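(* The following two statements hold. (1) For each $(h_1,h_2)\in(\mathcal D\cap\mathcal B)\cup((\partial\mathcal C)\cap\mathcal B\cap\mathcal H)$ and each $0<p<1$, $$J(h_1,h_2)=\{z_0\in\hat{\mathbb C}:\text{for each neighborhood }U\text{ of }z_0,\ z\mapsto T(h_1,h_2,p,z)\text{ is not constant on }U\}.$$ (2) Let $(h_1,h_2)\in(\partial\mathcal C)\cap\mathcal B\cap\mathcal H$ and let $0<p<1$. Then the function $z\mapsto T(h_1,h_2,p,z)$ is continuous on $\hat{\mathbb C}$ if and only if $J(h_1)\cap J(h_2)=\emptyset$.
   Context: $\hat{\mathbb C}$ is the Riemann sphere with spherical distance $d$. $\mathcal P$ is the set of all polynomial maps $g:\hat{\mathbb C}\to\hat{\mathbb C}$ with $\deg(g)\ge2$, with metric $\kappa(f,g)=\sup_{z\in\hat{\mathbb C}}d(f(z),g(z))$; $\mathcal P^2=\mathcal P\times\mathcal P$ has the product topology; boundaries $\partial$ of subsets of $\mathcal P^2$ are taken in $\mathcal P^2$. A polynomial semigroup is a semigroup of non-constant polynomial maps under composition; $\langle h_1,\dots,h_m\rangle$ is the one generated by $h_1,\dots,h_m$. For a polynomial semigroup $G$: $F(G)$ is the maximal open subset of $\hat{\mathbb C}$ on which $G$ is equicontinuous with respect to $d$; $J(G)=\hat{\mathbb C}\setminus F(G)$; $P(G)=\overline{\bigcup_{g\in G}\mathrm{CV}(g)}$ (closure in $\hat{\mathbb C}$; $\mathrm{CV}(g)$ is the set of critical values of $g:\hat{\mathbb C}\to\hat{\mathbb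 C}$); $P^*(G)=P(G)\setminus\{\infty\}$; $G$ is hyperbolic if $P(G)\subset F(G)$. Write $J(h_1,\dots,h_m)=J(\langle h_1,\dots,h_m\rangle)$, etc. $\mathcal B=\{(h_1,h_2)\in\mathcal P^2:P^*(h_1,h_2)\text{ is bounded in }\mathbb C\}$; $\mathcal C=\{(h_1,h_2)\in\mathcal P^2:J(h_1,h_2)\text{ is connected}\}$; $\mathcal D=\{(h_1,h_2)\in\mathcal P^2:J(h_1,h_2)\text{ is disconnected}\}$; $\mathcal H=\{(h_1,h_2)\in\mathcal P^2:\langle h_1,h_2\rangle\text{ is hyperbolic}\}$. Probability of tending to $\infty$: for $(h_1,h_2)\in\mathcal P^2$, $p\in(0,1)$, $z\in\hat{\mathbb C}$, let $\tau_{h_1,h_2,p}=p\delta_{h_1}+(1-p)\delta_{h_2}$ ($\delta_{h_i}$ the Dirac measure at $h_i$), $\tilde\tau_{h_1,h_2,p}=\otimes_{n=1}^\infty\tau_{h_1,h_2,p}$ on $\{h_1,h_2\}^{\mathbb N}$, and $$T(h_1,h_2,p,z)=\tilde\tau_{h_1,h_2,p}(\{\gamma\in\{h_1,h_2\}^{\mathbb N}:\gamma_n\circ\cdots\circ\gamma_1(z)\to\infty\text{ as }n\to\infty\}).$$ *)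

theory Defs
  imports "HOL-Probability.Probability" "HOL-Computational_Algebra.Polynomial"
begin

datatype riemann_sphere = Fin complex | Infty

fun stereo :: "riemann_sphere \<Rightarrow> complex \<times> real" where
  "stereo (Fin z) = ((2 / (1 + (cmod z)\<^sup>2)) *\<^sub>R z, ((cmod z)\<^sup>2 - 1) / ((cmod z)\<^sup>2 + 1))"
| "stereo Infty = (0, 1)"

lemma norm_stereo [simp]: "norm (stereo x) = 1"
proof (cases x)
  case (Fin z)
  define t where "t = (cmod z)\<^sup>2"
  have t: "t \<ge> 0" by (simp add: t_def)
  have "(norm (stereo x))\<^sup>2 = (2 / (1 + t))\<^sup>2 * t + ((t - 1) / (t + 1))\<^sup>2"
    using t by (simp add: Fin norm_prod_def power_mult_distrib t_def[symmetric] power_divide)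
  also have "\<dots> = (4 * t + (t - 1)\<^sup>2) / (1 + t)\<^sup>2"
    by (simp add: power_divide add.commute add_divide_distrib)
  also have "4 * t + (t - 1)\<^sup>2 = (1 + t)\<^sup>2"
    by (simp add: power2_eq_square algebra_simps)
  also have "(1 + t)\<^sup>2 / (1 + t)\<^sup>2 = 1" using t by simp
  finally show ?thesis
    using norm_ge_zero power2_eq_1_iff by (smt (verit))
next
  case Infty
  then show ?thesis by (simp add: norm_prod_def)
qed

lemma inj_stereo: "inj stereo"
proof (rule injI)
  have fin: "snd (stereo (Fin z)) = 1 - 2 / (1 + (cmod z)\<^sup>2)" for z
    by (simp add: field_simps add_pos_nonneg add_nonneg_eq_0_iff)
  have pos: "1 + (cmod z)\<^sup>2 > 0" for z by (simp add: add_pos_nonneg)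
  have ne: "snd (stereo (Fin z)) \<noteq> 1" for z
    using pos[of z] unfolding fin by simp
  fix x y assume eq: "stereo x = stereo y"
  show "x = y"
  proof (cases x; cases y)
    fix z w assume xy: "x = Fin z" "y = Fin w"
    have "2 / (1 + (cmod z)\<^sup>2) = 2 / (1 + (cmod w)\<^sup>2)"
      using eq fin[of z] fin[of w] xy by (metis add_diff_cancel_left diff_add_cancel diff_diff_eq2)
    moreover have "(2 / (1 + (cmod z)\<^sup>2)) *\<^sub>R z = (2 / (1 + (cmod w)\<^sup>2)) *\<^sub>R w"
      using eq xy by simp
    ultimately show ?thesis using pos[of z] xy
      by (metis divide_eq_0_iff less_irrefl scaleR_cancel_left zero_neq_numeral)
  qed (use eq ne in \<open>metis snd_conv stereo.simps(2)\<close>)+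
qed

lemma arccos_inner_triangle:
  fixes u v w :: "'a::real_inner"
  assumes "norm u = 1" "norm v = 1" "norm w = 1"
  shows "arccos (u \<bullet> w) \<le> arccos (u \<bullet> v) + arccos (v \<bullet> w)"
proof -
  have b: "-1 \<le> x \<bullet> y" "x \<bullet> y \<le> 1" if "norm x = 1" "norm y = 1" for x y :: 'a
    using Cauchy_Schwarz_ineq2[of x y] that by (auto simp: abs_le_iff)
  define a c where "a = u \<bullet> v" and "c = v \<bullet> w"
  have ac: "-1 \<le> a" "a \<le> 1" "-1 \<le> c" "c \<le> 1" using b assms by (auto simp: a_def c_def)
  have one: "u \<bullet> u = 1" "v \<bullet> v = 1" "w \<bullet> w = 1"
    using assms by (simp_all add: power2_norm_eq_inner [symmetric])
  have n1: "(norm (u - a *\<^sub>R v))\<^sup>2 = 1 - a\<^sup>2"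
    unfolding power2_norm_eq_inner
    by (simp add: inner_diff_left inner_diff_right one inner_commute[of v u] a_def power2_eq_square)
  have n2: "(norm (w - c *\<^sub>R v))\<^sup>2 = 1 - c\<^sup>2"
    unfolding power2_norm_eq_inner
    by (simp add: inner_diff_left inner_diff_right one inner_commute[of w v] c_def power2_eq_square)
  have m1: "norm (u - a *\<^sub>R v) = sqrt (1 - a\<^sup>2)" and m2: "norm (w - c *\<^sub>R v) = sqrt (1 - c\<^sup>2)"
    using n1 n2 by (metis norm_ge_zero real_sqrt_unique)+
  have "(u - a *\<^sub>R v) \<bullet> (w - c *\<^sub>R v) = u \<bullet> w - a * c"
    by (simp add: inner_diff_left inner_diff_right one a_def c_def)
  then have "u \<bullet> w \<ge> a * c - sqrt (1 - a\<^sup>2) * sqrt (1 - c\<^sup>2)"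
    using Cauchy_Schwarz_ineq2[of "u - a *\<^sub>R v" "w - c *\<^sub>R v"] unfolding m1 m2 by linarith
  then have le: "cos (arccos a + arccos c) \<le> u \<bullet> w"
    using ac by (simp add: cos_add sin_arccos)
  show ?thesis
  proof (cases "arccos a + arccos c \<le> pi")
    case True
    have "arccos (u \<bullet> w) \<le> arccos (cos (arccos a + arccos c))"
      by (rule arccos_le_arccos) (use le b assms in auto)
    also have "\<dots> = arccos a + arccos c"
      using True ac by (intro arccos_cos) (auto simp: arccos_lbound)
    finally show ?thesis by (simp add: a_def c_def)
  next
    case False
    then show ?thesis
      using arccos_ubound[of "u \<bullet> w"] b[OF assms(1,3)] by (simp add: a_def c_def)
  qed
qed

text \<open>The distance is the geodesic distance on the unit sphere.\<close>

instantiation riemann_sphere :: metric_space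
begin

definition dist_riemann_sphere :: "riemann_sphere \<Rightarrow> riemann_sphere \<Rightarrow> real" where
  "dist_riemann_sphere x y = arccos (stereo x \<bullet> stereo y)"

definition uniformity_riemann_sphere :: "(riemann_sphere \<times> riemann_sphere) filter" where
  "uniformity_riemann_sphere = (INF e\<in>{0<..}. principal {(x, y). dist x y < e})"

definition open_riemann_sphere :: "riemann_sphere set \<Rightarrow> bool" where
  "open_riemann_sphere U \<longleftrightarrow> (\<forall>x\<in>U. \<forall>\<^sub>F (x', y) in uniformity. x' = x \<longrightarrow> y \<in> U)"

instance
proof
  fix x y z :: riemann_sphere
  have b: "-1 \<le> stereo x \<bullet> stereo y" "stereo x \<bullet> stereo y \<le> 1"
    using Cauchy_Schwarz_ineq2[of "stereo x" "stereo y"] by (auto simp: abs_le_iff)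
  have "dist x y = 0 \<longleftrightarrow> stereo x \<bullet> stereo y = 1"
    unfolding dist_riemann_sphere_def using b by (metis arccos_1 cos_arccos cos_zero)
  also have "\<dots> \<longleftrightarrow> stereo x = stereo y"
  proof
    assume "stereo x \<bullet> stereo y = 1"
    moreover have "(norm (stereo x - stereo y))\<^sup>2
        = (norm (stereo x))\<^sup>2 + (norm (stereo y))\<^sup>2 - 2 * (stereo x \<bullet> stereo y)"
      unfolding power2_norm_eq_inner
      by (simp add: inner_diff_left inner_diff_right inner_commute)
    ultimately show "stereo x = stereo y" by simp
  qed (simp add: power2_norm_eq_inner [symmetric])
  finally show "dist x y = 0 \<longleftrightarrow> x = y" using inj_stereo by (simp add: inj_eq)
  have "arccos (stereo x \<bullet> stereo y) \<le> arccos (stereo x \<bullet> stereo z) + arccos (stereo z \<bullet> stereo y)"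
    by (rule arccos_inner_triangle) simp_all
  then show "dist x y \<le> dist x z + dist y z"
    by (simp add: dist_riemann_sphere_def inner_commute)
qed (simp_all only: uniformity_riemann_sphere_def open_riemann_sphere_def)

end

lemma dist_riemann_sphere_le_pi: "dist (x::riemann_sphere) y \<le> pi"
  using Cauchy_Schwarz_ineq2[of "stereo x" "stereo y"]
  by (auto simp: dist_riemann_sphere_def abs_le_iff intro: arccos_ubound)

fun poly_map :: "complex poly \<Rightarrow> riemann_sphere \<Rightarrow> riemann_sphere" where
  "poly_map q (Fin z) = Fin (poly q z)"
| "poly_map q Infty = (if degree q = 0 then Fin (coeff q 0) else Infty)"

definition poly_maps :: "(riemann_sphere \<Rightarrow> riemann_sphere) set" where
  "poly_maps = {poly_map q | q. degree q \<ge> 2}"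

definition kappa :: "(riemann_sphere \<Rightarrow> riemann_sphere) \<Rightarrow> (riemann_sphere \<Rightarrow> riemann_sphere) \<Rightarrow> real" where
  "kappa f g = (SUP z. dist (f z) (g z))"

lemma Metric_space_poly_maps: "Metric_space poly_maps kappa"
proof -
  have bdd: "bdd_above (range (\<lambda>z. dist (f z) (g z)))" for f g :: "riemann_sphere \<Rightarrow> riemann_sphere"
    by (rule bdd_aboveI2[where M = pi]) (rule dist_riemann_sphere_le_pi)
  have le: "dist (f z) (g z) \<le> kappa f g" for f g z
    unfolding kappa_def by (rule cSUP_upper[OF _ bdd]) simp
  show ?thesis
  proof
    fix f g :: "riemann_sphere \<Rightarrow> riemann_sphere"
    show "0 \<le> kappa f g" using le[of f Infty g] by (meson order_trans zero_le_dist)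
    show "kappa f g = kappa g f" by (simp add: kappa_def dist_commute)
    show "kappa f g = 0 \<longleftrightarrow> f = g"
    proof
      assume "kappa f g = 0"
      then have "f z = g z" for z using le[of f z g] by simp
      then show "f = g" by auto
    qed (simp add: kappa_def)
  next
    fix f g h :: "riemann_sphere \<Rightarrow> riemann_sphere"
    have "dist (f z) (h z) \<le> kappa f g + kappa g h" for z
      using dist_triangle[of "f z" "h z" "g z"] le[of f z g] le[of g z h] by linarith
    then show "kappa f h \<le> kappa f g + kappa g h"
      by (subst kappa_def) (rule cSUP_least, auto)
  qed
qed

definition poly_maps2_topology ::
    "((riemann_sphere \<Rightarrow> riemann_sphere) \<times> (riemann_sphere \<Rightarrow> riemann_sphere)) topology" where
  "poly_maps2_topology = prod_topology (Metric_space.mtopology poly_maps kappa)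
                                       (Metric_space.mtopology poly_maps kappa)"

lemma topspace_poly_maps2_topology: "topspace poly_maps2_topology = poly_maps \<times> poly_maps"
  by (simp add: poly_maps2_topology_def Metric_space.topspace_mtopology[OF Metric_space_poly_maps])

inductive_set generated_semigroup :: "('a \<Rightarrow> 'a) set \<Rightarrow> ('a \<Rightarrow> 'a) set"
  for S :: "('a \<Rightarrow> 'a) set" where
  gen: "h \<in> S \<Longrightarrow> h \<in> generated_semigroup S"
| comp: "f \<in> generated_semigroup S \<Longrightarrow> g \<in> generated_semigroup S \<Longrightarrow> f \<circ> g \<in> generated_semigroup S"

definition equicontinuous_on ::
    "'a::metric_space set \<Rightarrow> ('a \<Rightarrow> 'b::metric_space) set \<Rightarrow> bool" where
  "equicontinuous_on U G \<longleftrightarrow>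
     (\<forall>x\<in>U. \<forall>e>0. \<exists>d>0. \<forall>g\<in>G. \<forall>y\<in>U. dist y x < d \<longrightarrow> dist (g y) (g x) < e)"

definition Fatou :: "(riemann_sphere \<Rightarrow> riemann_sphere) set \<Rightarrow> riemann_sphere set" where
  "Fatou G = \<Union>{U. open U \<and> equicontinuous_on U G}"

lemma Fatou_maximal:
  "open (Fatou G)" "equicontinuous_on (Fatou G) G"
  "open U \<Longrightarrow> equicontinuous_on U G \<Longrightarrow> U \<subseteq> Fatou G"
proof -
  show "open (Fatou G)" unfolding Fatou_def by auto
  show "equicontinuous_on (Fatou G) G"
    unfolding equicontinuous_on_def
  proof (intro ballI allI impI)
    fix x and e :: real assume "x \<in> Fatou G" "e > 0"
    then obtain U where U: "open U" "equicontinuous_on U G" "x \<in> U" by (auto simp: Fatou_def)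
    obtain r where r: "r > 0" "\<And>y. dist y x < r \<Longrightarrow> y \<in> U"
      using U unfolding open_dist by blast
    obtain d where d: "d > 0" "\<forall>g\<in>G. \<forall>y\<in>U. dist y x < d \<longrightarrow> dist (g y) (g x) < e"
      using U \<open>e > 0\<close> unfolding equicontinuous_on_def by meson
    show "\<exists>d>0. \<forall>g\<in>G. \<forall>y\<in>Fatou G. dist y x < d \<longrightarrow> dist (g y) (g x) < e"
      by (rule exI[of _ "min r d"]) (use r d in auto)
  qed
  show "open U \<Longrightarrow> equicontinuous_on U G \<Longrightarrow> U \<subseteq> Fatou G" by (auto simp: Fatou_def)
qed

definition Julia :: "(riemann_sphere \<Rightarrow> riemann_sphere) set \<Rightarrow> riemann_sphere set" where
  "Julia G = - Fatou G"

text \<open>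
  The standard holomorphic charts: the identity coordinate at a finite point and
  \<open>1/z\<close> at infinity. The value of the first chart at infinity, and of the second one at 0,
  is irrelevant: the derivative below is only taken for maps that are continuous on the sphere.
\<close>

fun chart :: "riemann_sphere \<Rightarrow> riemann_sphere \<Rightarrow> complex" where
  "chart (Fin a) (Fin z) = z"
| "chart (Fin a) Infty = 0"
| "chart Infty (Fin z) = inverse z"
| "chart Infty Infty = 0"

fun chart_inv :: "riemann_sphere \<Rightarrow> complex \<Rightarrow> riemann_sphere" where
  "chart_inv (Fin a) z = Fin z"
| "chart_inv Infty z = (if z = 0 then Infty else Fin (inverse z))"

definition critical_point :: "(riemann_sphere \<Rightarrow> riemann_sphere) \<Rightarrow> riemann_sphere \<Rightarrow> bool" where
  "critical_point g a \<longleftrightarrow>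
     ((\<lambda>z. chart (g a) (g (chart_inv a z))) has_field_derivative 0) (at (chart a a))"

definition CV :: "(riemann_sphere \<Rightarrow> riemann_sphere) \<Rightarrow> riemann_sphere set" where
  "CV g = g ` {a. critical_point g a}"

definition postcritical :: "(riemann_sphere \<Rightarrow> riemann_sphere) set \<Rightarrow> riemann_sphere set" where
  "postcritical G = closure (\<Union>g\<in>G. CV g)"

definition postcritical_fin :: "(riemann_sphere \<Rightarrow> riemann_sphere) set \<Rightarrow> riemann_sphere set" where
  "postcritical_fin G = postcritical G - {Infty}"

definition hyperbolic :: "(riemann_sphere \<Rightarrow> riemann_sphere) set \<Rightarrow> bool" where
  "hyperbolic G \<longleftrightarrow> postcritical G \<subseteq> Fatou G"

type_synonym map_pair = "(riemann_sphere \<Rightarrow> riemann_sphere) \<times> (riemann_sphere \<Rightarrow> riemann_sphere)"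

definition setB :: "map_pair set" where
  "setB = {(h1, h2) \<in> poly_maps \<times> poly_maps.
             bounded {z. Fin z \<in> postcritical_fin (generated_semigroup {h1, h2})}}"

definition setC :: "map_pair set" where
  "setC = {(h1, h2) \<in> poly_maps \<times> poly_maps. connected (Julia (generated_semigroup {h1, h2}))}"

definition setD :: "map_pair set" where
  "setD = {(h1, h2) \<in> poly_maps \<times> poly_maps. \<not> connected (Julia (generated_semigroup {h1, h2}))}"

definition setH :: "map_pair set" where
  "setH = {(h1, h2) \<in> poly_maps \<times> poly_maps. hyperbolic (generated_semigroup {h1, h2})}"

text \<open>
  The measure \<open>p \<delta>\<^bsub>h1\<^esub> + (1 - p) \<delta>\<^bsub>h2\<^esub>\<close>, living on the set \<open>{h1, h2}\<close> itself
  rather than on the whole type: otherwise the event in \<open>tend_prob\<close> need not be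
  measurable in the product. The case \<open>h1 = h2\<close> is allowed.
\<close>

definition tau :: "'a \<Rightarrow> 'a \<Rightarrow> real \<Rightarrow> 'a measure" where
  "tau h1 h2 p = point_measure {h1, h2}
     (\<lambda>g. ennreal (p * indicator {h1} g + (1 - p) * indicator {h2} g))"

lemma emeasure_tau:
  assumes "0 < p" "p < 1" "A \<subseteq> {h1, h2}"
  shows "emeasure (tau h1 h2 p) A = ennreal (p * indicator A h1 + (1 - p) * indicator A h2)"
proof -
  have fin: "finite A" using assms(3) finite_subset by auto
  have "emeasure (tau h1 h2 p) A
      = (\<Sum>g\<in>A. ennreal (p * indicator {h1} g + (1 - p) * indicator {h2} g))"
    unfolding tau_def using assms(3) fin by (intro emeasure_point_measure_finite) auto
  also have "\<dots> = ennreal (\<Sum>g\<in>A. p * indicator {h1} g + (1 - p) * indicator {h2} g)"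
    using assms by (intro sum_ennreal) (auto simp: indicator_def)
  also have "(\<Sum>g\<in>A. p * indicator {h1} g + (1 - p) * indicator {h2} g)
      = p * indicator A h1 + (1 - p) * indicator A h2"
    using fin by (simp add: sum.distrib sum_distrib_left [symmetric] indicator_def if_distrib
        cong: if_cong)
  finally show ?thesis .
qed

text \<open>\<open>random_orbit \<gamma> n z\<close> is \<open>\<gamma>\<^sub>n (\<dots> (\<gamma>\<^sub>1 z))\<close>; the letter \<open>\<gamma>\<^sub>k\<close> is \<open>\<gamma> (k - 1)\<close>.\<close>

primrec random_orbit :: "(nat \<Rightarrow> 'a \<Rightarrow> 'a) \<Rightarrow> nat \<Rightarrow> 'a \<Rightarrow> 'a" where
  "random_orbit \<gamma> 0 z = z"
| "random_orbit \<gamma> (Suc n) z = \<gamma> n (random_orbit \<gamma> n z)"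

definition tend_prob ::
    "(riemann_sphere \<Rightarrow> riemann_sphere) \<Rightarrow> (riemann_sphere \<Rightarrow> riemann_sphere) \<Rightarrow> real \<Rightarrow> riemann_sphere \<Rightarrow> real"
  where
  "tend_prob h1 h2 p z =
     (let M = PiM (UNIV :: nat set) (\<lambda>_. tau h1 h2 p)
      in measure M {\<gamma> \<in> space M. (\<lambda>n. random_orbit \<gamma> n z) \<longlonglongrightarrow> Infty})"

end

theory Submission
  imports Defs "HOL-Complex_Analysis.Complex_Analysis"
    "HOL-Computational_Algebra.Fundamental_Theorem_Algebra"
begin

text \<open>
  Let \<open>K\<^sub>1\<close>, \<open>K\<^sub>2\<close> be the filled Julia sets of \<open>h\<^sub>1\<close>, \<open>h\<^sub>2\<close>, and let \<open>T\<close> be the probability of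
  tending to infinity. Both statements follow from one relation between the generators, called
  \<open>ordered\<close> below: \<open>K\<^sub>1 \<subseteq> K\<^sub>2\<close>, and \<open>h\<^sub>1 z \<in> K\<^sub>2\<close> implies \<open>h\<^sub>2 z \<in> K\<^sub>1\<close>. Then \<open>K\<^sub>1\<close> and the complement
  of \<open>K\<^sub>2\<close> are mapped into themselves by both generators, so \<open>T = 0\<close> on \<open>K\<^sub>1\<close>. On the Fatou set \<open>T\<close> is
  locally constant, because equicontinuity decides the fate of all random orbits near a point at
  once; the complement of \<open>K\<^sub>2\<close> is a connected part of the Fatou set by Montel's theorem, so \<open>T = 1\<close>
  there.

  Statement (1) for an ordered pair (\<open>ordered_Julia_eq\<close>). A neighbourhood of a Julia point contains, by
  Montel's theorem, points \<open>z\<close> and \<open>z'\<close> such that some word \<open>g\<close> in the generators satisfies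
  \<open>g z \<in> K\<^sub>1\<close> and \<open>g z' \<notin> K\<^sub>1\<close>. Then \<open>T z < T z'\<close>: read \<open>g\<close> letter by letter; at each step the other letter either sends the orbit
  of \<open>z\<close> into \<open>K\<^sub>1\<close>, where \<open>T = 0\<close>, or sends the orbit of \<open>z'\<close> outside \<open>K\<^sub>2\<close>, where \<open>T = 1\<close>, so it can
  only help the inequality.

  Statement (2) for an ordered pair (\<open>ordered_continuous_iff\<close>). At a common point of \<open>J(h\<^sub>1)\<close> and
  \<open>J(h\<^sub>2)\<close> the value is 0, and the value 1 occurs arbitrarily close. If there is no common point, then
  from every point some word of length two leads into the Fatou set. Since \<open>T\<close> is the average of its
  pullbacks under the four words of length two, its oscillation is everywhere at most a fixed
  fraction of its largest oscillation, hence it vanishes.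

  Pairs with disconnected Julia set (\<open>disconnected_imp_ordered\<close>). If the postcritical set is bounded,
  the preimages of \<open>K\<^sub>1\<close> and \<open>K\<^sub>2\<close> under words are compact connected sets with connected complement. Their
  frontiers are connected subsets of the Julia set, with dense union, so a separation of the Julia set
  must separate some of them. If the pair is not ordered, in either order, one finds arbitrarily long
  words \<open>g\<close> such that the frontiers of \<open>g\<^sup>-\<^sup>1(K\<^sub>1)\<close> and \<open>g\<^sup>-\<^sup>1(K\<^sub>2)\<close> are nested and stay a distance apart
  that does not depend on \<open>g\<close>. This is impossible: for fixed \<open>\<lambda> > 1\<close> the dilate of the inner set by
  \<open>\<lambda>\<close> lies inside the outer one, and comparing \<open>g(z) - a\<close> with \<open>g(z/\<lambda>) - a\<close> by the maximum
  principle up to infinity bounds \<open>\<lambda>\<close> to the power of the degree of \<open>g\<close>.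

  Boundary pairs (\<open>disconnected_limit_imp_ordered\<close>). Such a pair is a limit of pairs with disconnected
  Julia set. For a hyperbolic pair with bounded postcritical set, long words contract a neighbourhood
  of the finite part of the postcritical set (\<open>contraction_near_Pc\<close>); this neighbourhood remains a
  trap for nearby pairs, so these have bounded postcritical sets, and those with disconnected Julia
  set are ordered up to exchange of the generators. The filled Julia sets vary semicontinuously, so the relation passes to the limit. The contraction holds
  since otherwise some words would converge to the identity on a disc (\<open>expanding_orbit_impossible\<close>).
  That convergence spreads over the whole plane, by equicontinuity at postcritical points and by
  inverse branches elsewhere, and this contradicts the growth of the words near infinity
  (\<open>no_identity_limit\<close>).
\<close>

section \<open>Complex polynomials as open proper maps\<close>

lemma deriv_poly [simp]: "deriv (poly f) z = poly (pderiv f) (z::complex)"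
  by (rule DERIV_imp_deriv) (rule poly_DERIV)

lemma poly_not_constant_on:
  fixes f :: "complex poly"
  assumes "degree f > 0" "open U" "U \<noteq> {}"
  shows "\<not> poly f constant_on U"
proof
  assume "poly f constant_on U"
  then obtain c where c: "\<And>z. z \<in> U \<Longrightarrow> poly f z = c" by (auto simp: constant_on_def)
  have "U \<subseteq> {z. poly (f - [:c:]) z = 0}" using c by auto
  moreover have "infinite U"
    using assms by (meson finite_imp_not_open)
  moreover have "f - [:c:] \<noteq> 0" using assms(1) by auto
  ultimately show False using poly_roots_finite finite_subset by blast
qed

lemma open_poly_image:
  fixes f :: "complex poly"
  assumes "degree f > 0" "open U"
  shows "open (poly f ` U)"
  by (rule open_mapping_thm[of "poly f" UNIV])
     (use assms poly_not_constant_on[of f UNIV] in \<open>auto intro: holomorphic_intros\<close>)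

lemma interior_poly_vimage:
  fixes f :: "complex poly"
  assumes "degree f > 0"
  shows "interior (poly f -` S) = poly f -` interior S"
proof
  show "interior (poly f -` S) \<subseteq> poly f -` interior S"
  proof
    fix x assume x: "x \<in> interior (poly f -` S)"
    have "poly f ` interior (poly f -` S) \<subseteq> interior S"
      by (rule interior_maximal) (use assms open_poly_image interior_subset in blast)+
    then show "x \<in> poly f -` interior S" using x by auto
  qed
  show "poly f -` interior S \<subseteq> interior (poly f -` S)"
    by (rule interior_maximal)
       (use interior_subset in \<open>auto intro!: open_vimage continuous_intros\<close>)
qed

lemma closure_poly_vimage:
  fixes f :: "complex poly"
  assumes "degree f > 0"
  shows "closure (poly f -` S) = poly f -` closure S"
  using interior_poly_vimage[OF assms, of "-S"] by (auto simp: closure_interior vimage_Compl)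

lemma frontier_poly_vimage:
  fixes f :: "complex poly"
  assumes "degree f > 0"
  shows "frontier (poly f -` S) = poly f -` frontier S"
  unfolding frontier_def using interior_poly_vimage[OF assms] closure_poly_vimage[OF assms] by auto

lemma poly_cmod_large:
  fixes f :: "complex poly"
  assumes "degree f > 0"
  obtains \<rho> where "\<rho> > 0" "\<And>z. cmod z \<ge> \<rho> \<Longrightarrow> cmod (poly f z) > M"
proof -
  have "filterlim (poly f) at_infinity at_infinity" using assms by (rule filterlim_poly_at_infinity)
  then have "eventually (\<lambda>z. cmod (poly f z) \<ge> M + 1) at_infinity"
    using filterlim_at_infinity[of 0 "poly f"] by (metis (full_types) filterlim_at_infinity_imp_eventually_ne
       filterlim_at_infinity_conv_norm_at_top filterlim_at_top)
  then obtain b where b: "\<And>z. cmod z \<ge> b \<Longrightarrow> cmod (poly f z) \<ge> M + 1"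
    unfolding eventually_at_infinity by auto
  show ?thesis
  proof (rule that[of "max b 1"])
    show "cmod (poly f z) > M" if "cmod z \<ge> max b 1" for z using b[of z] that by auto
  qed auto
qed

lemma bounded_poly_vimage:
  fixes f :: "complex poly"
  assumes "degree f > 0" "bounded S"
  shows "bounded (poly f -` S)"
proof -
  obtain M where M: "\<And>z. z \<in> S \<Longrightarrow> cmod z \<le> M" using assms(2) by (auto simp: bounded_iff)
  obtain \<rho> where "\<rho> > 0" "\<And>z. cmod z \<ge> \<rho> \<Longrightarrow> cmod (poly f z) > M"
    using poly_cmod_large[OF assms(1)] by metis
  then have "\<forall>z\<in>poly f -` S. cmod z \<le> \<rho>" using M by (metis linorder_not_le nle_le vimageE)
  then show ?thesis by (auto simp: bounded_iff)
qed

lemma compact_poly_vimage: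
  fixes f :: "complex poly"
  assumes "degree f > 0" "compact S"
  shows "compact (poly f -` S)"
  using assms bounded_poly_vimage[OF assms(1)]
  by (auto simp: compact_eq_bounded_closed intro!: closed_vimage continuous_intros)

lemma poly_surj:
  fixes f :: "complex poly"
  assumes "degree f > 0"
  shows "\<exists>z. poly f z = c"
proof -
  have "degree (f - [:c:]) = degree f"
    using assms by (metis degree_pCons_0 degree_add_eq_left degree_minus diff_conv_add_uminus)
  then have "\<exists>z. poly (f - [:c:]) z = 0"
    using assms by (intro fundamental_theorem_of_algebra) (simp add: constant_degree)
  then show ?thesis by auto
qed

text \<open>
  The inverse is defined on a whole disc and \<open>N\<close> is its image; so intersections of \<open>N\<close> with
  preimages of convex sets are connected.
\<close>

lemma poly_local_inverse:
  fixes f :: "complex poly"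
  assumes "poly (pderiv f) x \<noteq> 0" "e > 0"
  obtains N r g where "open N" "x \<in> N" "N \<subseteq> ball x e" "r > 0" "continuous_on (ball (poly f x) r) g"
    "g ` ball (poly f x) r = N" "\<forall>y\<in>ball (poly f x) r. poly f (g y) = y"
    "\<forall>z\<in>N. g (poly f z) = z" "\<forall>z\<in>N. poly f z \<in> ball (poly f x) r"
proof -
  have hol: "poly f holomorphic_on ball x e" by (intro holomorphic_intros)
  obtain s where s: "s > 0" "ball x s \<subseteq> ball x e" "open (poly f ` ball x s)" "inj_on (poly f) (ball x s)"
    using has_complex_derivative_locally_invertible[OF hol, of x] assms by auto
  obtain g where g: "g holomorphic_on poly f ` ball x s" "\<And>z. z \<in> ball x s \<Longrightarrow> g (poly f z) = z"
    using holomorphic_has_inverse[of "poly f" "ball x s"] s by (metis hol holomorphic_on_subset open_ball)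
  obtain r where r: "r > 0" "ball (poly f x) r \<subseteq> poly f ` ball x s"
    using s by (meson centre_in_ball image_eqI openE)
  let ?B = "ball (poly f x) r"
  let ?N = "ball x s \<inter> poly f -` ?B"
  show ?thesis
  proof (rule that[of ?N r g])
    show "open ?N" by (intro open_Int open_vimage) (auto intro: continuous_intros)
    show "continuous_on ?B g" using g(1) r(2) holomorphic_on_imp_continuous_on holomorphic_on_subset by blast
    show "g ` ?B = ?N"
    proof
      show "g ` ?B \<subseteq> ?N" using r(2) g(2) by force
      show "?N \<subseteq> g ` ?B" using g(2) by (metis IntE image_eqI subsetI vimageE)
    qed
    show "\<forall>y\<in>?B. poly f (g y) = y" using r(2) g(2) by force
  qed (use s r g in auto)
qed

lemma poly_attains_min_max:
  fixes f :: "complex poly"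
  assumes "compact S" "S \<noteq> {}"
  obtains y y' where "y \<in> S" "\<And>x. x \<in> S \<Longrightarrow> cmod (poly f y) \<le> cmod (poly f x)"
    "y' \<in> S" "\<And>x. x \<in> S \<Longrightarrow> cmod (poly f x) \<le> cmod (poly f y')"
proof -
  have cont: "continuous_on S (\<lambda>z. cmod (poly f z))" by (intro continuous_intros)
  show ?thesis
    using continuous_attains_inf[OF assms cont] continuous_attains_sup[OF assms cont] that by blast
qed

section \<open>The maximum principle outside a compact set\<close>

text \<open>
  Here \<open>v / u\<close> tends to 0 at infinity, so infinity acts as a harmless boundary point.
\<close>

lemma max_principle_outside_strict:
  fixes u v :: "complex poly"
  assumes S: "compact S" and deg: "degree v < degree u" and M: "M > 0"
    and nz: "\<And>z. z \<notin> interior S \<Longrightarrow> poly u z \<noteq> 0"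
    and bd: "\<And>z. z \<in> frontier S \<Longrightarrow> cmod (poly v z) \<le> M * cmod (poly u z)"
    and z: "z \<notin> S"
  shows "cmod (poly v z) \<le> M * cmod (poly u z)"
proof -
  have "((\<lambda>x. poly v x / poly u x) \<longlongrightarrow> 0) at_infinity"
    using deg by (rule poly_divide_tendsto_0_at_infinity)
  then have "eventually (\<lambda>x. cmod (poly v x / poly u x) < M) at_infinity"
    using tendstoD[OF _ M, of "\<lambda>x. poly v x / poly u x" 0 at_infinity] by (simp add: dist_norm)
  then obtain b where b: "\<And>x. cmod x \<ge> b \<Longrightarrow> cmod (poly v x / poly u x) < M"
    unfolding eventually_at_infinity by auto
  define \<rho> where "\<rho> = max b (cmod z + 1)"
  let ?D = "(- S) \<inter> ball 0 \<rho>"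
  have opD: "open ?D" using S by (auto intro: compact_imp_closed)
  have clD: "closure ?D \<subseteq> - interior S"
    by (metis Int_lower1 closure_complement closure_mono)
  have "cmod (poly v z / poly u z) \<le> M"
  proof (rule maximum_modulus_frontier[of "\<lambda>z. poly v z / poly u z" ?D])
    show "(\<lambda>z. poly v z / poly u z) holomorphic_on interior ?D"
      using nz clD closure_subset interior_subset by (intro holomorphic_intros) blast
    show "continuous_on (closure ?D) (\<lambda>z. poly v z / poly u z)"
      using nz clD by (intro continuous_intros) blast
    show "bounded ?D" by (simp add: bounded_Int)
    show "z \<in> ?D" using z by (auto simp: \<rho>_def)
    fix w assume w: "w \<in> frontier ?D"
    show "cmod (poly v w / poly u w) \<le> M"
    proof (cases "cmod w \<ge> \<rho>")
      case True then show ?thesis using b[of w] by (simp add: \<rho>_def)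
    next
      case False
      have "w \<in> closure ?D" "w \<notin> ?D"
        using w interior_open[OF opD] unfolding frontier_def by blast+
      then have "w \<in> S" "w \<notin> interior S" using False clD by auto
      then have "w \<in> frontier S" using S by (simp add: frontier_def compact_imp_closed)
      then show ?thesis using bd[of w] nz[OF \<open>w \<notin> interior S\<close>] by (simp add: norm_divide divide_le_eq)
    qed
  qed
  moreover have "poly u z \<noteq> 0" using z interior_subset nz by blast
  ultimately show ?thesis by (simp add: norm_divide divide_le_eq)
qed

text \<open>
  For equal degrees \<open>v / u\<close> has a nonzero limit at infinity. Replacing the pair by \<open>v\<^sup>k\<close> and
  \<open>u\<^sup>k (z - c)\<close> restores a strict inequality of degrees at the cost of a factor that does not depend
  on \<open>k\<close>; this factor disappears when \<open>k\<close>-th roots are taken.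
\<close>

lemma max_principle_outside:
  fixes u v :: "complex poly"
  assumes S: "compact S" and deg: "degree v \<le> degree u" and M: "M > 0" and c: "c \<in> interior S"
    and nz: "\<And>z. z \<notin> interior S \<Longrightarrow> poly u z \<noteq> 0"
    and bd: "\<And>z. z \<in> frontier S \<Longrightarrow> cmod (poly v z) \<le> M * cmod (poly u z)"
    and z: "z \<notin> S"
  shows "cmod (poly v z) \<le> M * cmod (poly u z)"
proof -
  obtain e where e: "e > 0" "ball c e \<subseteq> interior S" using c by (meson open_contains_ball open_interior)
  have uz: "poly u z \<noteq> 0" using z interior_subset nz by blast
  have zc: "z \<noteq> c" using z c interior_subset by blast
  have u0: "u \<noteq> 0" using uz by auto
  define x where "x = cmod (poly v z) / (M * cmod (poly u z))"
  define C where "C = cmod (z - c) / e"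
  have Cpos: "C > 0" using zc e by (simp add: C_def)
  have xk: "x ^ k \<le> C" for k :: nat
  proof -
    \<comment> \<open>On the frontier of \<open>S\<close> the extra factor is at least \<open>e\<close> in modulus.\<close>
    let ?u = "u ^ k * [:-c, 1:]" and ?v = "v ^ k"
    have "cmod (poly ?v z) \<le> (M ^ k / e) * cmod (poly ?u z)"
    proof (rule max_principle_outside_strict[OF S])
      show "degree ?v < degree ?u"
        using deg u0 by (subst degree_mult_eq) (auto simp: degree_power_eq le_less_trans[OF degree_power_le] less_Suc_eq_le
            intro!: order.trans[OF degree_power_le])
      show "M ^ k / e > 0" using M e by simp
      show "poly ?u w \<noteq> 0" if "w \<notin> interior S" for w using nz[OF that] that c by auto
      fix w assume w: "w \<in> frontier S"
      have "w \<notin> ball c e" using e w by (auto simp: frontier_def)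
      then have we: "1 \<le> cmod (w - c) / e" using e by (simp add: dist_norm norm_minus_commute)
      have "cmod (poly ?v w) \<le> (M * cmod (poly u w)) ^ k"
        using bd[OF w] by (simp add: norm_power power_mono)
      also have "\<dots> \<le> (M * cmod (poly u w)) ^ k * (cmod (w - c) / e)"
        using we M mult_left_mono[OF we, of "(M * cmod (poly u w)) ^ k"] by simp
      also have "\<dots> = (M ^ k / e) * cmod (poly ?u w)"
      proof -
        have "poly ?u w = poly u w ^ k * (w - c)" by (simp add: algebra_simps)
        then show ?thesis by (simp add: norm_mult norm_power power_mult_distrib)
      qed
      finally show "cmod (poly ?v w) \<le> (M ^ k / e) * cmod (poly ?u w)" .
    qed (rule z)
    moreover have "poly ?u z = poly u z ^ k * (z - c)" by (simp add: algebra_simps)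
    ultimately have "cmod (poly v z) ^ k \<le> (M * cmod (poly u z)) ^ k * C"
      by (simp add: norm_mult norm_power power_mult_distrib C_def)
    then show ?thesis using M uz by (simp add: x_def power_divide divide_le_eq mult.commute)
  qed
  have "x \<le> 1"
  proof (rule ccontr)
    assume "\<not> x \<le> 1"
    then obtain n where "C < x ^ n" using real_arch_pow by (meson not_le)
    then show False using xk[of n] by simp
  qed
  then show ?thesis using M uz by (simp add: x_def divide_le_eq)
qed

section \<open>Connectedness of sublevel sets\<close>

text \<open>
  At a minimum of \<open>|f|\<close> over the piece that is not a zero, the open mapping theorem would produce a
  smaller value nearby, still inside the piece.
\<close>

lemma clopen_piece_contains_zero:
  fixes f :: "complex poly"
  assumes f: "degree f > 0" and Y: "closed Y" "closed Y'" "Y \<inter> Y' = {}" "Y \<noteq> {}" 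
    and L: "{z. cmod (poly f z) \<le> t} = Y \<union> Y'"
  shows "\<exists>z\<in>Y. poly f z = 0"
proof -
  have "{z. cmod (poly f z) \<le> t} = poly f -` cball 0 t" by auto
  then have "compact (Y \<union> Y')" using compact_poly_vimage[OF f, of "cball 0 t"] L by simp
  then have "compact Y" using Y(1) by (meson Un_upper1 bounded_subset compact_eq_bounded_closed)
  then obtain y where y: "y \<in> Y" "\<And>x. x \<in> Y \<Longrightarrow> cmod (poly f y) \<le> cmod (poly f x)"
    using poly_attains_min_max[OF _ Y(4), of f] by metis
  have "poly f y = 0"
  proof (rule ccontr)
    assume nz: "poly f y \<noteq> 0"
    have "open (- Y')" "y \<in> - Y'" using Y y by auto
    then have "open (poly f ` (- Y'))" "poly f y \<in> poly f ` (- Y')" using open_poly_image[OF f] by auto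
    then obtain e where e: "e > 0" "ball (poly f y) e \<subseteq> poly f ` (- Y')" by (meson openE)
    define s where "s = min (1/2) (e / (2 * cmod (poly f y)))"
    have s: "0 < s" "s < 1" "s * cmod (poly f y) < e" using nz e
      by (auto simp: s_def min_def field_simps)
    have "(1 - complex_of_real s) * poly f y \<in> ball (poly f y) e"
      using s by (simp add: dist_norm algebra_simps norm_mult)
    then obtain w where w: "w \<notin> Y'" "poly f w = (1 - complex_of_real s) * poly f y" using e by auto
    have "cmod (poly f w) = (1 - s) * cmod (poly f y)"
      using s unfolding w(2) norm_mult by (metis abs_of_nonneg diff_ge_0_iff_ge less_imp_le norm_of_real of_real_1 of_real_diff)
    also have "\<dots> < cmod (poly f y)" using s nz by (simp add: algebra_simps)
    finally have lt: "cmod (poly f w) < cmod (poly f y)" .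
    moreover have "cmod (poly f y) \<le> t" using y L by auto
    ultimately have "w \<in> Y" using L w by force
    then show False using y(2) lt by force
  qed
  then show ?thesis using y by auto
qed

lemma connected_closed_disconnect:
  fixes S :: "complex set"
  assumes "compact S" "\<not> connected S"
  obtains A B where "compact A" "compact B" "A \<noteq> {}" "B \<noteq> {}" "A \<inter> B = {}" "S = A \<union> B"
proof -
  obtain A B where "closed A" "closed B" "S \<subseteq> A \<union> B" "A \<inter> B \<inter> S = {}" "A \<inter> S \<noteq> {}" "B \<inter> S \<noteq> {}"
    using assms(2) unfolding connected_closed by blast
  then show ?thesis using assms(1) by (intro that[of "A \<inter> S" "B \<inter> S"]) (auto intro: closed_Int_compact)
qed

text \<open>
  Each piece of a separated sublevel set contains a zero, so a connected set through all zeros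
  prevents a separation.
\<close>

lemma connected_sublevel_if_zeros_joined:
  fixes f :: "complex poly"
  assumes f: "degree f > 0"
    and C: "connected C" "C \<subseteq> {z. cmod (poly f z) \<le> t}" "{z. poly f z = 0} \<subseteq> C"
  shows "connected {z. cmod (poly f z) \<le> t}"
proof (rule ccontr)
  assume L: "\<not> connected {z. cmod (poly f z) \<le> t}"
  have eq: "{z. cmod (poly f z) \<le> t} = poly f -` cball 0 t" by auto
  have "compact {z. cmod (poly f z) \<le> t}" unfolding eq by (rule compact_poly_vimage[OF f]) simp
  then obtain A B where AB: "compact A" "compact B" "A \<noteq> {}" "B \<noteq> {}" "A \<inter> B = {}" "{z. cmod (poly f z) \<le> t} = A \<union> B"
    using connected_closed_disconnect[OF _ L] by metis
  have "\<exists>z\<in>A. poly f z = 0" "\<exists>z\<in>B. poly f z = 0"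
    using clopen_piece_contains_zero[OF f, of A B t] clopen_piece_contains_zero[OF f, of B A t] AB
    by (auto simp: compact_imp_closed Un_commute Int_commute)
  then have "A \<inter> C \<noteq> {}" "B \<inter> C \<noteq> {}" using C(3) by auto
  then show False
    using C(1) AB C(2) connected_closedD[of C A B] by (auto simp: compact_imp_closed)
qed

text \<open>
  Let \<open>s\<close> be the supremum of the levels at least \<open>R\<close> whose sublevel set is disconnected. The set
  \<open>|f| \<le> s\<close> is connected, being a decreasing limit of connected ones, while \<open>|f| < s\<close> is not. So two
  open pieces of \<open>|f| < s\<close> touch at a point of level \<open>s\<close>. As critical values have smaller modulus,
  \<open>f\<close> is injective there, and near that point \<open>|f| < s\<close> looks like a disc cut by a disc: it is
  connected, which contradicts the touching of two pieces.
\<close>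

lemma connected_sublevel:
  fixes f :: "complex poly"
  assumes f: "degree f > 0" and R: "R > 0"
    and crit: "\<And>c. poly (pderiv f) c = 0 \<Longrightarrow> cmod (poly f c) < R"
  shows "connected {z. cmod (poly f z) \<le> R}"
proof (rule ccontr)
  assume notR: "\<not> connected {z. cmod (poly f z) \<le> R}"
  define L where "L t = {z. cmod (poly f z) \<le> t}" for t
  have Leq: "L t = poly f -` cball 0 t" for t by (auto simp: L_def)
  have cL: "compact (L t)" for t unfolding Leq by (rule compact_poly_vimage[OF f]) simp
  define T where "T = {t. t \<ge> R \<and> \<not> connected (L t)}"
  have RT: "R \<in> T" using notR by (simp add: T_def L_def)
  have "bounded (L 0)" using cL compact_imp_bounded by blast
  then obtain a where a: "\<And>z. z \<in> L 0 \<Longrightarrow> cmod z \<le> a" by (auto simp: bounded_iff)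
  have "bounded (poly f ` cball 0 a)"
    by (intro compact_imp_bounded compact_continuous_image) (auto intro: continuous_intros)
  then obtain m where m: "\<And>z. z \<in> cball 0 a \<Longrightarrow> cmod (poly f z) \<le> m"
    unfolding bounded_iff by blast
  \<comment> \<open>Sublevel sets that contain a disc around all zeros are connected.\<close>
  have bT: "t \<le> m" if "t \<in> T" for t
  proof (rule ccontr)
    assume "\<not> t \<le> m"
    then show False using connected_sublevel_if_zeros_joined[OF f, of "cball 0 a" t] that m a
      by (force simp: T_def L_def)
  qed
  then have bdd: "bdd_above T" by (auto simp: bdd_above_def)
  define s where "s = Sup T"
  have sup: "\<And>t. t \<in> T \<Longrightarrow> t \<le> s" unfolding s_def by (rule cSup_upper[OF _ bdd])
  have sR: "s \<ge> R" using sup RT by blast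
  have conS: "connected (L s)"
  proof (rule ccontr)
    assume "\<not> connected (L s)"
    then obtain A B where AB: "compact A" "compact B" "A \<noteq> {}" "B \<noteq> {}" "A \<inter> B = {}" "L s = A \<union> B"
      using connected_closed_disconnect[OF cL] by metis
    obtain U V where UV: "open U" "open V" "A \<subseteq> U" "B \<subseteq> V" "U \<inter> V = {}"
      using separation_normal_compact[of A B] AB compact_imp_closed by (metis (no_types))
    have "compact (L (s+1) - (U \<union> V))" using cL UV by (intro compact_diff) auto
    have "\<exists>t>s. L t \<subseteq> U \<union> V"
    proof (cases "L (s+1) - (U \<union> V) = {}")
      case True then show ?thesis by (intro exI[of _ "s+1"]) auto
    next
      case False
      then obtain y where y: "y \<in> L (s+1) - (U \<union> V)" "\<And>x. x \<in> L (s+1) - (U \<union> V) \<Longrightarrow> cmod (poly f y) \<le> cmod (poly f x)"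
        using poly_attains_min_max[OF \<open>compact (L (s+1) - (U \<union> V))\<close> False, of f] by metis
      have "y \<notin> L s" using y AB UV by auto
      then have lt: "cmod (poly f y) > s" by (simp add: L_def)
      define t where "t = (s + min (s+1) (cmod (poly f y))) / 2"
      have t: "s < t" "t < s + 1" "t < cmod (poly f y)" using lt by (auto simp: t_def min_def)
      have "L t \<subseteq> U \<union> V" using y(2) t unfolding L_def by force
      then show ?thesis using t by blast
    qed
    then obtain t where t: "t > s" "L t \<subseteq> U \<union> V" by blast
    have "L s \<subseteq> L t" using t by (auto simp: L_def)
    then have "U \<inter> L t \<noteq> {}" "V \<inter> L t \<noteq> {}" using AB UV by auto
    then have "\<not> connected (L t)" using connectedD[of "L t" U V] UV t by blast
    then have "t \<in> T" using t sR by (auto simp: T_def)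
    then show False using sup t by force
  qed
  then have sT: "s \<notin> T" by (simp add: T_def)
  then have sR': "s > R" using sR RT by (metis less_eq_real_def)
  define W where "W = {z. cmod (poly f z) < s}"
  have Weq: "W = poly f -` ball 0 s" by (auto simp: W_def)
  have opW: "open W" unfolding Weq by (intro open_vimage) (auto intro: continuous_intros)
  have clW: "closure W = L s" unfolding Weq Leq using closure_poly_vimage[OF f, of "ball 0 s"] sR' R by simp
  have nW: "\<not> connected W"
  proof
    assume conW: "connected W"
    have fin: "finite {z. poly f z = 0}" using f by (intro poly_roots_finite) auto
    have subW: "{z. poly f z = 0} \<subseteq> W" using sR' R by (auto simp: W_def)
    \<comment> \<open>Paths joining the zeros inside \<open>W\<close> stay below some level less than \<open>s\<close>.\<close>
    obtain P where P: "compact P" "connected P" "{z. poly f z = 0} \<subseteq> P" "P \<subseteq> W"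
    proof -
      obtain z0 where z0: "poly f z0 = 0" using poly_surj[OF f] by blast
      have "path_connected W" using conW opW by (simp add: connected_open_path_connected)
      then have "\<forall>z\<in>{z. poly f z = 0}. \<exists>g. path g \<and> path_image g \<subseteq> W \<and> pathstart g = z0 \<and> pathfinish g = z"
        using z0 subW unfolding path_connected_def by blast
      then obtain g where g: "\<And>z. poly f z = 0 \<Longrightarrow> path (g z) \<and> path_image (g z) \<subseteq> W \<and> pathstart (g z) = z0 \<and> pathfinish (g z) = z"
        using bchoice[of "{z. poly f z = 0}" "\<lambda>z h. path h \<and> path_image h \<subseteq> W \<and> pathstart h = z0 \<and> pathfinish h = z"]
        by blast
      let ?P = "\<Union>z\<in>{z. poly f z = 0}. path_image (g z)"
      show ?thesis
      proof (rule that[of ?P])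
        show "compact ?P"
        proof (rule compact_UN[OF fin])
          fix z assume "z \<in> {z. poly f z = 0}"
          then have "path (g z)" using g by blast
          then show "compact (path_image (g z))" by (rule compact_path_image)
        qed
        show "connected ?P"
        proof (rule connected_Union, goal_cases)
          case (1 X) then show ?case using g by auto
        next
          case 2
          have "z0 \<in> path_image (g z)" if "poly f z = 0" for z using g[OF that] pathstart_in_path_image by metis
          then show ?case by blast
        qed
        show "{z. poly f z = 0} \<subseteq> ?P" using g pathfinish_in_path_image by fastforce
        show "?P \<subseteq> W" using g by auto
      qed
    qed
    have "P \<noteq> {}" using P poly_surj[OF f, of 0] by blast
    then obtain y where y: "y \<in> P" "\<And>x. x \<in> P \<Longrightarrow> cmod (poly f x) \<le> cmod (poly f y)"
      using poly_attains_min_max[OF P(1), of f] by metis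
    have "cmod (poly f y) < s" using y P by (auto simp: W_def)
    then obtain t where t: "t \<in> T" "cmod (poly f y) < t"
      using less_cSup_iff[of T "cmod (poly f y)"] RT bdd unfolding s_def by auto
    show False
      using connected_sublevel_if_zeros_joined[OF f, of P t] t P y(2) by (force simp: T_def L_def)
  qed
  then obtain U V where UV: "open U" "open V" "U \<inter> V \<inter> W = {}" "W \<subseteq> U \<union> V" "U \<inter> W \<noteq> {}" "V \<inter> W \<noteq> {}"
    unfolding connected_def by blast
  have "\<exists>x. x \<in> closure (U \<inter> W) \<inter> closure (V \<inter> W)"
  proof (rule ccontr)
    assume "\<nexists>x. x \<in> closure (U \<inter> W) \<inter> closure (V \<inter> W)"
    moreover have "closure (U \<inter> W) \<union> closure (V \<inter> W) = L s"
      using UV(4) clW by (metis Int_Un_distrib2 closure_Un inf.absorb2)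
    ultimately show False
      using conS UV(5,6) connected_closedD[of "L s" "closure (U \<inter> W)" "closure (V \<inter> W)"] closure_subset by fastforce
  qed
  then obtain x where x: "x \<in> closure (U \<inter> W)" "x \<in> closure (V \<inter> W)" by blast
  have xW: "x \<notin> W"
  proof
    assume "x \<in> W"
    then consider "x \<in> U \<inter> W" | "x \<in> V \<inter> W" using UV by blast
    then show False
    proof cases
      case 1
      then have "(U \<inter> W) \<inter> (V \<inter> W) \<noteq> {}" using x(2) opW UV by (metis open_Int open_Int_closure_eq_empty disjoint_iff)
      then show False using UV by blast
    next
      case 2
      then have "(V \<inter> W) \<inter> (U \<inter> W) \<noteq> {}" using x(1) opW UV by (metis open_Int open_Int_closure_eq_empty disjoint_iff)
      then show False using UV by blast
    qed
  qed
  then have "cmod (poly f x) \<ge> R" using sR' by (auto simp: W_def)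
  then have "poly (pderiv f) x \<noteq> 0" using crit by force
  then obtain N r g where N: "open N" "x \<in> N" and "N \<subseteq> ball x 1" and N': "r > 0" "continuous_on (ball (poly f x) r) g"
    "g ` ball (poly f x) r = N" "\<forall>y\<in>ball (poly f x) r. poly f (g y) = y"
    "\<forall>z\<in>N. g (poly f z) = z" "\<forall>z\<in>N. poly f z \<in> ball (poly f x) r"
    by (rule poly_local_inverse[OF _ zero_less_one])
  note N = N N'
  have "N \<inter> W = g ` (ball (poly f x) r \<inter> ball 0 s)"
  proof
    show "N \<inter> W \<subseteq> g ` (ball (poly f x) r \<inter> ball 0 s)"
    proof
      fix z assume "z \<in> N \<inter> W"
      then have "z = g (poly f z)" "poly f z \<in> ball (poly f x) r \<inter> ball 0 s" using N(7,8) by (auto simp: W_def)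
      then show "z \<in> g ` (ball (poly f x) r \<inter> ball 0 s)" by blast
    qed
    show "g ` (ball (poly f x) r \<inter> ball 0 s) \<subseteq> N \<inter> W" using N(5,6) by (auto simp: W_def)
  qed
  moreover have "connected (g ` (ball (poly f x) r \<inter> ball 0 s))"
    by (intro connected_continuous_image convex_connected convex_Int continuous_on_subset[OF N(4)]) auto
  ultimately have "connected (N \<inter> W)" by simp
  moreover have "N \<inter> (U \<inter> W) \<noteq> {}"
    using x(1) N(1,2) open_Int_closure_eq_empty[of N "U \<inter> W"] by blast
  moreover have "N \<inter> (V \<inter> W) \<noteq> {}"
    using x(2) N(1,2) open_Int_closure_eq_empty[of N "V \<inter> W"] by blast
  ultimately show False using UV(1-4) connectedD[of "N \<inter> W" U V] by blast
qed

text \<open>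
  By the maximum principle no component is bounded, and the unbounded ones meet in the neighbourhood
  of infinity.
\<close>

lemma connected_superlevel:
  fixes f :: "complex poly"
  assumes f: "degree f > 0" and R: "R > 0"
  shows "connected {z. cmod (poly f z) > R}"
proof -
  let ?U = "{z. cmod (poly f z) > R}"
  have opU: "open ?U" by (intro open_Collect_less continuous_intros)
  obtain \<rho> where \<rho>: "\<rho> > 0" "\<And>z. cmod z \<ge> \<rho> \<Longrightarrow> cmod (poly f z) > R" using poly_cmod_large[OF f] by metis
  have con: "connected (- cball (0::complex) \<rho>)"
    by (rule connected_complement_bounded_convex) auto
  have meets: "\<exists>w \<in> connected_component_set ?U z. cmod w > \<rho>" if z: "z \<in> ?U" for z
  proof (rule ccontr)
    let ?C = "connected_component_set ?U z"
    assume neg: "\<not> (\<exists>w \<in> ?C. cmod w > \<rho>)"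
    have bC: "bounded ?C" using neg by (auto simp: bounded_iff not_less intro!: exI[of _ \<rho>])
    have opC: "open ?C" using opU by (rule open_connected_component)
    have "cmod (poly f z) \<le> R"
    proof (rule maximum_modulus_frontier[of "poly f" ?C])
      show "z \<in> ?C" using z by simp
      fix w assume "w \<in> frontier ?C"
      then have "w \<notin> ?U" using frontier_of_connected_component_subset
        by (metis (no_types, lifting) DiffE frontier_def interior_open opU subsetD)
      then show "cmod (poly f w) \<le> R" by simp
    qed (use bC in \<open>auto intro: holomorphic_intros continuous_intros\<close>)
    then show False using z by simp
  qed
  have "connected_component ?U a b" if ab: "a \<in> ?U" "b \<in> ?U" for a b
  proof -
    obtain a' b' where a': "connected_component ?U a a'" "cmod a' > \<rho>" and b': "connected_component ?U b b'" "cmod b' > \<rho>"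
      using meets ab by (metis mem_Collect_eq)
    have "connected_component ?U a' b'"
      unfolding connected_component_def
      by (rule exI[of _ "- cball 0 \<rho>"]) (use con a' b' \<rho> in \<open>auto simp: dist_norm\<close>)
    then show ?thesis using a' b' by (meson connected_component_sym connected_component_trans)
  qed
  then show ?thesis using connected_iff_connected_component by blast
qed

section \<open>Nested plane continua\<close>

text \<open>
  The connected unbounded set \<open>- Y\<close> avoids the frontier of \<open>X\<close>, hence avoids \<open>X\<close>.
\<close>

lemma subset_of_frontier_subset:
  fixes X Y :: "complex set"
  assumes X: "compact X" and Y: "compact Y" "connected (- Y)" and sub: "frontier X \<subseteq> Y"
  shows "X \<subseteq> Y"
proof (rule ccontr)
  assume "\<not> X \<subseteq> Y"
  then have "(- Y) \<inter> X \<noteq> {}" by blast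
  moreover have "(- Y) - X \<noteq> {}"
  proof
    assume "(- Y) - X = {}"
    then have "UNIV = X \<union> Y" by auto
    moreover have "bounded (X \<union> Y)" using X Y by (simp add: compact_imp_bounded)
    ultimately show False using not_bounded_UNIV by metis
  qed
  ultimately have "(- Y) \<inter> frontier X \<noteq> {}" using connected_Int_frontier[OF Y(2)] by blast
  then show False using sub by blast
qed

lemma nested_continua:
  fixes X Y :: "complex set"
  assumes X: "compact X" "connected (frontier X)" and Y: "compact Y" "connected Y" "connected (- Y)"
    and XY: "X \<inter> Y \<noteq> {}" and disj: "frontier X \<inter> frontier Y = {}"
  shows "X \<subseteq> interior Y \<or> Y \<subseteq> interior X"
proof (cases "frontier X \<inter> Y = {}")
  case True
  then have "Y \<inter> frontier X = {}" by blast
  then have "Y \<subseteq> X" using connected_Int_frontier[OF Y(2), of X] XY by blast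
  then show ?thesis using True X(1) by (auto simp: frontier_def compact_imp_closed)
next
  case False
  then have "frontier X \<subseteq> Y" using connected_Int_frontier[OF X(2) False] disj by blast
  then have fr: "frontier X \<subseteq> interior Y" using disj Y(1) by (auto simp: frontier_def compact_imp_closed)
  have "X \<subseteq> Y" by (rule subset_of_frontier_subset) (use X Y \<open>frontier X \<subseteq> Y\<close> in auto)
  then have "interior X \<subseteq> interior Y" by (rule interior_mono)
  then show ?thesis using fr X(1) by (auto simp: frontier_def compact_imp_closed)
qed

section \<open>Holomorphic tools\<close>

lemma cauchy_deriv_bound:
  assumes hol: "f holomorphic_on ball y s" and s: "s > 0" and bd: "\<And>z. z \<in> ball y s \<Longrightarrow> cmod (f z) \<le> M"
  shows "cmod (deriv f y) \<le> 2 * M / s"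
proof -
  have sub: "cball y (s/2) \<subseteq> ball y s" using s by auto
  have "cmod ((deriv ^^ 1) f y) \<le> fact 1 * M / (s/2) ^ 1"
  proof (rule Cauchy_inequality)
    show "f holomorphic_on ball y (s/2)" using hol sub ball_subset_cball holomorphic_on_subset by blast
    show "continuous_on (cball y (s/2)) f"
      using hol sub holomorphic_on_imp_continuous_on continuous_on_subset by blast
  qed (use s bd sub in \<open>auto simp: dist_norm\<close>)
  then show ?thesis using s by (simp add: field_simps)
qed

lemma bounded_holomorphic_lipschitz:
  assumes hol: "f holomorphic_on ball x r" and r: "r > 0" and bd: "\<And>z. z \<in> ball x r \<Longrightarrow> cmod (f z) \<le> M"
    and y: "y \<in> ball x (r/2)" "y' \<in> ball x (r/2)"
  shows "cmod (f y - f y') \<le> 4 * M / r * cmod (y - y')"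
proof (rule field_differentiable_bound[of "ball x (r/2)" f "deriv f"])
  fix z assume z: "z \<in> ball x (r/2)"
  have sub: "ball z (r/2) \<subseteq> ball x r" 
  proof
    fix w assume "w \<in> ball z (r/2)"
    then show "w \<in> ball x r" using z dist_triangle[of x w z] by (auto simp: dist_commute)
  qed
  have "cmod (deriv f z) \<le> 2 * M / (r/2)"
  proof (rule cauchy_deriv_bound)
    show "f holomorphic_on ball z (r/2)" using hol sub by (rule holomorphic_on_subset)
    show "cmod (f w) \<le> M" if "w \<in> ball z (r/2)" for w using bd sub that by blast
  qed (use r in simp)
  then show "cmod (deriv f z) \<le> 4 * M / r" by simp
  have "z \<in> ball x r" using z r by auto
  then have "f field_differentiable (at z)" using hol
    by (meson holomorphic_on_imp_differentiable_at open_ball)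
  then show "(f has_field_derivative deriv f z) (at z within ball x (r / 2))"
    using field_differentiable_derivI has_field_derivative_at_within by blast
qed (use y in auto)

text \<open>
  A solution is a fixed point of \<open>t \<mapsto> y - (f t - t)\<close>, which maps the disc of radius \<open>\<eta>\<close> around \<open>y\<close>
  into itself.
\<close>

lemma near_identity_covers:
  fixes f :: "complex \<Rightarrow> complex"
  assumes cont: "continuous_on (cball x r) f" and near: "\<And>t. t \<in> cball x r \<Longrightarrow> cmod (f t - t) \<le> \<eta>"
    and sub: "cball y \<eta> \<subseteq> cball x r" and \<eta>: "\<eta> > 0"
  obtains t where "t \<in> cball y \<eta>" "f t = y"
proof -
  have "continuous_on (cball y \<eta>) (\<lambda>t. y - (f t - t))"
    using continuous_on_subset[OF cont sub] by (intro continuous_intros)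
  moreover have "(\<lambda>t. y - (f t - t)) \<in> cball y \<eta> \<rightarrow> cball y \<eta>"
  proof
    fix t assume "t \<in> cball y \<eta>"
    then have "cmod (f t - t) \<le> \<eta>" using near sub by blast
    then show "y - (f t - t) \<in> cball y \<eta>" by (simp add: dist_norm)
  qed
  ultimately obtain t where t: "t \<in> cball y \<eta>" "y - (f t - t) = t" by (rule brouwer_ball[OF \<eta>])
  have "y = t + (f t - t)" using t(2) by (simp only: diff_eq_eq)
  then have "f t = y" by simp
  with t(1) show ?thesis by (rule that)
qed

text \<open>
  Otherwise Montel's theorem extracts a limit that agrees with \<open>h\<close> on \<open>U\<close>, hence everywhere.
\<close>

lemma vitali_convergence:
  fixes F :: "nat \<Rightarrow> complex \<Rightarrow> complex"
  assumes S: "open S" "connected S" and hol: "\<And>n. F n holomorphic_on S"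
    and bd: "\<And>n z. z \<in> S \<Longrightarrow> cmod (F n z) \<le> M"
    and h: "h holomorphic_on S" and U: "open U" "U \<subseteq> S" "U \<noteq> {}"
    and lim: "\<And>z. z \<in> U \<Longrightarrow> (\<lambda>n. F n z) \<longlonglongrightarrow> h z" and K: "compact K" "K \<subseteq> S"
  shows "uniform_limit K F h sequentially"
proof (rule ccontr)
  assume "\<not> uniform_limit K F h sequentially"
  then have "\<exists>e>0. \<forall>N. \<exists>n\<ge>N. \<exists>x\<in>K. e \<le> dist (F n x) (h x)"
    by (auto simp: uniform_limit_sequentially_iff not_less)
  then obtain e where e: "e > 0" "\<And>N. \<exists>n\<ge>N. \<exists>x\<in>K. e \<le> dist (F n x) (h x)" by blast
  have inf: "infinite {n. \<exists>x\<in>K. e \<le> dist (F n x) (h x)}"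
    unfolding infinite_nat_iff_unbounded_le using e(2) by blast
  obtain s :: "nat \<Rightarrow> nat" where s: "strict_mono s" "\<forall>n. s n \<in> {n. \<exists>x\<in>K. e \<le> dist (F n x) (h x)}"
    using infinite_enumerate[OF inf] by blast
  let ?H = "{f. f holomorphic_on S \<and> (\<forall>z\<in>S. cmod (f z) \<le> M)}"
  obtain g r where g: "g holomorphic_on S" "strict_mono (r::nat\<Rightarrow>nat)"
      "\<And>x. x \<in> S \<Longrightarrow> (\<lambda>n. F (s (r n)) x) \<longlonglongrightarrow> g x"
      "\<And>K. \<lbrakk>compact K; K \<subseteq> S\<rbrakk> \<Longrightarrow> uniform_limit K ((\<lambda>n. F (s n)) \<circ> r) g sequentially"
  proof (rule Montel[OF S(1), of ?H "\<lambda>n. F (s n)"])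
    show "\<exists>B. \<forall>h\<in>?H. \<forall>z\<in>K. cmod (h z) \<le> B" if "compact K" "K \<subseteq> S" for K using that by blast
    show "range (\<lambda>n. F (s n)) \<subseteq> ?H" using hol bd by auto
  qed auto
  have gh: "g z = h z" if "z \<in> U" for z
  proof -
    have "(\<lambda>n. F (s (r n)) z) \<longlonglongrightarrow> h z"
      using LIMSEQ_subseq_LIMSEQ[OF lim[OF that] strict_mono_o[OF s(1) g(2)]] by (simp add: o_def)
    moreover have "z \<in> S" using U that by blast
    ultimately show ?thesis using LIMSEQ_unique[OF g(3)] by blast
  qed
  have "g z = h z" if "z \<in> S" for z
    by (rule analytic_continuation_open[of U S g h]) (use S U g h gh that in auto)
  moreover have "\<forall>\<^sub>F n in sequentially. \<forall>x\<in>K. dist (((\<lambda>n. F (s n)) \<circ> r) n x) (g x) < e"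
    using g(4)[OF K] e(1) by (auto simp: uniform_limit_iff)
  ultimately obtain n where "\<forall>x\<in>K. dist (F (s (r n)) x) (h x) < e"
    using K(2) unfolding eventually_sequentially by (auto simp: subset_iff)
  then show False using spec[OF s(2), of "r n"] by force
qed

text \<open>
  Since a polynomial is proper, it is a covering map over any set of regular values.
\<close>

lemma covering_space_poly:
  fixes f :: "complex poly"
  assumes f: "degree f > 0" and B: "open B" and reg: "\<And>c. poly (pderiv f) c = 0 \<Longrightarrow> poly f c \<notin> B"
  shows "covering_space (poly f -` B) (poly f) B"
  unfolding covering_space_def
proof (intro conjI ballI)
  show "continuous_on (poly f -` B) (poly f)" by (intro continuous_intros)
  show "poly f ` (poly f -` B) = B" using poly_surj[OF f] by (auto simp: image_iff) metis
  fix y assume y: "y \<in> B"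
  define Z where "Z = {z. poly f z = y}"
  have Zeq: "Z = {z. poly (f - [:y:]) z = 0}" by (auto simp: Z_def)
  have finZ: "finite Z" unfolding Zeq using f by (intro poly_roots_finite) auto
  have Zne: "Z \<noteq> {}" using poly_surj[OF f, of y] by (auto simp: Z_def)
  have "\<exists>e>0. \<forall>z'\<in>Z. z' \<noteq> z \<longrightarrow> e \<le> dist z z'" for z using finite_set_avoid[OF finZ, of z] by auto
  then obtain e where e: "\<And>z. e z > 0" "\<And>z z'. z' \<in> Z \<Longrightarrow> z' \<noteq> z \<Longrightarrow> e z \<le> dist z z'" by metis
  have "\<exists>N r g. open N \<and> z \<in> N \<and> N \<subseteq> ball z (e z / 2) \<and> r > 0 \<and> continuous_on (ball y r) g \<and>
      g ` ball y r = N \<and> (\<forall>y'\<in>ball y r. poly f (g y') = y') \<and> (\<forall>z\<in>N. g (poly f z) = z) \<and> (\<forall>z\<in>N. poly f z \<in> ball y r)"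
    if "z \<in> Z" for z
  proof -
    have fz: "poly f z = y" using that by (simp add: Z_def)
    have "poly (pderiv f) z \<noteq> 0" using reg[of z] y fz by auto
    then show ?thesis
      by (rule poly_local_inverse[of f z "e z / 2"]) (use e(1)[of z] fz in auto)
  qed
  then obtain N r g where N: "\<And>z. z \<in> Z \<Longrightarrow> open (N z) \<and> z \<in> N z \<and> N z \<subseteq> ball z (e z / 2) \<and> r z > 0 \<and>
      continuous_on (ball y (r z)) (g z) \<and> g z ` ball y (r z) = N z \<and>
      (\<forall>y'\<in>ball y (r z). poly f (g z y') = y') \<and> (\<forall>x\<in>N z. g z (poly f x) = x) \<and> (\<forall>x\<in>N z. poly f x \<in> ball y (r z))"
    by metis
  have disjN: "N z \<inter> N z' = {}" if "z \<in> Z" "z' \<in> Z" "z \<noteq> z'" for z z'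
  proof (rule ccontr)
    assume "N z \<inter> N z' \<noteq> {}"
    then obtain x where "x \<in> N z" "x \<in> N z'" by blast
    then have "x \<in> ball z (e z / 2)" "x \<in> ball z' (e z' / 2)"
      using N[OF that(1)] N[OF that(2)] by blast+
    moreover have "e z \<le> dist z z'" "e z' \<le> dist z z'" using e(2) that by (metis, metis dist_commute)
    ultimately show False using dist_triangle[of z z' x] by (simp add: dist_commute)
  qed
  define U where "U = (\<Union>z\<in>Z. N z)"
  have opU: "open U" using N by (auto simp: U_def)
  have "\<exists>s>0. poly f -` ball y s \<subseteq> U"
  proof (cases "poly f -` cball y 1 - U = {}")
    case True
    then show ?thesis by (intro exI[of _ 1]) auto
  next
    case False
    let ?K = "poly f -` cball y 1 - U"
    have K: "compact ?K" using opU by (intro compact_diff compact_poly_vimage[OF f]) auto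
    obtain x where x: "x \<in> ?K" "\<And>x'. x' \<in> ?K \<Longrightarrow> cmod (poly (f - [:y:]) x) \<le> cmod (poly (f - [:y:]) x')"
      using poly_attains_min_max[OF K False, of "f - [:y:]"] by metis
    have "poly f x \<noteq> y" using x N by (auto simp: U_def Z_def)
    then have pos: "cmod (poly (f - [:y:]) x) > 0" by simp
    show ?thesis
    proof (intro exI conjI)
      show "min 1 (cmod (poly (f - [:y:]) x)) > 0" using pos by simp
      show "poly f -` ball y (min 1 (cmod (poly (f - [:y:]) x))) \<subseteq> U"
        using x(2) by (force simp: dist_norm norm_minus_commute)
    qed
  qed
  then obtain s where s: "s > 0" "poly f -` ball y s \<subseteq> U" by blast
  obtain s' where s': "s' > 0" "ball y s' \<subseteq> B" using y B by (meson openE)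
  define t where "t = min (min s s') (Min (r ` Z))"
  have t: "t > 0" "t \<le> s" "t \<le> s'" "\<And>z. z \<in> Z \<Longrightarrow> t \<le> r z"
    using s s' finZ Zne N by (auto simp: t_def min_le_iff_disj)
  let ?T = "ball y t"
  let ?v = "(\<lambda>z. N z \<inter> poly f -` ?T) ` Z"
  show "\<exists>T. y \<in> T \<and> openin (top_of_set B) T \<and> (\<exists>v. \<Union> v = poly f -` B \<inter> poly f -` T \<and>
      (\<forall>u\<in>v. openin (top_of_set (poly f -` B)) u) \<and> pairwise disjnt v \<and> (\<forall>u\<in>v. \<exists>q. homeomorphism u T (poly f) q))"
  proof (intro exI[of _ ?T] exI[of _ ?v] conjI ballI)
    have TB: "?T \<subseteq> B" using s' t by (meson subset_ball order_trans)
    show "y \<in> ?T" using t by simp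
    show "openin (top_of_set B) ?T" using TB by (simp add: openin_open_eq B)
    have "poly f -` ?T \<subseteq> U" using s t by (meson subset_ball vimage_mono order_trans)
    then show "\<Union> ?v = poly f -` B \<inter> poly f -` ?T" using TB by (auto simp: U_def)
    show "openin (top_of_set (poly f -` B)) u" if "u \<in> ?v" for u
    proof -
      have opv: "open (poly f -` V)" if "open V" for V
        using that by (intro open_vimage) (auto intro: continuous_intros)
      have "open u" "u \<subseteq> poly f -` B" using that N TB opv[of ?T] by auto
      then show ?thesis using opv[OF B] by (simp add: openin_open_eq)
    qed
    show "pairwise disjnt ?v"
      using disjN by (fastforce simp: pairwise_def disjnt_def)
    fix u assume "u \<in> ?v"
    then obtain z where z: "z \<in> Z" "u = N z \<inter> poly f -` ?T" by blast
    have Nz: "continuous_on (ball y (r z)) (g z)" "g z ` ball y (r z) = N z"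
      "\<forall>y'\<in>ball y (r z). poly f (g z y') = y'" "\<forall>x\<in>N z. g z (poly f x) = x" using N[OF z(1)] by auto
    have Tr: "?T \<subseteq> ball y (r z)" using t(4)[OF z(1)] by (rule subset_ball)
    have "homeomorphism u ?T (poly f) (g z)"
    proof (rule homeomorphismI)
      show "continuous_on u (poly f)" by (intro continuous_intros)
      show "continuous_on ?T (g z)" using Nz(1) Tr by (rule continuous_on_subset)
      show "poly f ` u \<subseteq> ?T" using z by auto
      show "g z ` ?T \<subseteq> u" unfolding z(2) using Nz Tr by blast
      show "g z (poly f x) = x" if "x \<in> u" for x using that Nz z by auto
      show "poly f (g z x) = x" if "x \<in> ?T" for x using that Nz Tr by blast
    qed
    then show "\<exists>q. homeomorphism u ?T (poly f) q" by blast
  qed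
qed

text \<open>
  Lift the identity of the disc through the covering.
\<close>

lemma poly_inverse_branch:
  fixes f :: "complex poly"
  assumes f: "degree f > 0" and reg: "\<And>c. poly (pderiv f) c = 0 \<Longrightarrow> poly f c \<notin> ball x r"
    and w: "poly f w \<in> ball x r"
  obtains v where "v holomorphic_on ball x r" "\<forall>y\<in>ball x r. poly f (v y) = y" "v (poly f w) = w"
proof -
  have cov: "covering_space (poly f -` ball x r) (poly f) (ball x r)"
    using covering_space_poly[OF f open_ball reg] .
  obtain v where v: "continuous_on (ball x r) v" "v \<in> ball x r \<rightarrow> poly f -` ball x r" "v (poly f w) = w"
      "\<And>y. y \<in> ball x r \<Longrightarrow> poly f (v y) = y"
  proof (rule covering_space_lift_strong[OF cov, of w "poly f w" "ball x r" "\<lambda>y. y"])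
    show "simply_connected (ball x r)" by (intro convex_imp_simply_connected) simp
    show "locally path_connected (ball x r)" by (intro open_imp_locally_path_connected) simp
  qed (use w in auto)
  have "v holomorphic_on ball x r"
    by (rule covering_space_lift_is_holomorphic[OF cov, of "\<lambda>y. y"])
       (use v in \<open>auto intro!: open_vimage holomorphic_intros continuous_intros\<close>)
  then show ?thesis using that v by blast
qed

section \<open>The spherical metric in the plane coordinate\<close>

text \<open>
  The Euclidean distance in space between the two points of the unit sphere. It is comparable with
  the spherical distance and, unlike it, given by an algebraic formula.
\<close>

definition chord :: "riemann_sphere \<Rightarrow> riemann_sphere \<Rightarrow> real" where
  "chord x y = norm (stereo x - stereo y)"

lemma stereo_inner_bounds: "-1 \<le> stereo x \<bullet> stereo y" "stereo x \<bullet> stereo y \<le> 1"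
  using Cauchy_Schwarz_ineq2[of "stereo x" "stereo y"] by (auto simp: abs_le_iff)

lemma chord_sq: "(chord x y)\<^sup>2 = 2 - 2 * (stereo x \<bullet> stereo y)"
proof -
  have "(chord x y)\<^sup>2 = (norm (stereo x))\<^sup>2 + (norm (stereo y))\<^sup>2 - 2 * (stereo x \<bullet> stereo y)"
    unfolding chord_def power2_norm_eq_inner
    by (simp add: inner_diff_left inner_diff_right inner_commute)
  then show ?thesis by simp
qed

lemma chord_nonneg: "chord x y \<ge> 0" by (simp add: chord_def)

lemma chord_le_dist: "chord x y \<le> dist x y"
proof -
  define d where "d = dist x y"
  have c: "cos d = stereo x \<bullet> stereo y"
    unfolding d_def dist_riemann_sphere_def by (rule cos_arccos) (rule stereo_inner_bounds)+
  have d0: "0 \<le> d" by (simp add: d_def)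
  have "(chord x y)\<^sup>2 = 2 - 2 * cos (2 * (d/2))" using c chord_sq by simp
  also have "\<dots> = (2 * sin (d/2))\<^sup>2" unfolding cos_double_sin by (simp add: power_mult_distrib)
  also have "\<dots> = (2 * \<bar>sin (d/2)\<bar>)\<^sup>2" by (simp add: power_mult_distrib)
  also have "\<dots> \<le> d\<^sup>2"
    using abs_sin_x_le_abs_x[of "d/2"] d0 by (intro power_mono) auto
  finally show ?thesis using d0 unfolding d_def by (rule power2_le_imp_le)
qed

lemma chord_small_imp_dist_small:
  assumes "e > 0"
  obtains \<delta> where "\<delta> > 0" "\<And>x y. chord x y < \<delta> \<Longrightarrow> dist x y < e"
proof -
  have "\<forall>t\<in>{-1..1}. \<forall>e>0. \<exists>s>0. \<forall>t'\<in>{-1..1}. dist t' t < s \<longrightarrow> dist (arccos t') (arccos t) < e"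
    using continuous_on_arccos' unfolding continuous_on_iff .
  from bspec[OF this, of 1] assms have "\<exists>s>0. \<forall>t'\<in>{-1..1}. dist t' 1 < s \<longrightarrow> dist (arccos t') (arccos 1) < e"
    by simp
  then obtain s where s: "s > 0" "\<And>t. t \<in> {-1..1} \<Longrightarrow> dist t 1 < s \<Longrightarrow> dist (arccos t) (arccos 1) < e"
    by blast
  show ?thesis
  proof (rule that[of "sqrt s"])
    fix x y assume "chord x y < sqrt s"
    then have "(chord x y)\<^sup>2 < s" using s(1) chord_nonneg by (metis real_sqrt_less_iff real_sqrt_abs abs_of_nonneg)
    then have "dist (stereo x \<bullet> stereo y) 1 < s"
      using chord_sq[of x y] stereo_inner_bounds[of x y] by (simp add: dist_real_def)
    then show "dist x y < e"
      using s(2)[of "stereo x \<bullet> stereo y"] stereo_inner_bounds[of x y]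
      by (simp add: dist_riemann_sphere_def dist_real_def)
  qed (use s in simp)
qed

lemma chord_Fin_sq:
  "(chord (Fin z) (Fin w))\<^sup>2 = 4 * (cmod (z - w))\<^sup>2 / ((1 + (cmod z)\<^sup>2) * (1 + (cmod w)\<^sup>2))"
proof -
  define a b i where "a = (cmod z)\<^sup>2" and "b = (cmod w)\<^sup>2" and "i = z \<bullet> w"
  have pos: "1 + a > 0" "1 + b > 0" by (auto simp: a_def b_def add_pos_nonneg)
  have n: "(cmod (z - w))\<^sup>2 = a + b - 2 * i"
    unfolding a_def b_def i_def power2_norm_eq_inner by (simp add: inner_diff_left inner_diff_right inner_commute)
  have "stereo (Fin z) \<bullet> stereo (Fin w) = (2 / (1 + a)) * (2 / (1 + b)) * i + ((a - 1) / (a + 1)) * ((b - 1) / (b + 1))"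
    by (simp add: a_def b_def i_def inner_prod_def)
  also have "\<dots> = (4 * i + (a - 1) * (b - 1)) / ((1 + a) * (1 + b))"
    using pos by (simp add: add_divide_distrib add.commute)
  finally have "(chord (Fin z) (Fin w))\<^sup>2 = 2 - 2 * ((4 * i + (a - 1) * (b - 1)) / ((1 + a) * (1 + b)))"
    unfolding chord_sq by simp
  also have "\<dots> = (2 * ((1 + a) * (1 + b)) - 2 * (4 * i + (a - 1) * (b - 1))) / ((1 + a) * (1 + b))"
    using pos by (simp add: diff_divide_distrib)
  also have "2 * ((1 + a) * (1 + b)) - 2 * (4 * i + (a - 1) * (b - 1)) = 4 * (a + b - 2 * i)"
    by (simp add: algebra_simps)
  finally show ?thesis unfolding n a_def b_def .
qed

lemma chord_Fin_le: "chord (Fin z) (Fin w) \<le> 2 * cmod (z - w)"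
proof -
  have "1 * 1 \<le> (1 + (cmod z)\<^sup>2) * (1 + (cmod w)\<^sup>2)" by (intro mult_mono) auto
  then have "4 * (cmod (z - w))\<^sup>2 / ((1 + (cmod z)\<^sup>2) * (1 + (cmod w)\<^sup>2)) \<le> 4 * (cmod (z - w))\<^sup>2 / 1"
    by (intro divide_left_mono) (auto simp: add_pos_nonneg)
  then have "(chord (Fin z) (Fin w))\<^sup>2 \<le> (2 * cmod (z - w))\<^sup>2"
    unfolding chord_Fin_sq by (simp add: power_mult_distrib)
  then show ?thesis by (rule power2_le_imp_le) simp
qed

lemma Fin_uniformly_continuous:
  assumes "e > 0"
  obtains \<delta> where "\<delta> > 0" "\<And>z w. cmod (z - w) < \<delta> \<Longrightarrow> dist (Fin z) (Fin w) < e"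
proof -
  obtain \<delta> where \<delta>: "\<delta> > 0" "\<And>x y. chord x y < \<delta> \<Longrightarrow> dist x y < e"
    using chord_small_imp_dist_small[OF assms] by metis
  show ?thesis
  proof (rule that[of "\<delta>/2"])
    show "dist (Fin z) (Fin w) < e" if "cmod (z - w) < \<delta> / 2" for z w
      using \<delta>(2) chord_Fin_le[of z w] that by force
  qed (use \<delta> in simp)
qed

lemma chord_inverse:
  assumes "z \<noteq> 0" "w \<noteq> 0"
  shows "chord (Fin (inverse z)) (Fin (inverse w)) = chord (Fin z) (Fin w)"
proof -
  define a b where "a = (cmod z)\<^sup>2" and "b = (cmod w)\<^sup>2"
  have pos: "a > 0" "b > 0" using assms by (auto simp: a_def b_def)
  have "inverse z - inverse w = (w - z) / (z * w)" using assms by (simp add: field_simps)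
  then have "(cmod (inverse z - inverse w))\<^sup>2 = (cmod (z - w))\<^sup>2 / (a * b)"
    by (simp add: norm_divide norm_mult power_divide power_mult_distrib norm_minus_commute a_def b_def)
  then have "(chord (Fin (inverse z)) (Fin (inverse w)))\<^sup>2
      = 4 * ((cmod (z - w))\<^sup>2 / (a * b)) / ((1 + inverse a) * (1 + inverse b))"
    unfolding chord_Fin_sq by (simp add: norm_inverse power_inverse a_def b_def)
  also have "\<dots> = 4 * (cmod (z - w))\<^sup>2 / ((1 + a) * (1 + b))"
    using pos by (simp add: field_simps)
  finally have "(chord (Fin (inverse z)) (Fin (inverse w)))\<^sup>2 = (chord (Fin z) (Fin w))\<^sup>2"
    unfolding chord_Fin_sq a_def b_def .
  then show ?thesis using chord_nonneg by (simp add: power2_eq_iff_nonneg)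
qed

text \<open>
  Affine maps are Lipschitz for the chordal distance because \<open>1 + |z|\<^sup>2\<close> and \<open>1 + |a + c z|\<^sup>2\<close> are
  comparable.
\<close>

lemma chord_affine:
  assumes c: "c \<noteq> 0"
  obtains C where "C > 0" "\<And>z w. chord (Fin (a + c * z)) (Fin (a + c * w)) \<le> C * chord (Fin z) (Fin w)"
proof -
  define k where "k = (cmod c)\<^sup>2"
  define D where "D = 1 + 2 * (1 + (cmod a)\<^sup>2) / k"
  have k: "k > 0" using c by (simp add: k_def)
  have D: "D > 0" using k by (simp add: D_def add_pos_nonneg)
  have est: "1 + (cmod z)\<^sup>2 \<le> D * (1 + (cmod (a + c * z))\<^sup>2)" for z
  proof -
    define y where "y = a + c * z"
    have "k * (cmod z)\<^sup>2 = (cmod (y - a))\<^sup>2" by (simp add: k_def y_def norm_mult power_mult_distrib)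
    also have "\<dots> \<le> (cmod y + cmod a)\<^sup>2" by (intro power_mono norm_triangle_ineq4) simp
    also have "\<dots> \<le> 2 * (cmod y)\<^sup>2 + 2 * (cmod a)\<^sup>2"
      using zero_le_power2[of "cmod y - cmod a"] by (simp add: power2_eq_square algebra_simps)
    also have "\<dots> \<le> 2 * (1 + (cmod a)\<^sup>2) * (1 + (cmod y)\<^sup>2)"
      by (simp add: algebra_simps)
    finally have "(cmod z)\<^sup>2 \<le> 2 * (1 + (cmod a)\<^sup>2) / k * (1 + (cmod y)\<^sup>2)"
      using k by (simp add: field_simps)
    moreover have "D * (1 + (cmod y)\<^sup>2) = (1 + (cmod y)\<^sup>2) + 2 * (1 + (cmod a)\<^sup>2) / k * (1 + (cmod y)\<^sup>2)"
      by (simp only: D_def distrib_right mult_1)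
    ultimately show ?thesis unfolding y_def[symmetric] using zero_le_power2[of "cmod y"] by linarith
  qed
  show ?thesis
  proof (rule that[of "cmod c * D"])
    fix z w
    let ?Z = "1 + (cmod z)\<^sup>2" and ?W = "1 + (cmod w)\<^sup>2"
    let ?Z' = "1 + (cmod (a + c * z))\<^sup>2" and ?W' = "1 + (cmod (a + c * w))\<^sup>2"
    have pos: "?Z > 0" "?W > 0" "?Z' > 0" "?W' > 0" by (auto simp: add_pos_nonneg)
    have "?Z * ?W \<le> (D * ?Z') * (D * ?W')" using est pos D by (intro mult_mono) auto
    then have le: "1 / (?Z' * ?W') \<le> D\<^sup>2 / (?Z * ?W)"
      using pos by (simp add: divide_simps power2_eq_square mult_ac)
    have "a + c * z - (a + c * w) = c * (z - w)" by (simp add: algebra_simps)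
    then have "(cmod (a + c * z - (a + c * w)))\<^sup>2 = k * (cmod (z - w))\<^sup>2"
      by (simp only: norm_mult power_mult_distrib k_def)
    then have "(chord (Fin (a + c * z)) (Fin (a + c * w)))\<^sup>2 = 4 * (k * (cmod (z - w))\<^sup>2) * (1 / (?Z' * ?W'))"
      unfolding chord_Fin_sq by simp
    also have "\<dots> \<le> 4 * (k * (cmod (z - w))\<^sup>2) * (D\<^sup>2 / (?Z * ?W))"
      using le k by (intro mult_left_mono) auto
    also have "\<dots> = (cmod c * D * chord (Fin z) (Fin w))\<^sup>2"
      unfolding power_mult_distrib chord_Fin_sq k_def by (simp add: mult_ac)
    finally show "chord (Fin (a + c * z)) (Fin (a + c * w)) \<le> cmod c * D * chord (Fin z) (Fin w)"
      by (rule power2_le_imp_le) (use D chord_nonneg in auto)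
  qed (use c D in simp)
qed

text \<open>
  The second point need not be bounded in advance. This uses that \<open>s\<^sup>2 / (1 + (s + R)\<^sup>2)\<close>, a lower
  bound for the squared chordal distance up to a constant, increases with \<open>s = |z - w|\<close>.
\<close>

lemma dist_Fin_small_imp_close:
  assumes e: "e > 0" and R: "R \<ge> 0"
  obtains \<delta> where "\<delta> > 0" "\<And>z w. cmod z \<le> R \<Longrightarrow> dist (Fin z) (Fin w) < \<delta> \<Longrightarrow> cmod (z - w) < e"
proof -
  define D where "D = (1 + R\<^sup>2) * (1 + (e + R)\<^sup>2)"
  have D: "D > 0" unfolding D_def by (intro mult_pos_pos add_pos_nonneg) auto
  show ?thesis
  proof (rule that[of "2 * e / sqrt D"])
    show "2 * e / sqrt D > 0" using e D by simp
    fix z w assume z: "cmod z \<le> R" and d: "dist (Fin z) (Fin w) < 2 * e / sqrt D"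
    show "cmod (z - w) < e"
    proof (rule ccontr)
      define s where "s = cmod (z - w)"
      define P where "P = (1 + (cmod z)\<^sup>2) * (1 + (cmod w)\<^sup>2)"
      have P: "P > 0" unfolding P_def by (intro mult_pos_pos add_pos_nonneg) auto
      assume "\<not> cmod (z - w) < e"
      then have s: "s \<ge> e" by (simp add: s_def)
      have "cmod w \<le> s + R" using norm_triangle_ineq4[of z "z - w"] z by (simp add: s_def)
      then have W: "1 + (cmod w)\<^sup>2 \<le> 1 + (s + R)\<^sup>2" by (simp add: power_mono)
      have "e * (s + R) \<le> s * (e + R)" using mult_right_mono[OF s R] by (simp add: algebra_simps)
      then have "(e * (s + R))\<^sup>2 \<le> (s * (e + R))\<^sup>2" using s R e by (intro power_mono) auto
      moreover have "e\<^sup>2 \<le> s\<^sup>2" using s e by (intro power_mono) auto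
      ultimately have "e\<^sup>2 * (1 + (s + R)\<^sup>2) \<le> s\<^sup>2 * (1 + (e + R)\<^sup>2)"
        unfolding power_mult_distrib by (simp only: distrib_left mult_1_right)
      then have "e\<^sup>2 * (1 + (cmod w)\<^sup>2) \<le> s\<^sup>2 * (1 + (e + R)\<^sup>2)"
        using mult_left_mono[OF W, of "e\<^sup>2"] by simp
      moreover have "1 + (cmod z)\<^sup>2 \<le> 1 + R\<^sup>2" using z by (simp add: power_mono)
      ultimately have "(1 + (cmod z)\<^sup>2) * (e\<^sup>2 * (1 + (cmod w)\<^sup>2)) \<le> (1 + R\<^sup>2) * (s\<^sup>2 * (1 + (e + R)\<^sup>2))"
        by - (rule mult_mono, simp_all)
      then have "e\<^sup>2 * P \<le> s\<^sup>2 * D" by (simp add: P_def D_def mult_ac)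
      then have "4 * e\<^sup>2 / D \<le> 4 * s\<^sup>2 / P" using D P by (simp add: pos_divide_le_eq pos_le_divide_eq mult_ac)
      then have "4 * e\<^sup>2 / D \<le> (chord (Fin z) (Fin w))\<^sup>2"
        unfolding chord_Fin_sq s_def[symmetric] P_def .
      then have "(2 * e / sqrt D)\<^sup>2 \<le> (chord (Fin z) (Fin w))\<^sup>2"
        using D by (simp add: power_divide power_mult_distrib)
      then have "2 * e / sqrt D \<le> chord (Fin z) (Fin w)" using chord_nonneg by (rule power2_le_imp_le)
      then show False using d chord_le_dist[of "Fin z" "Fin w"] by simp
    qed
  qed
qed

lemma chord_Infty_sq: "(chord (Fin z) Infty)\<^sup>2 = 4 / (1 + (cmod z)\<^sup>2)"
proof -
  have "(cmod z)\<^sup>2 + 1 > 0" by (simp add: add_nonneg_pos)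
  then show ?thesis unfolding chord_sq by (simp add: inner_prod_def field_simps)
qed

lemma near_Infty_imp_large:
  obtains e where "e > 0" "\<And>z. dist (Fin z) Infty < e \<Longrightarrow> cmod z > M"
proof (rule that[of "2 / sqrt (1 + M\<^sup>2)"])
  have pos: "1 + M\<^sup>2 > 0" by (simp add: add_pos_nonneg)
  then show "2 / sqrt (1 + M\<^sup>2) > 0" by simp
  fix z assume d: "dist (Fin z) Infty < 2 / sqrt (1 + M\<^sup>2)"
  show "cmod z > M"
  proof (rule ccontr)
    assume "\<not> cmod z > M"
    then have "1 + (cmod z)\<^sup>2 \<le> 1 + M\<^sup>2" by (simp add: power_mono)
    then have "4 / (1 + M\<^sup>2) \<le> 4 / (1 + (cmod z)\<^sup>2)"
      by (intro divide_left_mono) (auto simp: add_pos_nonneg)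
    then have "(2 / sqrt (1 + M\<^sup>2))\<^sup>2 \<le> (chord (Fin z) Infty)\<^sup>2"
      unfolding chord_Infty_sq using pos by (simp add: power_divide)
    then have "2 / sqrt (1 + M\<^sup>2) \<le> chord (Fin z) Infty" using chord_nonneg by (rule power2_le_imp_le)
    then show False using d chord_le_dist[of "Fin z" Infty] by simp
  qed
qed

lemma large_imp_near_Infty:
  assumes "e > 0"
  obtains M where "\<And>z. cmod z \<ge> M \<Longrightarrow> dist (Fin z) Infty < e"
proof -
  obtain \<delta> where \<delta>: "\<delta> > 0" "\<And>x y. chord x y < \<delta> \<Longrightarrow> dist x y < e"
    using chord_small_imp_dist_small[OF assms] by metis
  show ?thesis
  proof (rule that[of "2 / \<delta>"])
    fix z assume z: "2 / \<delta> \<le> cmod z"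
    have "(2 / \<delta>)\<^sup>2 \<le> (cmod z)\<^sup>2" using z \<delta> by (intro power_mono) auto
    then have "4 / \<delta>\<^sup>2 < 1 + (cmod z)\<^sup>2" by (simp add: power_divide)
    then have "4 < (1 + (cmod z)\<^sup>2) * \<delta>\<^sup>2" using \<delta> by (simp only: pos_divide_less_eq zero_less_power)
    moreover have "1 + (cmod z)\<^sup>2 > 0" by (simp add: add_pos_nonneg)
    ultimately have "4 / (1 + (cmod z)\<^sup>2) < \<delta>\<^sup>2" by (simp only: pos_divide_less_eq mult.commute)
    then have "(chord (Fin z) Infty)\<^sup>2 < \<delta>\<^sup>2" by (simp only: chord_Infty_sq)
    then have "chord (Fin z) Infty < \<delta>" by (rule power2_less_imp_less) (use \<delta>(1) in linarith)
    then show "dist (Fin z) Infty < e" by (rule \<delta>(2))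
  qed
qed

lemma continuous_on_Fin: "continuous_on S Fin"
  unfolding continuous_on_iff
  by (metis Fin_uniformly_continuous dist_norm)

lemma open_Fin_image:
  assumes "open U"
  shows "open (Fin ` U)"
  unfolding open_dist
proof
  fix x assume "x \<in> Fin ` U"
  then obtain z where z: "x = Fin z" "z \<in> U" by blast
  then obtain e where e: "e > 0" "ball z e \<subseteq> U" using assms openE by blast
  obtain \<delta> where \<delta>: "\<delta> > 0" "\<And>z' w. cmod z' \<le> cmod z \<Longrightarrow> dist (Fin z') (Fin w) < \<delta> \<Longrightarrow> cmod (z' - w) < e"
    using dist_Fin_small_imp_close[OF e(1), of "cmod z"] by auto
  obtain \<delta>' where \<delta>': "\<delta>' > 0" "\<And>w. dist (Fin w) Infty < \<delta>' \<Longrightarrow> cmod w > cmod z"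
    using near_Infty_imp_large by metis
  have "y \<in> Fin ` U" if "dist y x < min \<delta> \<delta>'" for y
  proof (cases y)
    case (Fin w)
    then have "cmod (z - w) < e" using \<delta>(2)[of z w] that z by (simp add: dist_commute)
    then show ?thesis using e Fin by (auto simp: dist_norm)
  next
    case Infty
    then have "dist (Fin z) Infty < \<delta>'" using that z by (simp add: dist_commute)
    then show ?thesis using \<delta>'(2)[of z] by simp
  qed
  then show "\<exists>e>0. \<forall>y. dist y x < e \<longrightarrow> y \<in> Fin ` U" using \<delta> \<delta>' by (intro exI[of _ "min \<delta> \<delta>'"]) auto
qed

lemma open_Fin_vimage: "open V \<Longrightarrow> open (Fin -` V)"
  using continuous_on_Fin[of UNIV] by (simp add: open_vimage)

section \<open>Normal families in the spherical metric\<close>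

text \<open>
  A form of Montel's theorem in which each member of the family may satisfy a different alternative.
  After an affine change the omitted values are 0 and 1. Then either \<open>\<phi>\<close> or \<open>1 / \<phi>\<close> has modulus at
  most 1 at \<open>x\<close>, so it is bounded near \<open>x\<close> by a constant common to the family (Schottky's theorem),
  and inversion preserves chordal distances.
\<close>

lemma bounded_or_omitting_equicontinuous:
  fixes \<F> :: "(complex \<Rightarrow> complex) set"
  assumes r: "r > 0" and ab: "a \<noteq> b" and e: "e > 0"
    and hol: "\<And>f. f \<in> \<F> \<Longrightarrow> f holomorphic_on ball x r"
    and cases: "\<And>f. f \<in> \<F> \<Longrightarrow> (\<forall>z\<in>ball x r. cmod (f z) \<le> M) \<or> (\<forall>z\<in>ball x r. f z \<noteq> a \<and> f z \<noteq> b)"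
  shows "\<exists>d>0. \<forall>f\<in>\<F>. \<forall>y. cmod (y - x) < d \<longrightarrow> dist (Fin (f y)) (Fin (f x)) < e"
proof -
  define s where "s = r / 2"
  have s: "s > 0" "ball x s \<subseteq> ball x r" "cball x s \<subseteq> ball x r" using r by (auto simp: s_def)
  define \<phi> where "\<phi> f z = (f z - a) / (b - a)" for f and z :: complex
  define X where "X = {g. g holomorphic_on ball x r \<and> (\<forall>z\<in>ball x r. g z \<noteq> 0 \<and> g z \<noteq> 1)}"
  obtain B where B: "\<And>g z. g \<in> X \<Longrightarrow> cmod (g x) \<le> 1 \<Longrightarrow> z \<in> cball x s \<Longrightarrow> cmod (g z) \<le> B"
  proof (rule GPicard3[of "ball x r" x "{g \<in> X. cmod (g x) \<le> 1}" X "cball x s"])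
  qed (use r s in \<open>auto simp: X_def\<close>)
  obtain C where C: "C > 0" "\<And>z w. chord (Fin (a + (b - a) * z)) (Fin (a + (b - a) * w)) \<le> C * chord (Fin z) (Fin w)"
    using chord_affine[of "b - a" a] ab by auto
  obtain \<delta> where \<delta>: "\<delta> > 0" "\<And>x y. chord x y < \<delta> \<Longrightarrow> dist x y < e"
    using chord_small_imp_dist_small[OF e] by metis
  \<comment> \<open>One bound for all cases: \<open>M\<close> for the bounded members, \<open>B\<close> for \<open>\<phi>\<close> or its inverse.\<close>
  define M' where "M' = \<bar>M\<bar> + \<bar>B\<bar> + 1"
  define L where "L = 4 * M' / s"
  have L: "L > 0" using s by (simp add: L_def M'_def add_nonneg_pos)
  have lip: "cmod (g y - g x) \<le> L * cmod (y - x)"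
    if "g holomorphic_on ball x r" "\<And>z. z \<in> ball x s \<Longrightarrow> cmod (g z) \<le> M'" "cmod (y - x) < s / 2" for g y
    unfolding L_def
    by (rule bounded_holomorphic_lipschitz[of g x s])
       (use that s holomorphic_on_subset in \<open>auto simp: dist_norm norm_minus_commute\<close>)
  define d where "d = min (s / 2) (\<delta> / (4 * (1 + C) * L))"
  have P: "4 * (1 + C) * L > 0" using C L by (intro mult_pos_pos) auto
  have d: "d > 0" "d \<le> s / 2" unfolding d_def using s(1) P \<delta>(1) by (simp, linarith)
  have "d \<le> \<delta> / (4 * (1 + C) * L)" by (simp add: d_def)
  then have d3: "4 * (1 + C) * L * d \<le> \<delta>" using P by (simp only: pos_le_divide_eq mult.commute)
  have small: "2 * (1 + C) * (L * t) < \<delta>" if "0 \<le> t" "t < d" for t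
  proof -
    have "2 * (1 + C) * (L * t) \<le> 2 * (1 + C) * (L * d)" using that C L by (intro mult_left_mono) auto
    also have "\<dots> < 4 * (1 + C) * L * d" using mult_pos_pos[OF P d(1)] by linarith
    finally show ?thesis using d3 by linarith
  qed
  show ?thesis
  proof (intro exI conjI ballI allI impI)
    show "d > 0" by (rule d)
    fix f y assume f: "f \<in> \<F>" and y: "cmod (y - x) < d"
    have yr: "y \<in> ball x r" "x \<in> ball x r" using y d s r by (auto simp: dist_norm norm_minus_commute s_def)
    have ys: "cmod (y - x) < s / 2" using y d by simp
    note fh = hol[OF f]
    have \<phi>h: "\<phi> f holomorphic_on ball x r" unfolding \<phi>_def by (intro holomorphic_intros fh) (use ab in auto)
    have f\<phi>: "f z = a + (b - a) * \<phi> f z" for z using ab by (simp add: \<phi>_def)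
    have ch: "chord (Fin (f y)) (Fin (f x)) \<le> C * chord (Fin (\<phi> f y)) (Fin (\<phi> f x))"
      unfolding f\<phi>[of y] f\<phi>[of x] by (rule C(2))
    have "chord (Fin (f y)) (Fin (f x)) < \<delta>"
    proof (cases "\<forall>z\<in>ball x r. cmod (f z) \<le> M")
      case True
      have "cmod (f y - f x) \<le> L * cmod (y - x)"
        by (rule lip[OF fh _ ys]) (use True s in \<open>force simp: M'_def\<close>)
      then have "chord (Fin (f y)) (Fin (f x)) \<le> 2 * (L * cmod (y - x))" using chord_Fin_le[of "f y" "f x"] by linarith
      also have "\<dots> \<le> 2 * (1 + C) * (L * cmod (y - x))" using C L by (intro mult_right_mono) auto
      also have "\<dots> < \<delta>" using small y by simp
      finally show ?thesis .
    next
      case False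
      then have om: "\<forall>z\<in>ball x r. f z \<noteq> a \<and> f z \<noteq> b" using cases[OF f] by blast
      have \<phi>X: "\<phi> f \<in> X" using \<phi>h om ab by (auto simp: X_def \<phi>_def)
      then have \<phi>nz: "\<phi> f z \<noteq> 0" if "z \<in> ball x r" for z using that by (auto simp: X_def)
      have "chord (Fin (\<phi> f y)) (Fin (\<phi> f x)) \<le> 2 * (L * cmod (y - x))"
      proof (cases "cmod (\<phi> f x) \<le> 1")
        case True
        have "cmod (\<phi> f y - \<phi> f x) \<le> L * cmod (y - x)"
        proof (rule lip[OF \<phi>h _ ys])
          fix z assume "z \<in> ball x s"
          then have "cmod (\<phi> f z) \<le> B" by (intro B[OF \<phi>X True]) simp
          then show "cmod (\<phi> f z) \<le> M'" by (simp add: M'_def)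
        qed
        then show ?thesis using chord_Fin_le[of "\<phi> f y" "\<phi> f x"] by linarith
      next
        case False
        let ?g = "\<lambda>z. inverse (\<phi> f z)"
        have gh: "?g holomorphic_on ball x r" using \<phi>h \<phi>nz by (intro holomorphic_intros) auto
        have gX: "?g \<in> X" using gh \<phi>X by (auto simp: X_def)
        have g1: "cmod (?g x) \<le> 1" using False by (simp add: norm_inverse inverse_le_1_iff)
        have "cmod (?g y - ?g x) \<le> L * cmod (y - x)"
        proof (rule lip[OF gh _ ys])
          fix z assume "z \<in> ball x s"
          then have "cmod (?g z) \<le> B" by (intro B[OF gX g1]) simp
          then show "cmod (?g z) \<le> M'" by (simp add: M'_def)
        qed
        then show ?thesis using chord_Fin_le[of "?g y" "?g x"] chord_inverse \<phi>nz yr by simp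
      qed
      then have "chord (Fin (f y)) (Fin (f x)) \<le> C * (2 * (L * cmod (y - x)))"
        using ch C(1) mult_left_mono[of "chord (Fin (\<phi> f y)) (Fin (\<phi> f x))" "2 * (L * cmod (y - x))" C] by linarith
      also have "\<dots> \<le> 2 * (1 + C) * (L * cmod (y - x))" using C L by (simp add: algebra_simps)
      also have "\<dots> < \<delta>" using small y by simp
      finally show ?thesis .
    qed
    then show "dist (Fin (f y)) (Fin (f x)) < e" by (rule \<delta>(2))
  qed
qed

section \<open>Semigroups generated by two polynomials\<close>

text \<open>
  The first letter of the word is applied first.
\<close>

primrec word_poly :: "(bool \<Rightarrow> complex poly) \<Rightarrow> bool list \<Rightarrow> complex poly" where
  "word_poly q [] = [:0, 1:]"
| "word_poly q (b # w) = word_poly q w \<circ>\<^sub>p q b"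

definition filled :: "complex poly \<Rightarrow> complex set" where
  "filled f = {z. bounded (range (\<lambda>n. (poly f ^^ n) z))}"

lemma escape_radius_exists:
  fixes f :: "complex poly"
  assumes "degree f \<ge> 2"
  obtains R where "R \<ge> 1" "\<And>z. cmod z \<ge> R \<Longrightarrow> cmod (poly f z) \<ge> 3 * cmod z"
proof -
  have "((\<lambda>x. poly [:0, 3:] x / poly f x) \<longlongrightarrow> 0) at_infinity"
    using assms by (intro poly_divide_tendsto_0_at_infinity) auto
  then have "eventually (\<lambda>x. cmod (poly [:0, 3:] x / poly f x) < 1) at_infinity"
    using tendstoD[of "\<lambda>x. poly [:0, 3:] x / poly f x" 0 at_infinity 1] by (simp add: dist_norm)
  then obtain b where b: "\<And>x. cmod x \<ge> b \<Longrightarrow> cmod (poly [:0, 3:] x / poly f x) < 1"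
    unfolding eventually_at_infinity by auto
  obtain \<rho> where \<rho>: "\<rho> > 0" "\<And>z. cmod z \<ge> \<rho> \<Longrightarrow> cmod (poly f z) > 0"
    using poly_cmod_large[of f 0] assms by auto
  show ?thesis
  proof (rule that[of "max 1 (max b \<rho>)"])
    fix z assume z: "cmod z \<ge> max 1 (max b \<rho>)"
    have "cmod (3 * z) / cmod (poly f z) < 1" using b[of z] z by (simp add: norm_divide mult.commute)
    then show "cmod (poly f z) \<ge> 3 * cmod z"
      using \<rho>(2)[of z] z by (simp add: divide_less_eq norm_mult)
  qed auto
qed

lemma filled_vimage: "poly f z \<in> filled f \<longleftrightarrow> z \<in> filled f"
proof -
  have "range (\<lambda>n. (poly f ^^ n) z) = insert z (range (\<lambda>n. (poly f ^^ n) (poly f z)))" (is "?A = insert z ?B")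
  proof
    show "?A \<subseteq> insert z ?B"
    proof
      fix x assume "x \<in> ?A"
      then obtain n where "x = (poly f ^^ n) z" by blast
      then show "x \<in> insert z ?B" by (cases n) (auto simp: funpow_swap1)
    qed
    show "insert z ?B \<subseteq> ?A"
    proof -
      have "z \<in> ?A" by (metis funpow_0 rangeI)
      moreover have "(poly f ^^ n) (poly f z) \<in> ?A" for n
        by (metis funpow_Suc_right o_apply rangeI)
      ultimately show ?thesis by blast
    qed
  qed
  then show ?thesis by (simp add: filled_def)
qed

text \<open>
  Montel's theorem needs two omitted values. With a fixed point \<open>z\<^sub>0\<close> write
  \<open>f(z) - z\<^sub>0 = (z - z\<^sub>0) s(z)\<close>. A zero of \<open>s\<close> is a preimage of \<open>z\<^sub>0\<close> and a zero of \<open>s - 1\<close> is a fixed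
  point; they differ.
\<close>

lemma filled_two_points:
  fixes f :: "complex poly"
  assumes f: "degree f \<ge> 2"
  obtains a b where "a \<in> filled f" "b \<in> filled f" "a \<noteq> b"
proof -
  have "degree (f - [:0,1:]) = degree f"
    using assms by (metis (no_types, opaque_lifting) degree_add_eq_left degree_minus diff_conv_add_uminus degree_pCons_eq_if
        one_neq_zero pCons_eq_0_iff degree_0 degree_1 one_pCons less_le_trans numeral_2_eq_2 lessI)
  then obtain z0 where "poly (f - [:0,1:]) z0 = 0" using poly_surj[of "f - [:0,1:]" 0] f by auto
  then have z0: "poly f z0 = z0" by simp
  then have fix0: "z0 \<in> filled f"
  proof -
    have "(poly f ^^ n) z0 = z0" for n by (induction n) (simp_all add: z0)
    then show ?thesis by (simp add: filled_def)
  qed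
  have "poly (f - [:z0:]) z0 = 0" using z0 by simp
  then obtain s where s: "f - [:z0:] = [:- z0, 1:] * s" by (metis dvdE poly_eq_0_iff_dvd)
  have sv: "poly f z = z0 + (z - z0) * poly s z" for z
  proof -
    have "poly (f - [:z0:]) z = poly ([:- z0, 1:] * s) z" using s by simp
    then show ?thesis by (simp add: algebra_simps)
  qed
  have "degree s > 0"
  proof (rule ccontr)
    assume "\<not> degree s > 0"
    then obtain c where "s = [:c:]" by (metis degree_eq_zeroE gr0I)
    then have "f = [:z0:] + [:- z0, 1:] * [:c:]" using s by (simp add: algebra_simps)
    then have "degree f \<le> 1" by simp
    then show False using f by simp
  qed
  then obtain r1 r2 where r: "poly s r1 = 0" "poly s r2 = 1" using poly_surj by blast
  have "r1 \<in> filled f" using sv[of r1] r fix0 filled_vimage[of f r1] by simp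
  moreover have "r2 \<in> filled f"
  proof -
    have "poly f r2 = r2" using sv[of r2] r by simp
    then have "(poly f ^^ n) r2 = r2" for n by (induction n) simp_all
    then show ?thesis by (simp add: filled_def)
  qed
  moreover have "r1 \<noteq> r2" using r by auto
  ultimately show ?thesis using that by blast
qed

text \<open>
  The radius is part of the data so that nearby pairs can share it.
\<close>

locale poly_pair =
  fixes q :: "bool \<Rightarrow> complex poly" and R :: real
  assumes deg: "degree (q b) \<ge> 2" and R1: "R \<ge> 1"
    and esc: "cmod z \<ge> R \<Longrightarrow> cmod (poly (q b) z) \<ge> 2 * cmod z"
begin

abbreviation wp where "wp \<equiv> word_poly q"
abbreviation g where "g w \<equiv> poly (word_poly q w)"
abbreviation K where "K b \<equiv> filled (q b)"
abbreviation G where "G \<equiv> generated_semigroup {poly_map (q True), poly_map (q False)}"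

lemma g_append: "g (u @ v) z = g v (g u z)"
  by (induction u arbitrary: z) (simp_all add: poly_pcompose)

lemma degree_wp: "degree (wp w) \<ge> 2 ^ length w"
proof (induction w)
  case (Cons b w)
  have "degree (wp (b # w)) = degree (wp w) * degree (q b)" by (simp add: degree_pcompose)
  also have "\<dots> \<ge> 2 ^ length w * 2" using Cons deg[of b] by (intro mult_mono) auto
  finally show ?case by (simp add: mult.commute)
qed simp

lemma degree_wp_pos: "degree (wp w) > 0"
  using degree_wp[of w] by (metis less_le_trans zero_less_numeral zero_less_power)

lemma g_replicate: "g (replicate n b) z = (poly (q b) ^^ n) z"
proof -
  have "(poly (q b) ^^ n) (poly (q b) z) = (poly (q b) ^^ Suc n) z" for n z
    by (metis funpow_Suc_right o_apply)
  then show ?thesis by (induction n arbitrary: z) (simp_all add: poly_pcompose)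
qed

lemma g_escape: "cmod z \<ge> R \<Longrightarrow> cmod (g w z) \<ge> 2 ^ length w * cmod z"
proof (induction w arbitrary: z)
  case (Cons b w)
  have e: "cmod (poly (q b) z) \<ge> 2 * cmod z" using esc Cons.prems .
  then have "cmod (poly (q b) z) \<ge> R" using Cons.prems R1 by linarith
  from Cons.IH[OF this] have "cmod (g (b # w) z) \<ge> 2 ^ length w * cmod (poly (q b) z)"
    by (simp add: poly_pcompose)
  moreover have "2 ^ length w * cmod (poly (q b) z) \<ge> 2 ^ length w * (2 * cmod z)"
    using e by (intro mult_left_mono) auto
  ultimately have "cmod (g (b # w) z) \<ge> 2 ^ length w * (2 * cmod z)" by linarith
  then show ?case by (simp add: mult_ac del: word_poly.simps)
qed simp

lemma g_escape_strict:
  assumes "cmod z \<ge> R" "w \<noteq> []"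
  shows "cmod (g w z) > R"
proof -
  have "(2::real) ^ length w \<ge> 2 ^ 1" using assms(2) by (intro power_increasing) (auto simp: Suc_le_eq)
  then have "2 ^ length w * cmod z \<ge> 2 * cmod z" by (intro mult_right_mono) auto
  then show ?thesis using g_escape[OF assms(1), of w] assms(1) R1 by linarith
qed

lemma not_filled_escapes:
  assumes "z \<notin> K b"
  obtains n where "n \<ge> 1" "cmod (g (replicate n b) z) > M"
proof -
  have "\<not> bounded (range (\<lambda>n. (poly (q b) ^^ n) z))" using assms by (simp add: filled_def)
  then have "\<exists>n. cmod ((poly (q b) ^^ n) z) > max M (cmod z)"
    unfolding bounded_iff by (metis (no_types, lifting) imageE linorder_not_le)
  then obtain n where n: "cmod ((poly (q b) ^^ n) z) > max M (cmod z)" by blast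
  then have "n \<noteq> 0" by (intro notI) simp
  then show ?thesis using n that[of n] by (simp add: g_replicate)
qed

lemma filled_iff: "z \<in> K b \<longleftrightarrow> (\<forall>n. cmod (g (replicate n b) z) \<le> R)"
proof
  assume z: "z \<in> K b"
  show "\<forall>n. cmod (g (replicate n b) z) \<le> R"
  proof (rule ccontr)
    assume "\<not> (\<forall>n. cmod (g (replicate n b) z) \<le> R)"
    then obtain n where n: "cmod (g (replicate n b) z) > R" by (auto simp: not_le)
    obtain M where M: "\<And>n. cmod (g (replicate n b) z) \<le> M"
      using z by (auto simp: filled_def bounded_iff g_replicate)
    obtain m where m: "M < 2 ^ m" using real_arch_pow[of 2 M] by auto
    have "cmod (g (replicate (n + m) b) z) \<ge> 2 ^ m * cmod (g (replicate n b) z)"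
      using g_escape[of "g (replicate n b) z" "replicate m b"] n by (simp add: replicate_add g_append)
    moreover have "(2::real) ^ m * cmod (g (replicate n b) z) \<ge> 2 ^ m * 1"
      using n R1 by (intro mult_left_mono) auto
    ultimately show False using M[of "n + m"] m by linarith
  qed
next
  assume "\<forall>n. cmod (g (replicate n b) z) \<le> R"
  then show "z \<in> K b" by (auto simp: filled_def bounded_iff g_replicate)
qed

lemma filled_le_R: "z \<in> K b \<Longrightarrow> cmod z \<le> R"
  using filled_iff[of z b] by (metis funpow_0 g_replicate)

lemma compact_filled: "compact (K b)"
proof -
  have "K b = (\<Inter>n. g (replicate n b) -` cball 0 R)" by (auto simp: filled_iff)
  then have "closed (K b)" by (auto intro!: closed_vimage continuous_intros)
  moreover have "bounded (K b)" using filled_le_R by (auto simp: bounded_iff)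
  ultimately show ?thesis by (simp add: compact_eq_bounded_closed)
qed

lemma closed_filled: "closed (K b)" using compact_filled by (rule compact_imp_closed)

lemma filled_nonempty: "K b \<noteq> {}" using filled_two_points[OF deg[of b]] by blast

lemma frontier_filled_nonempty: "frontier (K b) \<noteq> {}"
  using frontier_eq_empty filled_nonempty compact_filled compact_imp_bounded not_bounded_UNIV by metis

lemma semigroup_words: "G = (\<lambda>w. poly_map (wp w)) ` {w. w \<noteq> []}"
proof
  have app: "poly_map (wp (u @ v)) = poly_map (wp v) \<circ> poly_map (wp u)" for u v
  proof
    fix x show "poly_map (wp (u @ v)) x = (poly_map (wp v) \<circ> poly_map (wp u)) x"
      using degree_wp_pos[of "u @ v"] degree_wp_pos[of u] degree_wp_pos[of v]
      by (cases x) (auto simp: g_append)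
  qed
  have one: "poly_map (wp [b]) = poly_map (q b)" for b by (simp add: pcompose_pCons)
  show "G \<subseteq> (\<lambda>w. poly_map (wp w)) ` {w. w \<noteq> []}"
  proof
    fix f assume "f \<in> G"
    then show "f \<in> (\<lambda>w. poly_map (wp w)) ` {w. w \<noteq> []}"
    proof induction
      case (gen h)
      then obtain b where "h = poly_map (wp [b])" using one by auto
      then show ?case by blast
    next
      case (comp f h)
      then obtain u v where "f = poly_map (wp v)" "h = poly_map (wp u)" "u \<noteq> []" by blast
      then have "f \<circ> h = poly_map (wp (u @ v))" "u @ v \<noteq> []" using app by auto
      then show ?case by blast
    qed
  qed
  have "w \<noteq> [] \<Longrightarrow> poly_map (wp w) \<in> G" for w :: "bool list"
  proof (induction w)
    case (Cons b w)
    have b: "poly_map (wp [b]) \<in> G"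
      unfolding one by (cases b) (auto intro: generated_semigroup.gen)
    show ?case
    proof (cases "w = []")
      case False
      have "poly_map (wp (b # w)) = poly_map (wp w) \<circ> poly_map (wp [b])" using app[of "[b]" w] by simp
      then show ?thesis using generated_semigroup.comp[OF Cons(1)[OF False] b] by (simp only:)
    qed (use b in auto)
  qed simp
  then show "(\<lambda>w. poly_map (wp w)) ` {w. w \<noteq> []} \<subseteq> G" by blast
qed

lemma g_holomorphic: "g w holomorphic_on S" by (intro holomorphic_intros)

text \<open>
  The alternative may vary with the word, as it does on a disc whose image under each word either
  lies in a filled set or avoids it.
\<close>

lemma Fatou_criterion:
  assumes r: "r > 0" and ab: "a \<noteq> b"
    and cs: "\<And>w. (\<forall>z\<in>ball x r. cmod (g w z) \<le> M) \<or> (\<forall>z\<in>ball x r. g w z \<noteq> a \<and> g w z \<noteq> b)"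
  shows "Fin x \<in> Fatou G"
proof -
  have "equicontinuous_on (Fin ` ball x r) G"
    unfolding equicontinuous_on_def
  proof (intro ballI allI impI)
    fix y' e assume y': "y' \<in> Fin ` ball x r" and e: "(e::real) > 0"
    then obtain y where y: "y' = Fin y" "y \<in> ball x r" by blast
    define s where "s = r - dist x y"
    have s: "s > 0" using y by (simp add: s_def)
    have sub: "z \<in> ball x r" if "z \<in> ball y s" for z
      using that dist_triangle[of x z y] by (simp add: s_def)
    have "\<exists>d>0. \<forall>f\<in>range g. \<forall>z. cmod (z - y) < d \<longrightarrow> dist (Fin (f z)) (Fin (f y)) < e"
    proof (rule bounded_or_omitting_equicontinuous[OF s ab e, of _ y M])
      show "f holomorphic_on ball y s" if "f \<in> range g" for f using that g_holomorphic by blast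
      fix f assume "f \<in> range g"
      then obtain w where w: "f = g w" by blast
      show "(\<forall>z\<in>ball y s. cmod (f z) \<le> M) \<or> (\<forall>z\<in>ball y s. f z \<noteq> a \<and> f z \<noteq> b)"
        using cs[of w] sub unfolding w by blast
    qed
    then obtain d where d: "d > 0" "\<And>w z. cmod (z - y) < d \<Longrightarrow> dist (Fin (g w z)) (Fin (g w y)) < e" by blast
    obtain \<delta> where \<delta>: "\<delta> > 0" "\<And>z' v. cmod z' \<le> cmod y \<Longrightarrow> dist (Fin z') (Fin v) < \<delta> \<Longrightarrow> cmod (z' - v) < d"
      using dist_Fin_small_imp_close[OF d(1), of "cmod y"] by auto
    show "\<exists>d>0. \<forall>f\<in>G. \<forall>v\<in>Fin ` ball x r. dist v y' < d \<longrightarrow> dist (f v) (f y') < e"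
    proof (intro exI conjI ballI impI)
      show "\<delta> > 0" by (rule \<delta>)
      fix f v' assume f: "f \<in> G" and v': "v' \<in> Fin ` ball x r" "dist v' y' < \<delta>"
      obtain w where w: "f = poly_map (wp w)" using f semigroup_words by blast
      obtain v where v: "v' = Fin v" using v' by blast
      have "cmod (v - y) < d" using \<delta>(2)[of y v] v' unfolding v y(1) by (simp add: dist_commute norm_minus_commute)
      then show "dist (f v') (f y') < e" using d(2) unfolding w v y(1) by simp
    qed
  qed
  moreover have "open (Fin ` ball x r)" by (intro open_Fin_image) simp
  ultimately have "Fin ` ball x r \<subseteq> Fatou G" by (intro Fatou_maximal(3))
  then show ?thesis using r by auto
qed

lemma Fatou_omit:
  assumes U: "open U" "x \<in> U" and om: "\<And>w z. z \<in> U \<Longrightarrow> g w z \<notin> K b"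
  shows "Fin x \<in> Fatou G"
proof -
  obtain r where r: "r > 0" "ball x r \<subseteq> U" using U openE by blast
  obtain a c where ac: "a \<in> K b" "c \<in> K b" "a \<noteq> c" using filled_two_points[OF deg] by metis
  show ?thesis
    by (rule Fatou_criterion[OF r(1) ac(3), of x 0]) (use r om ac in blast)
qed

lemma Fatou_bounded:
  assumes U: "open U" "x \<in> U" and bd: "\<And>w z. z \<in> U \<Longrightarrow> cmod (g w z) \<le> M"
  shows "Fin x \<in> Fatou G"
proof -
  obtain r where r: "r > 0" "ball x r \<subseteq> U" using U openE by blast
  show ?thesis
    by (rule Fatou_criterion[OF r(1), of 0 1 x M]) (use r bd in auto)
qed

lemma Fatou_equicontinuous:
  assumes x: "Fin x \<in> Fatou G" and e: "e > 0"
  obtains d where "d > 0" "\<And>w y. w \<noteq> [] \<Longrightarrow> cmod (y - x) < d \<Longrightarrow> dist (Fin (g w y)) (Fin (g w x)) < e"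
proof -
  obtain s where s: "s > 0" "\<And>f y. f \<in> G \<Longrightarrow> y \<in> Fatou G \<Longrightarrow> dist y (Fin x) < s \<Longrightarrow> dist (f y) (f (Fin x)) < e"
    using Fatou_maximal(2)[of G] x e unfolding equicontinuous_on_def by metis
  obtain s' where s': "s' > 0" "\<And>y. dist y (Fin x) < s' \<Longrightarrow> y \<in> Fatou G"
    using Fatou_maximal(1)[of G] x unfolding open_dist by blast
  obtain d where d: "d > 0" "\<And>z w. cmod (z - w) < d \<Longrightarrow> dist (Fin z) (Fin w) < min s s'"
    using Fin_uniformly_continuous[of "min s s'"] s s' by auto
  show ?thesis
  proof (rule that[OF d(1)])
    fix w :: "bool list" and y assume w: "w \<noteq> []" and y: "cmod (y - x) < d"
    have "poly_map (wp w) \<in> G" using w semigroup_words by blast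
    then show "dist (Fin (g w y)) (Fin (g w x)) < e"
      using s(2)[of "poly_map (wp w)" "Fin y"] s'(2)[of "Fin y"] d(2)[OF y] by simp
  qed
qed

lemma poly_map_wp_Infty: "poly_map (wp w) Infty = Infty"
  using degree_wp_pos[of w] by simp

text \<open>
  Words do not decrease the modulus near infinity, which gives equicontinuity at infinity itself.
\<close>

lemma Infty_Fatou: "Infty \<in> Fatou G"
proof -
  obtain e0 where e0: "e0 > 0" "\<And>z. dist (Fin z) Infty < e0 \<Longrightarrow> cmod z > R"
    using near_Infty_imp_large by metis
  have outF: "Fin x \<in> Fatou G" if "cmod x > R" for x
  proof (rule Fatou_omit[of "{z. cmod z > R}" x True])
    show "open {z. R < cmod z}" by (intro open_Collect_less continuous_intros)
    fix w z assume "z \<in> {z. R < cmod z}"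
    then have "cmod z \<ge> R" by simp
    then have "cmod (g (w @ [True]) z) > R" using g_escape_strict[of z "w @ [True]"] by simp
    then show "g w z \<notin> K True"
      using filled_iff[of "g w z" True] by (metis g_append linorder_not_le replicate_Suc replicate_0)
  qed (use that in simp)
  have "equicontinuous_on (ball Infty e0) G"
    unfolding equicontinuous_on_def
  proof (intro ballI allI impI)
    fix x and e :: real assume x: "x \<in> ball Infty e0" and e: "e > 0"
    show "\<exists>d>0. \<forall>f\<in>G. \<forall>y\<in>ball Infty e0. dist y x < d \<longrightarrow> dist (f y) (f x) < e"
    proof (cases x)
      case (Fin z)
      then have "cmod z > R" using e0(2)[of z] x by (simp add: dist_commute)
      then have "x \<in> Fatou G" using outF Fin by simp
      then obtain d where d: "d > 0" "\<And>f y. f \<in> G \<Longrightarrow> y \<in> Fatou G \<Longrightarrow> dist y x < d \<Longrightarrow> dist (f y) (f x) < e"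
        using Fatou_maximal(2)[of G] e unfolding equicontinuous_on_def by metis
      obtain d' where d': "d' > 0" "\<And>y. dist y x < d' \<Longrightarrow> y \<in> Fatou G"
        using Fatou_maximal(1)[of G] \<open>x \<in> Fatou G\<close> unfolding open_dist by blast
      show ?thesis by (intro exI[of _ "min d d'"]) (use d d' in auto)
    next
      case Infty
      obtain M where M: "\<And>z. cmod z \<ge> M \<Longrightarrow> dist (Fin z) Infty < e" using large_imp_near_Infty[OF e] by metis
      obtain d where d: "d > 0" "\<And>z. dist (Fin z) Infty < d \<Longrightarrow> cmod z > max M R"
        using near_Infty_imp_large by metis
      show ?thesis
      proof (intro exI conjI ballI impI)
        show "d > 0" by (rule d)
        fix f y assume f: "f \<in> G" and y: "dist y x < d"
        obtain w where w: "f = poly_map (wp w)" using f semigroup_words by blast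
        show "dist (f y) (f x) < e"
        proof (cases y)
          case (Fin z)
          then have z: "cmod z > max M R" using d(2)[of z] y Infty by simp
          then have "cmod (g w z) \<ge> 2 ^ length w * cmod z" by (intro g_escape) simp
          moreover have "2 ^ length w * cmod z \<ge> 1 * cmod z" by (intro mult_right_mono) auto
          ultimately have "cmod (g w z) \<ge> M" using z by simp
          then show ?thesis using M w Fin Infty poly_map_wp_Infty[of w] by simp
        next
          case Infty
          then show ?thesis using \<open>x = Infty\<close> e by simp
        qed
      qed
    qed
  qed
  then have "ball Infty e0 \<subseteq> Fatou G" by (intro Fatou_maximal(3)) auto
  then show ?thesis using e0 by auto
qed

text \<open>
  The orbit of \<open>g w x\<close> under the generator \<open>b\<close> stays bounded while orbits of arbitrarily close points
  escape.
\<close>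

lemma frontier_not_Fatou:
  assumes "g w x \<in> frontier (K b)"
  shows "Fin x \<notin> Fatou G"
proof
  assume F: "Fin x \<in> Fatou G"
  obtain \<delta> where \<delta>: "\<delta> > 0" "\<And>z v. cmod z \<le> R \<Longrightarrow> dist (Fin z) (Fin v) < \<delta> \<Longrightarrow> cmod (z - v) < 1"
    using dist_Fin_small_imp_close[of 1 R] R1 by auto
  obtain d where d: "d > 0" "\<And>w y. w \<noteq> [] \<Longrightarrow> cmod (y - x) < d \<Longrightarrow> dist (Fin (g w y)) (Fin (g w x)) < \<delta>"
    using Fatou_equicontinuous[OF F \<delta>(1)] by metis
  have "x \<in> frontier (g w -` K b)" using assms frontier_poly_vimage[OF degree_wp_pos] by simp
  then have "x \<in> closure (- (g w -` K b))" by (simp add: frontier_closures)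
  then obtain y where y: "g w y \<notin> K b" "cmod (y - x) < d"
    using d(1) unfolding closure_approachable by (auto simp: dist_norm)
  obtain n where n: "n \<ge> 1" "cmod (g (replicate n b) (g w y)) > R + 1" using not_filled_escapes[OF y(1)] by metis
  have gx: "cmod (g (w @ replicate n b) x) \<le> R"
    using assms closed_filled filled_iff[of "g w x" b] by (simp add: g_append frontier_def)
  have "w @ replicate n b \<noteq> []" using n by auto
  then have "cmod (g (w @ replicate n b) x - g (w @ replicate n b) y) < 1"
    using d(2)[of "w @ replicate n b" y] \<delta>(2)[OF gx] y by (simp add: dist_commute)
  then have "cmod (g (w @ replicate n b) y) < R + 1"
    using gx norm_triangle_ineq2[of "g (w @ replicate n b) y" "g (w @ replicate n b) x"] by (simp add: norm_minus_commute)
  then show False using n by (simp add: g_append)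
qed

text \<open>
  Otherwise the image of a disc under each word would lie in \<open>K b\<close> or avoid it, and the criterion
  above would apply.
\<close>

lemma Julia_meets_preimages:
  assumes x: "Fin x \<notin> Fatou G" and r: "r > 0"
  obtains w z where "z \<in> ball x r" "g w z \<in> frontier (K b)"
proof -
  obtain a c where ac: "a \<in> K b" "c \<in> K b" "a \<noteq> c" using filled_two_points[OF deg] by metis
  have "\<not> (\<forall>w. (\<forall>z\<in>ball x r. cmod (g w z) \<le> R) \<or> (\<forall>z\<in>ball x r. g w z \<noteq> a \<and> g w z \<noteq> c))"
    using Fatou_criterion[OF r ac(3), of x R] x by blast
  then obtain w z z' where w: "z \<in> ball x r" "\<not> cmod (g w z) \<le> R" "z' \<in> ball x r" "g w z' = a \<or> g w z' = c" by blast
  have "ball x r \<inter> g w -` K b \<noteq> {}" "ball x r - g w -` K b \<noteq> {}"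
    using w ac filled_le_R by auto
  then have "ball x r \<inter> frontier (g w -` K b) \<noteq> {}" by (intro connected_Int_frontier) auto
  then show ?thesis using that frontier_poly_vimage[OF degree_wp_pos] by auto
qed

text \<open>
  The Julia set in the plane coordinate; it loses nothing since infinity is a Fatou point.
\<close>

definition J where "J = {x. Fin x \<in> Julia G}"

lemma Julia_J: "Julia G = Fin ` J"
proof -
  have "x \<in> Fin ` J" if "x \<in> Julia G" for x
    using that Infty_Fatou by (cases x) (auto simp: J_def Julia_def)
  then show ?thesis by (auto simp: J_def)
qed

lemma J_iff: "x \<in> J \<longleftrightarrow> Fin x \<notin> Fatou G" by (simp add: J_def Julia_def)

lemma compact_J: "compact J"
proof -
  have "J = - (Fin -` Fatou G)" by (auto simp: J_iff)
  then have "closed J" using open_Fin_vimage Fatou_maximal(1) by auto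
  moreover have "cmod x \<le> R" if "x \<in> J" for x
  proof (rule ccontr)
    assume x: "\<not> cmod x \<le> R"
    have "g w z \<notin> K True" if "cmod z > R" for w z
      using filled_iff[of "g w z" True] g_escape_strict[of z "w @ [True]"] that
      by (metis g_append less_imp_le linorder_not_le replicate_Suc replicate_0 snoc_eq_iff_butlast)
    moreover have "open {z. R < cmod z}" by (intro open_Collect_less continuous_intros)
    ultimately have "Fin x \<in> Fatou G" using x by (intro Fatou_omit[of "{z. cmod z > R}" x True]) auto
    then show False using that by (simp add: J_iff)
  qed
  ultimately show ?thesis by (auto simp: compact_eq_bounded_closed bounded_iff)
qed

lemma connected_Julia_iff: "connected (Julia G) \<longleftrightarrow> connected J"
proof
  assume "connected J"
  then show "connected (Julia G)" unfolding Julia_J by (intro connected_continuous_image continuous_on_Fin)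
next
  assume c: "connected (Julia G)"
  show "connected J"
  proof (rule connectedI)
    fix A B assume AB: "open A" "open B" "A \<inter> J \<noteq> {}" "B \<inter> J \<noteq> {}" "A \<inter> B \<inter> J = {}" "J \<subseteq> A \<union> B"
    have "open (Fin ` A)" "open (Fin ` B)" using AB open_Fin_image by auto
    moreover have "Fin ` A \<inter> Julia G \<noteq> {}" "Fin ` B \<inter> Julia G \<noteq> {}" "Julia G \<subseteq> Fin ` A \<union> Fin ` B"
      using AB unfolding Julia_J by auto
    moreover have "Fin ` A \<inter> Fin ` B \<inter> Julia G = {}" using AB(5) unfolding Julia_J by auto
    ultimately show False using connectedD[OF c, of "Fin ` A" "Fin ` B"] by simp
  qed
qed

end

text \<open>
  A single polynomial is treated as a pair with equal generators.
\<close>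

lemma Julia_single:
  assumes f: "degree f \<ge> 2"
  shows "Julia (generated_semigroup {poly_map f}) = Fin ` frontier (filled f)"
proof -
  obtain R where R: "R \<ge> 1" "\<And>z. cmod z \<ge> R \<Longrightarrow> cmod (poly f z) \<ge> 3 * cmod z"
    using escape_radius_exists[OF f] by metis
  interpret P: poly_pair "\<lambda>_. f" R by unfold_locales (use f R in \<open>force+\<close>)
  have inv: "P.g w z \<in> filled f \<longleftrightarrow> z \<in> filled f" for w z
    by (induction w arbitrary: z) (simp_all add: poly_pcompose filled_vimage)
  have "x \<in> frontier (filled f)" if "x \<in> P.J" for x
  proof (rule ccontr)
    assume "x \<notin> frontier (filled f)"
    then consider "x \<in> interior (filled f)" | "x \<in> - filled f"
      using P.closed_filled by (auto simp: frontier_def)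
    then have "Fin x \<in> Fatou P.G"
    proof cases
      case 1
      show ?thesis
        by (rule P.Fatou_bounded[OF open_interior 1, of R])
           (use P.filled_le_R inv interior_subset in blast)
    next
      case 2
      show ?thesis
        by (rule P.Fatou_omit[OF _ 2]) (use P.closed_filled inv in auto)
    qed
    then show False using that by (simp add: P.J_iff)
  qed
  moreover have "x \<in> P.J" if "x \<in> frontier (filled f)" for x
    using P.frontier_not_Fatou[of "[]" x] that by (simp add: P.J_iff)
  ultimately have "P.J = frontier (filled f)" by blast
  then show ?thesis using P.Julia_J by simp
qed

section \<open>The probability of tending to infinity\<close>

lemma prob_space_tau:
  assumes "0 < p" "p < 1"
  shows "prob_space (tau h1 h2 p)"
proof
  have "emeasure (tau h1 h2 p) (space (tau h1 h2 p)) = emeasure (tau h1 h2 p) {h1, h2}"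
    by (simp add: tau_def space_point_measure)
  also have "\<dots> = ennreal (p * indicator {h1, h2} h1 + (1 - p) * indicator {h1, h2} h2)"
    by (rule emeasure_tau) (use assms in auto)
  finally show "emeasure (tau h1 h2 p) (space (tau h1 h2 p)) = 1" by simp
qed

lemma space_tau: "space (tau h1 h2 p) = {h1, h2}" by (simp add: tau_def space_point_measure)

lemma sets_tau: "sets (tau h1 h2 p) = Pow {h1, h2}" by (simp add: tau_def sets_point_measure)

lemma nn_integral_tau:
  assumes "0 < p" "p < 1"
  shows "(\<integral>\<^sup>+x. f x \<partial>tau h1 h2 p) = ennreal p * f h1 + ennreal (1 - p) * f h2"
proof (cases "h1 = h2")
  case True
  have "ennreal p * f h2 + ennreal (1 - p) * f h2 = ennreal (p + (1 - p)) * f h2"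
    using assms by (simp only: distrib_right[symmetric] ennreal_plus)
  then show ?thesis unfolding tau_def by (subst nn_integral_point_measure_finite) (use True in \<open>auto simp: mult.commute\<close>)
next
  case False
  then show ?thesis unfolding tau_def
    by (subst nn_integral_point_measure_finite) (auto simp: indicator_def mult.commute)
qed

abbreviation code_space :: "('a \<Rightarrow> 'a) \<Rightarrow> ('a \<Rightarrow> 'a) \<Rightarrow> real \<Rightarrow> (nat \<Rightarrow> 'a \<Rightarrow> 'a) measure" where
  "code_space h1 h2 p \<equiv> PiM UNIV (\<lambda>_. tau h1 h2 p)"

lemma space_code_space: "space (code_space h1 h2 p) = {\<gamma>. \<forall>n. \<gamma> n \<in> {h1, h2}}"
  by (auto simp: space_PiM space_tau PiE_def Pi_def)

text \<open>
  Only finitely many maps occur as letters, so each event about finitely many steps is a finite union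
  of cylinders, without any measurability of the maps themselves.
\<close>

lemma sets_orbit_event: "{\<gamma> \<in> space (code_space h1 h2 p). P (random_orbit \<gamma> n z)} \<in> sets (code_space h1 h2 p)"
proof (induction n arbitrary: P)
  case 0
  then show ?case by (cases "P z") auto
next
  case (Suc n)
  let ?M = "code_space h1 h2 p"
  have letter: "{\<gamma> \<in> space ?M. \<gamma> n = h} \<in> sets ?M" if "h \<in> {h1, h2}" for h
  proof -
    have "(\<lambda>\<gamma>. \<gamma> n) \<in> measurable ?M (tau h1 h2 p)" by (rule measurable_component_singleton) simp
    from measurable_sets[OF this, of "{h}"] have "(\<lambda>\<gamma>. \<gamma> n) -` {h} \<inter> space ?M \<in> sets ?M"
      using that by (auto simp: sets_tau)
    moreover have "{\<gamma> \<in> space ?M. \<gamma> n = h} = (\<lambda>\<gamma>. \<gamma> n) -` {h} \<inter> space ?M" by auto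
    ultimately show ?thesis by simp
  qed
  have "{\<gamma> \<in> space ?M. P (random_orbit \<gamma> (Suc n) z)} =
      ({\<gamma> \<in> space ?M. \<gamma> n = h1} \<inter> {\<gamma> \<in> space ?M. P (h1 (random_orbit \<gamma> n z))}) \<union>
      ({\<gamma> \<in> space ?M. \<gamma> n = h2} \<inter> {\<gamma> \<in> space ?M. P (h2 (random_orbit \<gamma> n z))})"
    unfolding space_code_space by auto
  also have "\<dots> \<in> sets ?M"
    using letter[of h1] letter[of h2] Suc[of "\<lambda>x. P (h1 x)"] Suc[of "\<lambda>x. P (h2 x)"] by auto
  finally show ?case .
qed

definition escape_event where
  "escape_event h1 h2 p z = {\<gamma> \<in> space (code_space h1 h2 p). (\<lambda>n. random_orbit \<gamma> n z) \<longlonglongrightarrow> Infty}"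

lemma sets_escape_event: "escape_event h1 h2 p z \<in> sets (code_space h1 h2 p)"
proof -
  let ?M = "code_space h1 h2 p"
  have "escape_event h1 h2 p z =
     {\<gamma> \<in> space ?M. \<forall>k::nat. \<exists>N. \<forall>n. N \<le> n \<longrightarrow> dist (random_orbit \<gamma> n z) Infty < inverse (real (Suc k))}"
    unfolding escape_event_def
  proof (intro Collect_cong conj_cong refl)
    fix \<gamma>
    show "(\<lambda>n. random_orbit \<gamma> n z) \<longlonglongrightarrow> Infty \<longleftrightarrow>
       (\<forall>k::nat. \<exists>N. \<forall>n. N \<le> n \<longrightarrow> dist (random_orbit \<gamma> n z) Infty < inverse (real (Suc k)))"
    proof
      assume "(\<lambda>n. random_orbit \<gamma> n z) \<longlonglongrightarrow> Infty"
      then show "\<forall>k::nat. \<exists>N. \<forall>n. N \<le> n \<longrightarrow> dist (random_orbit \<gamma> n z) Infty < inverse (real (Suc k))"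
        unfolding lim_sequentially by auto
    next
      assume h: "\<forall>k::nat. \<exists>N. \<forall>n. N \<le> n \<longrightarrow> dist (random_orbit \<gamma> n z) Infty < inverse (real (Suc k))"
      show "(\<lambda>n. random_orbit \<gamma> n z) \<longlonglongrightarrow> Infty"
        unfolding lim_sequentially
      proof (intro allI impI)
        fix e :: real assume "e > 0"
        then obtain k where "inverse (real (Suc k)) < e" using reals_Archimedean by blast
        then show "\<exists>N. \<forall>n\<ge>N. dist (random_orbit \<gamma> n z) Infty < e" using h by (meson less_trans)
      qed
    qed
  qed
  also have "\<dots> \<in> sets ?M"
    by (intro sets.sets_Collect_countable_All sets.sets_Collect_countable_Ex sets_orbit_event
        sets.sets_Collect_imp)
  finally show ?thesis .
qed

lemma random_orbit_shift: "random_orbit (case_nat s \<omega>) (Suc n) z = random_orbit \<omega> n (s z)"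
  by (induction n) auto

lemma tend_prob_escape_event: "tend_prob h1 h2 p z = measure (code_space h1 h2 p) (escape_event h1 h2 p z)"
  by (simp add: tend_prob_def Let_def escape_event_def)

text \<open>
  Conditioning on the first letter.
\<close>

lemma tend_prob_step:
  assumes p: "0 < p" "p < 1"
  shows "tend_prob h1 h2 p z = p * tend_prob h1 h2 p (h1 z) + (1 - p) * tend_prob h1 h2 p (h2 z)"
proof -
  let ?M = "tau h1 h2 p" and ?S = "code_space h1 h2 p" and ?E = "escape_event h1 h2 p"
  interpret tau: prob_space ?M using p by (rule prob_space_tau)
  interpret sequence_space ?M by unfold_locales
  have "emeasure ?S (?E z) = emeasure (distr (?M \<Otimes>\<^sub>M ?S) ?S (\<lambda>(s, \<omega>). case_nat s \<omega>)) (?E z)"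
    by (simp add: PiM_iter)
  also have "\<dots> = emeasure (?M \<Otimes>\<^sub>M ?S) ((\<lambda>(s, \<omega>). case_nat s \<omega>) -` ?E z \<inter> space (?M \<Otimes>\<^sub>M ?S))"
    by (rule emeasure_distr) (auto simp: sets_escape_event)
  also have "\<dots> = (\<integral>\<^sup>+s. emeasure ?S (Pair s -` ((\<lambda>(s, \<omega>). case_nat s \<omega>) -` ?E z \<inter> space (?M \<Otimes>\<^sub>M ?S))) \<partial>?M)"
  proof (rule P.emeasure_pair_measure_alt)
    have "(\<lambda>(s, \<omega>). case_nat s \<omega>) \<in> measurable (?M \<Otimes>\<^sub>M ?S) ?S" by measurable
    then show "(\<lambda>(s, \<omega>). case_nat s \<omega>) -` ?E z \<inter> space (?M \<Otimes>\<^sub>M ?S) \<in> sets (?M \<Otimes>\<^sub>M ?S)"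
      by (rule measurable_sets) (rule sets_escape_event)
  qed
  also have "\<dots> = (\<integral>\<^sup>+s. emeasure ?S (?E (s z)) \<partial>?M)"
  proof (rule nn_integral_cong)
    fix s assume s: "s \<in> space ?M"
    have "Pair s -` ((\<lambda>(s, \<omega>). case_nat s \<omega>) -` ?E z \<inter> space (?M \<Otimes>\<^sub>M ?S)) = ?E (s z)"
    proof (rule set_eqI)
      fix \<omega>
      have "(\<lambda>n. random_orbit (case_nat s \<omega>) n z) \<longlonglongrightarrow> Infty \<longleftrightarrow> (\<lambda>n. random_orbit \<omega> n (s z)) \<longlonglongrightarrow> Infty"
        using filterlim_sequentially_Suc[of "\<lambda>n. random_orbit (case_nat s \<omega>) n z" "nhds Infty"]
        by (simp add: random_orbit_shift del: random_orbit.simps)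
      moreover have "case_nat s \<omega> \<in> space ?S" if "\<omega> \<in> space ?S"
        using that s by (auto simp: space_code_space space_tau split: nat.splits)
      ultimately show "\<omega> \<in> Pair s -` ((\<lambda>(s, \<omega>). case_nat s \<omega>) -` ?E z \<inter> space (?M \<Otimes>\<^sub>M ?S)) \<longleftrightarrow> \<omega> \<in> ?E (s z)"
        using s by (auto simp: escape_event_def space_pair_measure)
    qed
    then show "emeasure ?S (Pair s -` ((\<lambda>(s, \<omega>). case_nat s \<omega>) -` ?E z \<inter> space (?M \<Otimes>\<^sub>M ?S))) = emeasure ?S (?E (s z))"
      by simp
  qed
  also have "\<dots> = ennreal p * emeasure ?S (?E (h1 z)) + ennreal (1 - p) * emeasure ?S (?E (h2 z))"
    by (rule nn_integral_tau[OF p])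
  also have "\<dots> = ennreal (p * measure ?S (?E (h1 z)) + (1 - p) * measure ?S (?E (h2 z)))"
    using p by (simp add: P.emeasure_eq_measure ennreal_mult ennreal_plus)
  finally have "ennreal (measure ?S (?E z)) = ennreal (p * measure ?S (?E (h1 z)) + (1 - p) * measure ?S (?E (h2 z)))"
    by (simp add: P.emeasure_eq_measure)
  then show ?thesis
    unfolding tend_prob_escape_event using p by (subst (asm) ennreal_inj) (auto intro!: add_nonneg_nonneg mult_nonneg_nonneg)
qed

lemma tend_prob_bounds:
  assumes p: "0 < p" "p < 1"
  shows "0 \<le> tend_prob h1 h2 p z" "tend_prob h1 h2 p z \<le> 1"
proof -
  interpret tau: prob_space "tau h1 h2 p" using p by (rule prob_space_tau)
  interpret sequence_space "tau h1 h2 p" by unfold_locales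
  show "0 \<le> tend_prob h1 h2 p z" "tend_prob h1 h2 p z \<le> 1"
    by (auto simp: tend_prob_escape_event)
qed

lemma tend_prob_eq_1:
  assumes p: "0 < p" "p < 1" and "escape_event h1 h2 p z = space (code_space h1 h2 p)"
  shows "tend_prob h1 h2 p z = 1"
proof -
  interpret tau: prob_space "tau h1 h2 p" using p by (rule prob_space_tau)
  interpret sequence_space "tau h1 h2 p" by unfold_locales
  show ?thesis using P.prob_space by (simp add: tend_prob_escape_event assms)
qed

context poly_pair
begin

abbreviation T :: "real \<Rightarrow> riemann_sphere \<Rightarrow> real" where
  "T \<equiv> tend_prob (poly_map (q True)) (poly_map (q False))"

abbreviation codes :: "real \<Rightarrow> (nat \<Rightarrow> riemann_sphere \<Rightarrow> riemann_sphere) set" where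
  "codes p \<equiv> space (code_space (poly_map (q True)) (poly_map (q False)) p)"

lemma T_step: "0 < p \<Longrightarrow> p < 1 \<Longrightarrow>
    T p (Fin z) = p * T p (Fin (poly (q True) z)) + (1 - p) * T p (Fin (poly (q False) z))"
  by (subst tend_prob_step) auto

lemma random_orbit_word:
  assumes "\<gamma> \<in> codes p"
  obtains w where "length w = n" "\<And>x. random_orbit \<gamma> (m + n) x = poly_map (wp w) (random_orbit \<gamma> m x)"
proof -
  have "\<exists>w. length w = n \<and> (\<forall>x. random_orbit \<gamma> (m + n) x = poly_map (wp w) (random_orbit \<gamma> m x))"
  proof (induction n)
    case 0
    have "poly_map (wp []) x = x" for x by (cases x) auto
    then show ?case by auto
  next
    case (Suc n)
    then obtain w where w: "length w = n" "\<And>x. random_orbit \<gamma> (m + n) x = poly_map (wp w) (random_orbit \<gamma> m x)" by blast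
    have "\<gamma> (m + n) \<in> {poly_map (q True), poly_map (q False)}" using assms by (auto simp: space_code_space)
    then obtain b where b: "\<gamma> (m + n) = poly_map (q b)" by auto
    have app: "poly_map (wp (w @ [b])) x = poly_map (q b) (poly_map (wp w) x)" for x
      using degree_wp_pos[of "w @ [b]"] degree_wp_pos[of w] deg[of b]
      by (cases x) (auto simp: g_append poly_pcompose)
    then show ?case using w b by (intro exI[of _ "w @ [b]"]) (simp del: poly_map.simps word_poly.simps)
  qed
  then show ?thesis using that by blast
qed

lemma orbit_tends_to_Infty:
  assumes \<gamma>: "\<gamma> \<in> codes p" and m: "random_orbit \<gamma> m x = Infty \<or> (\<exists>z. random_orbit \<gamma> m x = Fin z \<and> cmod z \<ge> R)"
  shows "(\<lambda>n. random_orbit \<gamma> n x) \<longlonglongrightarrow> Infty"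
  unfolding lim_sequentially
proof (intro allI impI)
  fix e :: real assume "e > 0"
  then obtain M where M: "\<And>z. cmod z \<ge> M \<Longrightarrow> dist (Fin z) Infty < e" using large_imp_near_Infty by metis
  obtain N :: nat where N: "M < 2 ^ N" using real_arch_pow[of 2 M] by auto
  show "\<exists>no. \<forall>n\<ge>no. dist (random_orbit \<gamma> n x) Infty < e"
  proof (intro exI allI impI)
    fix n assume n: "n \<ge> m + N"
    obtain w where w: "length w = n - m" "\<And>x. random_orbit \<gamma> (m + (n - m)) x = poly_map (wp w) (random_orbit \<gamma> m x)"
      using random_orbit_word[OF \<gamma>] by metis
    have orb: "random_orbit \<gamma> n x = poly_map (wp w) (random_orbit \<gamma> m x)" using w(2)[of x] n by simp
    show "dist (random_orbit \<gamma> n x) Infty < e"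
    proof (cases "random_orbit \<gamma> m x")
      case (Fin z)
      then have z: "cmod z \<ge> R" using m by auto
      have "(2::real) ^ N \<le> 2 ^ length w" using n w(1) by (intro power_increasing) auto
      then have "2 ^ N * 1 \<le> 2 ^ length w * cmod z" using z R1 by (intro mult_mono) auto
      then have "cmod (g w z) \<ge> M" using g_escape[OF z, of w] N by linarith
      then show ?thesis using M orb Fin by simp
    next
      case Infty
      then show ?thesis using orb poly_map_wp_Infty[of w] \<open>e > 0\<close> by simp
    qed
  qed
qed

lemma T_far:
  assumes p: "0 < p" "p < 1" and z: "cmod z \<ge> R"
  shows "T p (Fin z) = 1"
  using orbit_tends_to_Infty[where m = 0] z
  by (intro tend_prob_eq_1[OF p]) (auto simp: escape_event_def)

lemma T_bounded_orbit:
  assumes p: "0 < p" "p < 1" and bd: "\<And>w. cmod (g w z) \<le> M"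
  shows "T p (Fin z) = 0"
proof -
  have "\<not> (\<lambda>n. random_orbit \<gamma> n (Fin z)) \<longlonglongrightarrow> Infty" if \<gamma>: "\<gamma> \<in> codes p" for \<gamma>
  proof
    assume lim: "(\<lambda>n. random_orbit \<gamma> n (Fin z)) \<longlonglongrightarrow> Infty"
    obtain e where e: "e > 0" "\<And>z. dist (Fin z) Infty < e \<Longrightarrow> cmod z > M" using near_Infty_imp_large by metis
    then obtain n where n: "dist (random_orbit \<gamma> n (Fin z)) Infty < e"
      using lim unfolding lim_sequentially by blast
    obtain w where w: "\<And>x. random_orbit \<gamma> (0 + n) x = poly_map (wp w) (random_orbit \<gamma> 0 x)"
      using random_orbit_word[OF \<gamma>] by metis
    show False using e(2)[of "g w z"] n w[of "Fin z"] bd[of w] by simp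
  qed
  then have "escape_event (poly_map (q True)) (poly_map (q False)) p (Fin z) = {}"
    by (auto simp: escape_event_def)
  then show ?thesis by (simp add: tend_prob_escape_event)
qed

text \<open>
  By equicontinuity all random orbits of nearby points stay close, uniformly in the letters; one of
  them enters the escape region exactly if the other does. So the two escape events are equal.
\<close>

lemma T_locally_constant_Fatou:
  assumes x: "x \<in> Fatou G"
  obtains d where "d > 0" "\<And>y. dist y x < d \<Longrightarrow> T p y = T p x"
proof -
  obtain e where e: "e > 0" "\<And>z. dist (Fin z) Infty < e \<Longrightarrow> cmod z > R" using near_Infty_imp_large by metis
  obtain d1 where d1: "d1 > 0" "\<And>f y. f \<in> G \<Longrightarrow> y \<in> Fatou G \<Longrightarrow> dist y x < d1 \<Longrightarrow> dist (f y) (f x) < e/2"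
    using Fatou_maximal(2)[of G] x e unfolding equicontinuous_on_def by (metis half_gt_zero)
  obtain d2 where d2: "d2 > 0" "\<And>y. dist y x < d2 \<Longrightarrow> y \<in> Fatou G"
    using Fatou_maximal(1)[of G] x unfolding open_dist by blast
  have esc: "(\<lambda>n. random_orbit \<gamma> n v) \<longlonglongrightarrow> Infty"
    if \<gamma>: "\<gamma> \<in> codes p" and lim: "(\<lambda>n. random_orbit \<gamma> n u) \<longlonglongrightarrow> Infty"
      and close: "\<And>f. f \<in> G \<Longrightarrow> dist (f v) (f u) < e/2" for \<gamma> u v
  proof -
    obtain n where n: "n \<ge> 1" "dist (random_orbit \<gamma> n u) Infty < e/2"
      using lim e(1) unfolding lim_sequentially by (metis half_gt_zero nat_le_linear)
    obtain w where w: "length w = n" "\<And>x. random_orbit \<gamma> (0 + n) x = poly_map (wp w) (random_orbit \<gamma> 0 x)"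
      using random_orbit_word[OF \<gamma>] by metis
    have "poly_map (wp w) \<in> G" using w(1) n(1) semigroup_words by auto
    then have "dist (random_orbit \<gamma> n v) (random_orbit \<gamma> n u) < e/2" using close w(2) by simp
    then have "dist (random_orbit \<gamma> n v) Infty < e"
      using n dist_triangle[of "random_orbit \<gamma> n v" Infty "random_orbit \<gamma> n u"] by linarith
    then have "random_orbit \<gamma> n v = Infty \<or> (\<exists>z. random_orbit \<gamma> n v = Fin z \<and> cmod z \<ge> R)"
      using e(2) by (cases "random_orbit \<gamma> n v") (auto intro: less_imp_le)
    then show ?thesis using orbit_tends_to_Infty[OF \<gamma>] by blast
  qed
  show ?thesis
  proof (rule that[of "min d1 d2"])
    fix y assume y: "dist y x < min d1 d2"
    have c: "dist (f y) (f x) < e/2" "dist (f x) (f y) < e/2" if "f \<in> G" for f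
      using d1(2)[OF that, of y] d2(2)[of y] y by (auto simp: dist_commute)
    have "escape_event (poly_map (q True)) (poly_map (q False)) p y
        = escape_event (poly_map (q True)) (poly_map (q False)) p x"
      using esc c unfolding escape_event_def by blast
    then show "T p y = T p x" by (simp add: tend_prob_escape_event)
  qed (use d1 d2 in simp)
qed

lemma T_Fatou_connected:
  assumes C: "connected C" "Fin ` C \<subseteq> Fatou G" and xy: "x \<in> C" "y \<in> C"
  shows "T p (Fin x) = T p (Fin y)"
proof -
  have "(\<lambda>z. T p (Fin z)) constant_on C"
  proof (rule locally_constant_imp_constant[OF C(1)])
    fix z assume z: "z \<in> C"
    then obtain d where d: "d > 0" "\<And>y. dist y (Fin z) < d \<Longrightarrow> T p y = T p (Fin z)"
      using T_locally_constant_Fatou C(2) by blast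
    obtain d' where d': "d' > 0" "\<And>z w. cmod (z - w) < d' \<Longrightarrow> dist (Fin z) (Fin w) < d"
      using Fin_uniformly_continuous[OF d(1)] by metis
    show "\<exists>V. openin (top_of_set C) V \<and> z \<in> V \<and> (\<forall>w\<in>V. T p (Fin w) = T p (Fin z))"
    proof (intro exI[of _ "C \<inter> ball z d'"] conjI ballI)
      fix w assume "w \<in> C \<inter> ball z d'"
      then show "T p (Fin w) = T p (Fin z)" by (intro d(2) d'(2)) (simp add: dist_norm norm_minus_commute)
    qed (use z d'(1) in \<open>auto intro: openin_open_Int\<close>)
  qed
  then show ?thesis using xy by (auto simp: constant_on_def)
qed

section \<open>Ordered pairs\<close>

text \<open>
  The second condition says \<open>h\<^sub>1\<^sup>-\<^sup>1(K\<^sub>2) \<subseteq> h\<^sub>2\<^sup>-\<^sup>1(K\<^sub>1)\<close>: the two preimages of the region between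
  \<open>K\<^sub>1\<close> and \<open>K\<^sub>2\<close> overlap at most along frontiers.
\<close>

definition ordered :: bool where
  "ordered \<longleftrightarrow> K True \<subseteq> K False \<and> (\<forall>z. poly (q True) z \<in> K False \<longrightarrow> poly (q False) z \<in> K True)"

lemma ordered_forward: "ordered \<Longrightarrow> z \<in> K True \<Longrightarrow> g w z \<in> K True"
proof (induction w arbitrary: z)
  case (Cons b w)
  have "poly (q True) z \<in> K True" using Cons.prems(2) by (simp add: filled_vimage)
  moreover have "poly (q False) z \<in> K True" using calculation Cons.prems(1) by (auto simp: ordered_def)
  ultimately have "poly (q b) z \<in> K True" by (cases b) auto
  then show ?case using Cons by (simp add: poly_pcompose)
qed simp

lemma ordered_backward: "ordered \<Longrightarrow> g w z \<in> K False \<Longrightarrow> z \<in> K False"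
proof (induction w arbitrary: z)
  case (Cons b w)
  then have b: "poly (q b) z \<in> K False" by (simp add: poly_pcompose)
  have "poly (q False) z \<in> K False"
  proof (cases b)
    case True
    then have "poly (q False) z \<in> K True" using b Cons.prems by (auto simp: ordered_def)
    then show ?thesis using Cons.prems by (auto simp: ordered_def)
  qed (use b in simp)
  then show ?case by (simp add: filled_vimage)
qed simp

lemma word_escapes_mono:
  assumes "cmod (g (w @ replicate m b) z) > R" "m \<le> n"
  shows "cmod (g (w @ replicate n b) z) > R"
proof -
  have eq: "w @ replicate n b = (w @ replicate m b) @ replicate (n - m) b"
    using assms(2) by (simp add: replicate_add[symmetric])
  have "1 * cmod (g (w @ replicate m b) z) \<le> 2 ^ (n - m) * cmod (g (w @ replicate m b) z)"
    by (intro mult_right_mono) auto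
  also have "\<dots> \<le> cmod (g (w @ replicate n b) z)"
    unfolding eq g_append[of "w @ replicate m b"]
    using g_escape[of "g (w @ replicate m b) z" "replicate (n - m) b"] assms(1) by simp
  finally show ?thesis using assms(1) by simp
qed

text \<open>
  The complement is an increasing union of superlevel sets of polynomials.
\<close>

lemma connected_Compl_preimage: "connected (- (g w -` K b))"
proof -
  have "- (g w -` K b) = (\<Union>n. {z. cmod (g (w @ replicate n b) z) > R})"
    by (simp add: set_eq_iff filled_iff not_le g_append)
  moreover have "connected (\<Union>n. {z. cmod (g (w @ replicate n b) z) > R})"
  proof (rule connected_Union, goal_cases)
    case (1 s)
    then obtain n where "s = {z. cmod (g (w @ replicate n b) z) > R}" by blast
    then show ?case using connected_superlevel[OF degree_wp_pos, of R "w @ replicate n b"] R1 by simp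
  next
    case 2
    have "of_real (R + 1) \<in> {z. cmod (g v z) > R}" for v
    proof (cases "v = []")
      case True then show ?thesis using R1 by simp
    next
      case False
      then show ?thesis using g_escape_strict[of "of_real (R + 1)" v] R1 by simp
    qed
    then show ?case by blast
  qed
  ultimately show ?thesis by simp
qed

lemma connected_Compl_filled: "connected (- K b)"
  using connected_Compl_preimage[of "[]" b] by (simp add: vimage_def)

text \<open>
  Words map the complement of \<open>K False\<close> into itself, so they omit the points of \<open>K False\<close>.
\<close>

lemma ordered_Fatou_outside:
  assumes "ordered" "z \<notin> K False"
  shows "Fin z \<in> Fatou G"
  by (rule Fatou_omit[of "- K False" z False])
     (use assms ordered_backward closed_filled in auto)

lemma ordered_Fatou_inside:
  assumes "ordered" "z \<in> interior (K True)"
  shows "Fin z \<in> Fatou G"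
  by (rule Fatou_bounded[of "interior (K True)" z R])
     (use assms ordered_forward filled_le_R interior_subset in blast)+

lemma ordered_T_inside:
  assumes p: "0 < p" "p < 1" and o: "ordered" and z: "z \<in> K True"
  shows "T p (Fin z) = 0"
  by (rule T_bounded_orbit[OF p, of z R]) (use ordered_forward[OF o z] filled_le_R in blast)

lemma ordered_T_outside:
  assumes p: "0 < p" "p < 1" and o: "ordered" and z: "z \<notin> K False"
  shows "T p (Fin z) = 1"
proof -
  let ?y = "of_real (R + 1) :: complex"
  have y: "cmod ?y = R + 1" using R1 by simp
  then have "?y \<notin> K False" using filled_le_R[of ?y False] by force
  then have "T p (Fin z) = T p (Fin ?y)"
    using T_Fatou_connected[OF connected_Compl_filled[of False], of z ?y p] ordered_Fatou_outside[OF o] z by blast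
  also have "\<dots> = 1" using T_far[OF p] y by simp
  finally show ?thesis .
qed

text \<open>
  The word \<open>True\<^sup>n\<close> has positive probability and leads into the escape region.
\<close>

lemma T_positive:
  assumes p: "0 < p" "p < 1" and z: "z \<notin> K True"
  shows "T p (Fin z) > 0"
proof -
  have step: "T p (Fin z) \<ge> p * T p (Fin (poly (q True) z))" for z
    using T_step[OF p, of z] tend_prob_bounds[OF p] p by simp
  have iter: "T p (Fin z) \<ge> p ^ n * T p (Fin (g (replicate n True) z))" for n z
  proof (induction n arbitrary: z)
    case (Suc n)
    have "p ^ Suc n * T p (Fin (g (replicate (Suc n) True) z)) = p * (p ^ n * T p (Fin (g (replicate n True) (poly (q True) z))))"
      by (simp add: poly_pcompose)
    also have "\<dots> \<le> p * T p (Fin (poly (q True) z))" using Suc p by (intro mult_left_mono) auto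
    also have "\<dots> \<le> T p (Fin z)" by (rule step)
    finally show ?case .
  qed simp
  obtain n where "n \<ge> 1" "cmod (g (replicate n True) z) > R" using not_filled_escapes[OF z] by metis
  then have "T p (Fin (g (replicate n True) z)) = 1" using T_far[OF p] by simp
  then show ?thesis using iter[of n z] p by (metis mult.right_neutral order_less_le_trans zero_less_power)
qed

text \<open>
  Induction on the word. If its first letter is \<open>True\<close>, the other letter sends \<open>z\<close> into \<open>K True\<close>, so
  it contributes 0 to \<open>T z\<close>; if it is \<open>False\<close>, the other letter sends \<open>z'\<close> outside \<open>K False\<close>, so it
  contributes its full weight to \<open>T z'\<close>.
\<close>

lemma ordered_T_strict:
  assumes p: "0 < p" "p < 1" and o: "ordered"
  shows "g w z \<in> K True \<Longrightarrow> g w z' \<notin> K True \<Longrightarrow> T p (Fin z) < T p (Fin z')"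
proof (induction w arbitrary: z z')
  case Nil
  then show ?case using ordered_T_inside[OF p o, of z] T_positive[OF p, of z'] by simp
next
  case (Cons b w)
  have h: "g w (poly (q b) z) \<in> K True" "g w (poly (q b) z') \<notin> K True"
    using Cons.prems by (simp_all add: poly_pcompose)
  have IH: "T p (Fin (poly (q b) z)) < T p (Fin (poly (q b) z'))" by (rule Cons.IH[OF h])
  show ?case
  proof (cases b)
    case True
    have "poly (q True) z \<in> K False"
      using ordered_backward[OF o, of w "poly (q True) z"] h(1) True o by (auto simp: ordered_def)
    then have "T p (Fin (poly (q False) z)) = 0" using ordered_T_inside[OF p o] o by (auto simp: ordered_def)
    moreover have "T p (Fin (poly (q False) z')) \<ge> 0" using tend_prob_bounds[OF p] by blast
    moreover have "p * T p (Fin (poly (q True) z)) < p * T p (Fin (poly (q True) z'))" using IH True p by simp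
    moreover have "(1 - p) * T p (Fin (poly (q False) z')) \<ge> 0" using calculation p by simp
    ultimately show ?thesis unfolding T_step[OF p, of z] T_step[OF p, of z'] by simp
  next
    case False
    have "poly (q False) z' \<notin> K True" using ordered_forward[OF o, of "poly (q False) z'" w] h(2) False by auto
    then have "poly (q True) z' \<notin> K False" using o by (auto simp: ordered_def)
    then have "T p (Fin (poly (q True) z')) = 1" by (rule ordered_T_outside[OF p o])
    then have "p * T p (Fin (poly (q True) z)) \<le> p * T p (Fin (poly (q True) z'))"
      using tend_prob_bounds[OF p] p by (intro mult_left_mono) auto
    moreover have "(1 - p) * T p (Fin (poly (q False) z)) < (1 - p) * T p (Fin (poly (q False) z'))"
      using IH False p by simp
    ultimately show ?thesis unfolding T_step[OF p, of z] T_step[OF p, of z'] by linarith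
  qed
qed

theorem ordered_Julia_eq:
  assumes p: "0 < p" "p < 1" and o: "ordered"
  shows "Julia G = {z0. \<forall>U. open U \<and> z0 \<in> U \<longrightarrow> \<not> T p constant_on U}"
proof (intro equalityI subsetI CollectI allI impI)
  fix z0 U assume z0: "z0 \<in> Julia G" and U: "open U \<and> z0 \<in> U"
  obtain x where x: "z0 = Fin x" "Fin x \<notin> Fatou G" using z0 Julia_J by (auto simp: J_iff)
  have "open (Fin -` U)" "x \<in> Fin -` U" using U x open_Fin_vimage by auto
  then obtain r where r: "r > 0" "ball x r \<subseteq> Fin -` U" by (meson openE)
  obtain w z where z: "z \<in> ball x r" "g w z \<in> frontier (K True)" using Julia_meets_preimages[OF x(2) r(1)] by metis
  have "z \<in> frontier (g w -` K True)" using z(2) frontier_poly_vimage[OF degree_wp_pos] by simp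
  then have "z \<in> closure (- (g w -` K True))" by (simp add: frontier_closures)
  then have "ball x r \<inter> - (g w -` K True) \<noteq> {}"
    using z(1) open_Int_closure_eq_empty[of "ball x r" "- (g w -` K True)"] by blast
  then obtain z' where z': "z' \<in> ball x r" "g w z' \<notin> K True" by blast
  have "g w z \<in> K True" using z(2) closed_filled by (auto simp: frontier_def)
  then have "T p (Fin z) < T p (Fin z')" using ordered_T_strict[OF p o] z' by blast
  moreover have "Fin z \<in> U" "Fin z' \<in> U" using z(1) z'(1) r(2) by auto
  ultimately show "\<not> T p constant_on U" by (force simp: constant_on_def)
next
  fix z0 assume z0: "z0 \<in> {z0. \<forall>U. open U \<and> z0 \<in> U \<longrightarrow> \<not> T p constant_on U}"
  show "z0 \<in> Julia G"
  proof (rule ccontr)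
    assume "z0 \<notin> Julia G"
    then obtain d where d: "d > 0" "\<And>y. dist y z0 < d \<Longrightarrow> T p y = T p z0"
      using T_locally_constant_Fatou[of z0 p] by (auto simp: Julia_def)
    have "T p constant_on ball z0 d" using d(2) by (auto simp: constant_on_def dist_commute)
    moreover have "open (ball z0 d)" "z0 \<in> ball z0 d" using d by auto
    ultimately show False using z0 by blast
  qed
qed

lemma frontier_filled_vimage: "poly (q b) z \<in> frontier (K b) \<longleftrightarrow> z \<in> frontier (K b)"
  and interior_filled_vimage: "poly (q b) z \<in> interior (K b) \<longleftrightarrow> z \<in> interior (K b)"
proof -
  have "poly (q b) -` K b = K b" using filled_vimage by auto
  moreover have d: "degree (q b) > 0" using deg[of b] by simp
  ultimately show "poly (q b) z \<in> frontier (K b) \<longleftrightarrow> z \<in> frontier (K b)"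
      "poly (q b) z \<in> interior (K b) \<longleftrightarrow> z \<in> interior (K b)"
    using frontier_poly_vimage[OF d, of "K b"] interior_poly_vimage[OF d, of "K b"] by auto
qed

text \<open>
  If all words of length two led from \<open>z\<close> to Julia points, then \<open>h\<^sub>2 z\<close> would be a frontier point of
  \<open>K\<^sub>1\<close> by the ordering of the pair, and the same argument one step later would put \<open>h\<^sub>1 (h\<^sub>2 z)\<close> on both
  frontiers.
\<close>

lemma ordered_some_word_Fatou:
  assumes o: "ordered" and disj: "frontier (K True) \<inter> frontier (K False) = {}"
  shows "\<exists>b c. Fin (g [b, c] z) \<in> Fatou G"
proof (rule ccontr)
  assume neg: "\<nexists>b c. Fin (g [b, c] z) \<in> Fatou G"
  define y where "y = poly (q False) z"
  have gF: "g [b, c] z = poly (q c) (poly (q b) z)" for b c by (simp add: poly_pcompose)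
  have inK: "poly (q c) (poly (q b) z) \<in> K False" and notint: "poly (q c) (poly (q b) z) \<notin> interior (K True)" for b c
    using neg ordered_Fatou_outside[OF o] ordered_Fatou_inside[OF o] unfolding gF by blast+
  have "poly (q True) z \<in> K False"
    using ordered_backward[OF o, of "[True]" "poly (q True) z"] inK[of True True] by (simp add: poly_pcompose)
  then have y1: "y \<in> K True" using o by (auto simp: ordered_def y_def)
  moreover have "y \<notin> interior (K True)" using notint[of True False] interior_filled_vimage[of True y] by (simp add: y_def)
  ultimately have "y \<in> frontier (K True)" using closed_filled by (simp add: frontier_def)
  then have fr1: "poly (q True) y \<in> frontier (K True)" by (simp add: frontier_filled_vimage)
  have "poly (q True) y \<notin> interior (K False)"
  proof
    assume "poly (q True) y \<in> interior (K False)"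
    then have "y \<in> poly (q True) -` interior (K False)" by simp
    moreover have "open (poly (q True) -` interior (K False))"
      by (intro open_vimage) (auto intro: continuous_intros)
    moreover have "poly (q True) -` interior (K False) \<subseteq> poly (q False) -` K True"
    proof
      fix x assume "x \<in> poly (q True) -` interior (K False)"
      then have "poly (q True) x \<in> K False" using interior_subset by auto
      then show "x \<in> poly (q False) -` K True" using o by (simp add: ordered_def)
    qed
    ultimately have "y \<in> interior (poly (q False) -` K True)" by (meson interior_maximal subsetD)
    then have "poly (q False) y \<in> interior (K True)"
      using interior_poly_vimage[of "q False" "K True"] deg[of False] by auto
    then show False using notint[of False False] by (simp add: y_def)
  qed
  then have "poly (q True) y \<in> frontier (K False)"
    using inK[of True False] closed_filled by (simp add: frontier_def y_def)
  then show False using fr1 disj by blast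
qed

lemma T_two_steps:
  assumes p: "0 < p" "p < 1"
  shows "T p (Fin z) = p * p * T p (Fin (g [True, True] z)) + p * (1 - p) * T p (Fin (g [True, False] z))
    + (1 - p) * p * T p (Fin (g [False, True] z)) + (1 - p) * (1 - p) * T p (Fin (g [False, False] z))"
  using T_step[OF p, of z] T_step[OF p, of "poly (q True) z"] T_step[OF p, of "poly (q False) z"]
  by (simp add: poly_pcompose algebra_simps)

definition osc_le :: "real \<Rightarrow> real \<Rightarrow> bool" where
  "osc_le p s \<longleftrightarrow> (\<forall>z. \<exists>d>0. \<forall>u\<in>ball z d. \<forall>v\<in>ball z d. \<bar>T p (Fin u) - T p (Fin v)\<bar> \<le> s)"

text \<open>
  Among the four words of length two, one contributes no oscillation at \<open>z\<close>, and its weight is at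
  least the square of the smaller probability.
\<close>

lemma osc_step:
  assumes p: "0 < p" "p < 1" and o: "ordered" and disj: "frontier (K True) \<inter> frontier (K False) = {}"
    and s: "s \<ge> 0" "osc_le p s"
  shows "osc_le p ((1 - (min p (1 - p))\<^sup>2) * s)"
  unfolding osc_le_def
proof
  fix z
  obtain b0 c0 where F: "Fin (g [b0, c0] z) \<in> Fatou G" using ordered_some_word_Fatou[OF o disj] by blast
  define S where "S b c = (if b = b0 \<and> c = c0 then 0 else s)" for b c
  have pull: "\<exists>d>0. \<forall>u\<in>ball z d. g w u \<in> ball (g w z) e" if "e > 0" for w e
  proof -
    have "isCont (g w) z" by (intro continuous_intros)
    then show ?thesis using that unfolding continuous_at_eps_delta by (metis dist_norm dist_commute mem_ball)
  qed
  have "\<exists>d>0. \<forall>u\<in>ball z d. \<forall>v\<in>ball z d. \<bar>T p (Fin (g [b, c] u)) - T p (Fin (g [b, c] v))\<bar> \<le> S b c" for b c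
  proof (cases "b = b0 \<and> c = c0")
    case True
    then obtain d where d: "d > 0" "\<And>y. dist y (Fin (g [b, c] z)) < d \<Longrightarrow> T p y = T p (Fin (g [b, c] z))"
      using T_locally_constant_Fatou[OF F, of p] by metis
    obtain d' where d': "d' > 0" "\<And>z w. cmod (z - w) < d' \<Longrightarrow> dist (Fin z) (Fin w) < d"
      using Fin_uniformly_continuous[OF d(1)] by metis
    obtain d'' where d'': "d'' > 0" "\<forall>u\<in>ball z d''. g [b, c] u \<in> ball (g [b, c] z) d'" using pull[OF d'(1)] by blast
    have "T p (Fin (g [b, c] u)) = T p (Fin (g [b, c] z))" if "u \<in> ball z d''" for u
      using d''(2) that by (intro d(2) d'(2)) (force simp: dist_norm norm_minus_commute simp del: word_poly.simps)
    then have "\<bar>T p (Fin (g [b, c] u)) - T p (Fin (g [b, c] v))\<bar> \<le> S b c" if "u \<in> ball z d''" "v \<in> ball z d''" for u v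
      using that True unfolding S_def by (simp del: word_poly.simps)
    then show ?thesis using d''(1) by blast
  next
    case False
    obtain d where d: "d > 0" "\<forall>u\<in>ball (g [b, c] z) d. \<forall>v\<in>ball (g [b, c] z) d. \<bar>T p (Fin u) - T p (Fin v)\<bar> \<le> s"
      using s(2) unfolding osc_le_def by metis
    obtain d'' where d'': "d'' > 0" "\<forall>u\<in>ball z d''. g [b, c] u \<in> ball (g [b, c] z) d" using pull[OF d(1)] by blast
    moreover have "S b c = s" using False by (auto simp: S_def)
    ultimately show ?thesis using d(2) by (intro exI[of _ d'']) (simp del: word_poly.simps)
  qed
  then obtain D where D: "\<And>b c. D b c > 0"
    "\<And>b c u v. u \<in> ball z (D b c) \<Longrightarrow> v \<in> ball z (D b c) \<Longrightarrow> \<bar>T p (Fin (g [b, c] u)) - T p (Fin (g [b, c] v))\<bar> \<le> S b c"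
    by metis
  define d where "d = min (min (D True True) (D True False)) (min (D False True) (D False False))"
  show "\<exists>d>0. \<forall>u\<in>ball z d. \<forall>v\<in>ball z d. \<bar>T p (Fin u) - T p (Fin v)\<bar> \<le> (1 - (min p (1 - p))\<^sup>2) * s"
  proof (intro exI conjI ballI)
    show "d > 0" using D(1) by (simp add: d_def)
    fix u v assume uv: "u \<in> ball z d" "v \<in> ball z d"
    define \<Delta> where "\<Delta> b c = T p (Fin (g [b, c] u)) - T p (Fin (g [b, c] v))" for b c
    have \<Delta>: "\<bar>\<Delta> b c\<bar> \<le> S b c" for b c
      unfolding \<Delta>_def by (rule D(2)) (use uv in \<open>cases b; cases c; simp add: d_def\<close>)+
    have pos: "0 \<le> p * p" "0 \<le> p * (1 - p)" "0 \<le> (1 - p) * p" "0 \<le> (1 - p) * (1 - p)" using p by auto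
    have "T p (Fin u) - T p (Fin v) = p * p * \<Delta> True True + p * (1 - p) * \<Delta> True False
        + (1 - p) * p * \<Delta> False True + (1 - p) * (1 - p) * \<Delta> False False"
      unfolding T_two_steps[OF p, of u] T_two_steps[OF p, of v] \<Delta>_def by (simp only: algebra_simps)
    also have "\<bar>\<dots>\<bar> \<le> \<bar>p * p * \<Delta> True True\<bar> + \<bar>p * (1 - p) * \<Delta> True False\<bar>
        + \<bar>(1 - p) * p * \<Delta> False True\<bar> + \<bar>(1 - p) * (1 - p) * \<Delta> False False\<bar>" by linarith
    also have "\<dots> \<le> p * p * S True True + p * (1 - p) * S True False + (1 - p) * p * S False True + (1 - p) * (1 - p) * S False False"
      unfolding abs_mult[of "p * p"] abs_mult[of "p * (1 - p)"] abs_mult[of "(1 - p) * p"] abs_mult[of "(1 - p) * (1 - p)"]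
        abs_of_nonneg[OF pos(1)] abs_of_nonneg[OF pos(2)] abs_of_nonneg[OF pos(3)] abs_of_nonneg[OF pos(4)]
      using pos \<Delta> by (intro add_mono mult_left_mono)
    also have "\<dots> = (1 - (if b0 then p else 1 - p) * (if c0 then p else 1 - p)) * s"
      by (cases b0; cases c0) (simp_all add: S_def algebra_simps)
    also have "\<dots> \<le> (1 - (min p (1 - p))\<^sup>2) * s"
    proof (intro mult_right_mono diff_left_mono)
      show "(min p (1 - p))\<^sup>2 \<le> (if b0 then p else 1 - p) * (if c0 then p else 1 - p)"
        unfolding power2_eq_square using p by (intro mult_mono) auto
    qed (rule s)
    finally show "\<bar>T p (Fin u) - T p (Fin v)\<bar> \<le> (1 - (min p (1 - p))\<^sup>2) * s" .
  qed
qed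

theorem ordered_continuous_iff:
  assumes p: "0 < p" "p < 1" and o: "ordered"
  shows "continuous_on UNIV (T p) \<longleftrightarrow> frontier (K True) \<inter> frontier (K False) = {}"
proof
  assume cont: "continuous_on UNIV (T p)"
  show "frontier (K True) \<inter> frontier (K False) = {}"
  proof (rule ccontr)
    assume "frontier (K True) \<inter> frontier (K False) \<noteq> {}"
    then obtain z where z: "z \<in> frontier (K True)" "z \<in> frontier (K False)" by blast
    then have T0: "T p (Fin z) = 0" using ordered_T_inside[OF p o] closed_filled by (auto simp: frontier_def)
    have "continuous_on UNIV (\<lambda>z. T p (Fin z))"
      by (rule continuous_on_compose2[OF cont continuous_on_Fin]) simp
    then obtain d where d: "d > 0" "\<And>y. dist y z < d \<Longrightarrow> dist (T p (Fin y)) (T p (Fin z)) < 1"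
      unfolding continuous_on_iff by (metis UNIV_I zero_less_one)
    have "z \<in> closure (- K False)" using z(2) by (simp add: frontier_closures)
    then obtain y where y: "y \<notin> K False" "dist y z < d" using d(1) unfolding closure_approachable by auto
    then show False using d(2)[OF y(2)] ordered_T_outside[OF p o y(1)] T0 by simp
  qed
next
  assume disj: "frontier (K True) \<inter> frontier (K False) = {}"
  define k where "k = 1 - (min p (1 - p))\<^sup>2"
  have "(min p (1 - p))\<^sup>2 \<le> 1\<^sup>2" "(min p (1 - p))\<^sup>2 > 0" using p by (intro power_mono zero_less_power; auto)+
  then have k: "0 \<le> k" "k < 1" by (auto simp: k_def)
  have osc: "osc_le p (k ^ n)" for n
  proof (induction n)
    case 0
    have "\<bar>T p x - T p y\<bar> \<le> 1" for x y
      using tend_prob_bounds[OF p, of _ _ x] tend_prob_bounds[OF p, of _ _ y] by (smt (verit))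
    then show ?case unfolding osc_le_def by (auto intro!: exI[of _ 1])
  next
    case (Suc n)
    then show ?case using osc_step[OF p o disj, of "k ^ n"] k by (simp add: k_def)
  qed
  show "continuous_on UNIV (T p)"
    unfolding continuous_on_iff
  proof (intro ballI allI impI)
    fix x and e :: real assume e: "e > 0"
    show "\<exists>d>0. \<forall>x'\<in>UNIV. dist x' x < d \<longrightarrow> dist (T p x') (T p x) < e"
    proof (cases x)
      case Infty
      then show ?thesis using T_locally_constant_Fatou[OF Infty_Fatou, of p] e by (metis dist_self)
    next
      case (Fin z)
      obtain n where n: "k ^ n < e" using real_arch_pow_inv[OF e k(2)] by blast
      obtain d where d: "d > 0" "\<forall>u\<in>ball z d. \<forall>v\<in>ball z d. \<bar>T p (Fin u) - T p (Fin v)\<bar> \<le> k ^ n"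
        using osc[of n] unfolding osc_le_def by blast
      have "open (Fin ` ball z d)" "x \<in> Fin ` ball z d" using d(1) Fin by (auto intro: open_Fin_image)
      then obtain d' where d': "d' > 0" "\<And>y. dist y x < d' \<Longrightarrow> y \<in> Fin ` ball z d" unfolding open_dist by blast
      show ?thesis
      proof (intro exI conjI ballI impI)
        show "d' > 0" by (rule d')
        fix x' assume "dist x' x < d'"
        then obtain u where "x' = Fin u" "u \<in> ball z d" using d'(2) by blast
        then have "\<bar>T p x' - T p x\<bar> \<le> k ^ n" using d Fin by auto
        then show "dist (T p x') (T p x) < e" using n by (simp add: dist_real_def)
      qed
    qed
  qed
qed

end

section \<open>Bounded postcritical sets\<close>

lemma critical_point_Fin:
  "critical_point (poly_map f) (Fin c) \<longleftrightarrow> poly (pderiv f) c = 0"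
proof -
  have "critical_point (poly_map f) (Fin c) \<longleftrightarrow> (poly f has_field_derivative 0) (at c)"
    by (simp add: critical_point_def)
  also have "\<dots> \<longleftrightarrow> poly (pderiv f) c = 0"
    using DERIV_unique[OF poly_DERIV[of f c]] poly_DERIV[of f c] by metis
  finally show ?thesis .
qed

lemma Fin_in_CV:
  assumes "degree f > 0"
  shows "Fin v \<in> CV (poly_map f) \<longleftrightarrow> (\<exists>c. poly (pderiv f) c = 0 \<and> poly f c = v)"
proof
  assume "Fin v \<in> CV (poly_map f)"
  then obtain a where a: "critical_point (poly_map f) a" "Fin v = poly_map f a" by (auto simp: CV_def)
  show "\<exists>c. poly (pderiv f) c = 0 \<and> poly f c = v"
    using a assms critical_point_Fin by (cases a) auto
next
  assume "\<exists>c. poly (pderiv f) c = 0 \<and> poly f c = v"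
  then obtain c where "poly (pderiv f) c = 0" "poly f c = v" by blast
  then have "critical_point (poly_map f) (Fin c)" "poly_map f (Fin c) = Fin v" by (simp_all add: critical_point_Fin)
  then show "Fin v \<in> CV (poly_map f)" unfolding CV_def by (metis imageI mem_Collect_eq)
qed

text \<open>
  Compare \<open>f(z) - a\<close> with \<open>f(z/lam) - a\<close> outside \<open>Y\<close>. The quotient of the leading coefficients is a
  power of \<open>lam\<close>, and the maximum principle up to infinity bounds it by \<open>M / \<delta>\<close>.
\<close>

lemma max_principle_dilation:
  fixes f :: "complex poly"
  assumes f: "degree f > 0" and Y: "compact Y" "interior Y \<noteq> {}" and lam: "lam > 0" and \<delta>: "\<delta> > 0" and M: "M > 0"
    and far: "\<And>z. z \<notin> interior Y \<Longrightarrow> cmod (poly f (z / of_real lam) - a) \<ge> \<delta>"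
    and near: "\<And>z. z \<in> frontier Y \<Longrightarrow> cmod (poly f z - a) \<le> M"
  shows "lam ^ degree f \<le> M / \<delta>"
proof -
  define v where "v = f - [:a:]"
  define u where "u = v \<circ>\<^sub>p [:0, 1 / of_real lam:]"
  have dv: "degree v = degree f"
    using f unfolding v_def by (metis degree_pCons_0 degree_add_eq_left degree_minus diff_conv_add_uminus)
  have du: "degree u = degree f" unfolding u_def using lam dv by (simp add: degree_pcompose)
  have pv: "poly v z = poly f z - a" for z by (simp add: v_def)
  have pu: "poly u z = poly f (z / of_real lam) - a" for z by (simp add: u_def poly_pcompose pv)
  obtain c where c: "c \<in> interior Y" using Y by blast
  have le: "cmod (poly v z) \<le> (M / \<delta>) * cmod (poly u z)" if "z \<notin> Y" for z
  proof (rule max_principle_outside[OF Y(1) _ _ c _ _ that])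
    show "degree v \<le> degree u" using du dv by simp
    show "M / \<delta> > 0" using M \<delta> by simp
    show "poly u z \<noteq> 0" if "z \<notin> interior Y" for z using far[OF that] \<delta> unfolding pu by auto
    fix z assume z: "z \<in> frontier Y"
    then have "cmod (poly u z) \<ge> \<delta>" unfolding pu using far by (simp add: frontier_def)
    then have "(M / \<delta>) * cmod (poly u z) \<ge> (M / \<delta>) * \<delta>" using M \<delta> by (intro mult_left_mono) auto
    then show "cmod (poly v z) \<le> (M / \<delta>) * cmod (poly u z)" unfolding pv using near[OF z] \<delta> by simp
  qed
  obtain r where r: "\<And>z. z \<in> Y \<Longrightarrow> cmod z \<le> r" using compact_imp_bounded[OF Y(1)] by (auto simp: bounded_iff)
  have lv: "((\<lambda>z. cmod (poly v z / z ^ degree f)) \<longlongrightarrow> cmod (lead_coeff v)) at_infinity"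
    using poly_divide_tendsto_aux[of v] unfolding dv by (intro tendsto_norm)
  have lu: "((\<lambda>z. (M / \<delta>) * cmod (poly u z / z ^ degree f)) \<longlongrightarrow> (M / \<delta>) * cmod (lead_coeff u)) at_infinity"
    using poly_divide_tendsto_aux[of u] unfolding du by (intro tendsto_intros)
  have "cmod (lead_coeff v) \<le> (M / \<delta>) * cmod (lead_coeff u)"
  proof (rule tendsto_le[OF _ lu lv])
    show "\<forall>\<^sub>F z in at_infinity. cmod (poly v z / z ^ degree f) \<le> (M / \<delta>) * cmod (poly u z / z ^ degree f)"
      unfolding eventually_at_infinity
    proof (intro exI allI impI)
      fix z :: complex assume "cmod z \<ge> r + 1"
      then have "z \<notin> Y" using r by force
      then show "cmod (poly v z / z ^ degree f) \<le> (M / \<delta>) * cmod (poly u z / z ^ degree f)"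
        using divide_right_mono[OF le, of z "cmod (z ^ degree f)"] by (simp add: norm_divide)
    qed
  qed (rule trivial_limit_at_infinity)
  moreover have "lead_coeff u = lead_coeff v * (1 / of_real lam) ^ degree f"
    unfolding u_def using lam dv by (subst lead_coeff_comp) auto
  moreover have "cmod ((1 / of_real lam) ^ degree f) = 1 / lam ^ degree f"
    using lam by (simp add: norm_power norm_divide power_divide)
  ultimately have "cmod (lead_coeff v) \<le> (M / \<delta>) * (cmod (lead_coeff v) * (1 / lam ^ degree f))"
    by (simp add: norm_mult)
  moreover have "cmod (lead_coeff v) > 0" using dv f by (metis degree_0 leading_coeff_0_iff less_irrefl zero_less_norm_iff)
  ultimately have "cmod (lead_coeff v) \<le> (cmod (lead_coeff v) * (M / \<delta>)) / lam ^ degree f"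
    "cmod (lead_coeff v) > 0" by (simp_all add: mult_ac)
  then have "cmod (lead_coeff v) * lam ^ degree f \<le> cmod (lead_coeff v) * (M / \<delta>)"
    using lam by (simp only: pos_le_divide_eq zero_less_power)
  then show ?thesis using \<open>cmod (lead_coeff v) > 0\<close> by (simp only: mult_le_cancel_left_pos)
qed

context poly_pair
begin

text \<open>
  The postcritical set in the plane coordinate; infinity, a critical value of every generator, is left
  out.
\<close>

definition Pc where "Pc = {z. Fin z \<in> postcritical G}"

lemma wp_append: "wp (u @ v) = wp v \<circ>\<^sub>p wp u"
  by (rule poly_eq_poly_eq_iff[THEN iffD1]) (simp add: fun_eq_iff g_append poly_pcompose)

lemma Pc_closure: "Pc = closure {g w c |w c. w \<noteq> [] \<and> poly (pderiv (wp w)) c = 0}" (is "_ = closure ?C")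
proof -
  have C: "v \<in> ?C \<longleftrightarrow> Fin v \<in> (\<Union>f\<in>G. CV f)" for v
  proof -
    have "Fin v \<in> (\<Union>f\<in>G. CV f) \<longleftrightarrow> (\<exists>w. w \<noteq> [] \<and> Fin v \<in> CV (poly_map (wp w)))"
      unfolding semigroup_words by blast
    also have "\<dots> \<longleftrightarrow> (\<exists>w. w \<noteq> [] \<and> (\<exists>c. poly (pderiv (wp w)) c = 0 \<and> g w c = v))"
      by (simp only: Fin_in_CV[OF degree_wp_pos])
    also have "\<dots> \<longleftrightarrow> (\<exists>w c. v = g w c \<and> w \<noteq> [] \<and> poly (pderiv (wp w)) c = 0)"
      by (rule iffI; elim exE conjE; intro exI conjI; (assumption | erule sym))
    finally show ?thesis unfolding mem_Collect_eq by (rule sym)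
  qed
  define C where "C = ?C"
  define X where "X = (\<Union>f\<in>G. CV f)"
  have CX: "v \<in> C \<longleftrightarrow> Fin v \<in> X" for v unfolding C_def X_def by (rule C)
  have "Pc = closure C"
  proof (intro equalityI subsetI)
    fix z assume z: "z \<in> Pc"
    show "z \<in> closure C"
    proof (rule ccontr)
      assume "z \<notin> closure C"
      then have "open (Fin ` (- closure C))" "Fin z \<in> Fin ` (- closure C)"
        using open_Fin_image[OF open_Compl[OF closed_closure]] by blast+
      moreover have "Fin z \<in> closure X" using z by (simp add: Pc_def postcritical_def X_def)
      ultimately have "Fin ` (- closure C) \<inter> X \<noteq> {}"
        using open_Int_closure_eq_empty[of "Fin ` (- closure C)" X] by blast
      then obtain v where "v \<notin> closure C" "Fin v \<in> X" by blast
      then show False using CX closure_subset by blast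
    qed
  next
    fix z assume "z \<in> closure C"
    moreover have "closed (Fin -` closure X)"
      by (rule closed_vimage) (use continuous_on_Fin in auto)
    moreover have "C \<subseteq> Fin -` closure X" using CX closure_subset by blast
    ultimately show "z \<in> Pc"
      using closure_minimal[of C "Fin -` closure X"] by (auto simp: Pc_def postcritical_def X_def)
  qed
  then show ?thesis by (simp only: C_def)
qed

lemma closed_Pc: "closed Pc" by (simp add: Pc_closure)

lemma critical_value_Pc: "w \<noteq> [] \<Longrightarrow> poly (pderiv (wp w)) c = 0 \<Longrightarrow> g w c \<in> Pc"
  unfolding Pc_closure by (rule subsetD[OF closure_subset], rule CollectI, intro exI conjI, rule refl)

lemma Pc_forward:
  assumes "z \<in> Pc"
  shows "g v z \<in> Pc"
proof -
  let ?C = "{g w c |w c. w \<noteq> [] \<and> poly (pderiv (wp w)) c = 0}"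
  have sub: "?C \<subseteq> g v -` Pc"
  proof
    fix x assume "x \<in> ?C"
    then obtain w c where w: "x = g w c" "w \<noteq> []" "poly (pderiv (wp w)) c = 0" by blast
    have "poly (pderiv (wp (w @ v))) c = 0" using w(3) by (simp add: wp_append pderiv_pcompose)
    then have "g (w @ v) c \<in> Pc" using w(2) by (intro critical_value_Pc) auto
    then show "x \<in> g v -` Pc" using w(1) by (simp add: g_append)
  qed
  have "closed (g v -` Pc)" using closed_Pc by (auto intro!: closed_vimage continuous_intros)
  then have "closure ?C \<subseteq> g v -` Pc" using sub by (rule closure_minimal[rotated])
  then show ?thesis using assms Pc_closure by blast
qed

lemma Pc_nonempty: "Pc \<noteq> {}"
proof -
  have "degree (pderiv (wp [True])) > 0"
    using degree_wp[of "[True]"] deg[of True] by (simp add: degree_pderiv degree_pcompose)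
  then obtain c where "poly (pderiv (wp [True])) c = 0" using poly_surj by blast
  then show ?thesis using critical_value_Pc[of "[True]" c] by blast
qed

text \<open>
  Iterates that omit two values on a disc form a normal family there.
\<close>

lemma backward_orbit_dense:
  assumes y: "y \<in> frontier (K b)" and r: "r > 0" and ac: "a \<noteq> c"
  obtains k v where "v \<in> ball y r" "g (replicate k b) v = a \<or> g (replicate k b) v = c"
proof -
  interpret S: poly_pair "\<lambda>_. q b" R by unfold_locales (use deg R1 esc in auto)
  have Sg: "S.g w z = g (replicate (length w) b) z" for w z
    by (induction w arbitrary: z) (simp_all add: poly_pcompose)
  have "\<not> (\<forall>w. \<forall>z\<in>ball y r. S.g w z \<noteq> a \<and> S.g w z \<noteq> c)"
    using S.Fatou_criterion[OF r ac, of y 0] S.frontier_not_Fatou[of "[]" y] y by auto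
  then show ?thesis using that unfolding Sg by blast
qed

end

locale poly_pair_bounded = poly_pair +
  assumes bounded_Pc: "bounded Pc"
begin

text \<open>
  A postcritical point of modulus at least \<open>R\<close> would have an unbounded orbit inside the postcritical set.
\<close>

lemma Pc_less_R: "z \<in> Pc \<Longrightarrow> cmod z < R"
proof (rule ccontr)
  assume z: "z \<in> Pc" and "\<not> cmod z < R"
  then have zR: "cmod z \<ge> R" by simp
  obtain M where M: "\<And>z. z \<in> Pc \<Longrightarrow> cmod z \<le> M" using bounded_Pc by (auto simp: bounded_iff)
  obtain n where n: "M < 2 ^ n" using real_arch_pow[of 2 M] by auto
  have "2 ^ n * cmod z \<le> cmod (g (replicate n True) z)" using g_escape[OF zR, of "replicate n True"] by simp
  moreover have "2 ^ n * 1 \<le> 2 ^ n * cmod z" using zR R1 by (intro mult_left_mono) auto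
  ultimately show False using M[OF Pc_forward[OF z, of "replicate n True"]] n by linarith
qed

text \<open>
  All finite critical values of words are postcritical, hence of modulus less than \<open>R\<close>.
\<close>

lemma connected_word_sublevel: "connected {z. cmod (g w z) \<le> R}"
proof (rule connected_sublevel[OF degree_wp_pos])
  show "R > 0" using R1 by simp
  fix c assume c: "poly (pderiv (wp w)) c = 0"
  then have "w \<noteq> []" by (intro notI) (simp add: pderiv_pCons)
  then show "cmod (g w c) < R" using critical_value_Pc c Pc_less_R by blast
qed

lemma compact_preimage: "compact (g w -` K b)"
  using compact_poly_vimage[OF degree_wp_pos compact_filled] .

text \<open>
  A decreasing intersection of connected sublevel sets of words.
\<close>

lemma connected_preimage: "connected (g w -` K b)"
proof -
  have eq: "g w -` K b = \<Inter> (range (\<lambda>n. {z. cmod (g (w @ replicate n b) z) \<le> R}))"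
    by (auto simp: filled_iff g_append)
  show ?thesis unfolding eq
  proof (rule connected_nest)
    fix n
    have "{z. cmod (g (w @ replicate n b) z) \<le> R} = g (w @ replicate n b) -` cball 0 R" by auto
    then show "compact {z. cmod (g (w @ replicate n b) z) \<le> R}"
      using compact_poly_vimage[OF degree_wp_pos compact_cball] by simp
    show "connected {z. cmod (g (w @ replicate n b) z) \<le> R}" by (rule connected_word_sublevel)
    show "{z. cmod (g (w @ replicate n b) z) \<le> R} \<subseteq> {z. cmod (g (w @ replicate m b) z) \<le> R}" if "m \<le> n" for m
      using word_escapes_mono[OF _ that, of w b] by (auto simp: not_le[symmetric])
  qed
qed

lemma frontier_preimage: "frontier (g w -` K b) = g w -` frontier (K b)"
  by (rule frontier_poly_vimage[OF degree_wp_pos])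

lemma connected_frontier_preimage: "connected (g w -` frontier (K b))"
  unfolding frontier_preimage[symmetric]
  by (intro connected_frontier_simple connected_preimage connected_Compl_preimage)

lemma Pc_in_filled:
  assumes "z \<in> Pc" shows "z \<in> K b"
  using Pc_less_R[OF Pc_forward[OF assms]] by (auto simp: filled_iff intro: less_imp_le)

lemma frontier_preimage_J: "g w -` frontier (K b) \<subseteq> J"
  using frontier_not_Fatou by (auto simp: J_iff)

lemma frontier_preimage_nonempty: "g w -` frontier (K b) \<noteq> {}"
  using frontier_filled_nonempty[of b] poly_surj[OF degree_wp_pos[of w]] by blast

lemma frontier_preimage_snoc: "g (w @ [b]) -` frontier (K b) = g w -` frontier (K b)"
  by (auto simp: g_append poly_pcompose frontier_filled_vimage)

lemma frontier_preimage_part: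
  assumes "compact A" "compact B" "A \<inter> B = {}" "J = A \<union> B"
  shows "g w -` frontier (K b) \<subseteq> A \<or> g w -` frontier (K b) \<subseteq> B"
proof (rule ccontr)
  let ?F = "g w -` frontier (K b)"
  assume "\<not> (?F \<subseteq> A \<or> ?F \<subseteq> B)"
  moreover have "?F \<subseteq> A \<union> B" using frontier_preimage_J assms(4) by blast
  ultimately have "A \<inter> ?F \<noteq> {}" "B \<inter> ?F \<noteq> {}" by auto
  then show False
    using connected_closedD[OF connected_frontier_preimage[of w b], of A B] assms \<open>?F \<subseteq> A \<union> B\<close>
    by (auto simp: compact_imp_closed)
qed

text \<open>
  If each word put its two frontiers into the same part, then all frontiers would lie in one part,
  because appending the letter \<open>b\<close> to a word does not change the preimage of the frontier of \<open>K b\<close>.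
  But the frontiers of preimages are dense in the Julia set.
\<close>

lemma splitting_word:
  assumes AB: "compact A" "compact B" "A \<inter> B = {}" "J = A \<union> B" "A \<noteq> {}" "B \<noteq> {}"
  obtains w where "g w -` frontier (K True) \<subseteq> A" "g w -` frontier (K False) \<subseteq> B"
  | w where "g w -` frontier (K True) \<subseteq> B" "g w -` frontier (K False) \<subseteq> A"
proof (rule ccontr)
  let ?F = "\<lambda>w b. g w -` frontier (K b)"
  assume neg: "\<not> thesis"
  note part = frontier_preimage_part[OF AB(1-4)]
  have excl: "\<not> (?F w b \<subseteq> A \<and> ?F w b \<subseteq> B)" for w b
    using frontier_preimage_nonempty[of w b] AB(3) by blast
  have same: "?F w True \<subseteq> A \<longleftrightarrow> ?F w False \<subseteq> A" for w
    using neg that part[of w True] part[of w False] by blast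
  obtain P where P: "P \<longleftrightarrow> ?F [] True \<subseteq> A" by blast
  have all: "\<forall>b. ?F w b \<subseteq> A \<longleftrightarrow> P" for w
  proof (induction w rule: rev_induct)
    case Nil
    show ?case using same[of "[]"] P by (simp only: all_bool_eq)
  next
    case (snoc c w)
    have "?F (w @ [c]) c \<subseteq> A \<longleftrightarrow> P" unfolding frontier_preimage_snoc using snoc by blast
    then show ?case using same[of "w @ [c]"] by (cases c) (simp_all only: all_bool_eq)
  qed
  have contra: False if CD: "closed C" "D \<noteq> {}" "C \<inter> D = {}" "D \<subseteq> J" "\<And>w. ?F w True \<subseteq> C" for C D
  proof -
    obtain x where x: "x \<in> D" using CD by blast
    then have "open (- C)" "x \<in> - C" using CD by auto
    then obtain r where r: "r > 0" "ball x r \<subseteq> - C" by (meson openE)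
    have "Fin x \<notin> Fatou G" using x CD(4) by (simp add: J_iff[symmetric] subset_iff)
    then obtain w z where "z \<in> ball x r" "g w z \<in> frontier (K True)"
      using Julia_meets_preimages[OF _ r(1), of x True] by metis
    then show False using r CD(5)[of w] by blast
  qed
  show False
  proof (cases P)
    case True
    then have "?F w True \<subseteq> A" for w using all by blast
    note sub = this
    have "B \<subseteq> J" using AB(4) by blast
    show False by (rule contra[OF compact_imp_closed[OF AB(1)] AB(6,3) \<open>B \<subseteq> J\<close> sub])
  next
    case False
    have sub: "?F w True \<subseteq> B" for w using all[of w] part[of w True] False by blast
    have "B \<inter> A = {}" "A \<subseteq> J" using AB(3,4) by blast+
    then show False using contra[OF compact_imp_closed[OF AB(2)] AB(5) _ _ sub] by simp
  qed
qed

lemma filled_frontiers_disjoint: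
  assumes "\<not> connected J"
  shows "frontier (K True) \<inter> frontier (K False) = {}"
proof (rule ccontr)
  assume "frontier (K True) \<inter> frontier (K False) \<noteq> {}"
  then obtain x where x: "x \<in> frontier (K True)" "x \<in> frontier (K False)" by blast
  obtain A B where AB: "compact A" "compact B" "A \<noteq> {}" "B \<noteq> {}" "A \<inter> B = {}" "J = A \<union> B"
    using connected_closed_disconnect[OF compact_J assms] by metis
  have no: False if "g w -` frontier (K True) \<subseteq> C" "g w -` frontier (K False) \<subseteq> D" "C \<inter> D = {}" for w C D
  proof -
    obtain z where "g w z = x" using poly_surj[OF degree_wp_pos[of w], of x] by blast
    then have "z \<in> C" "z \<in> D" using x that(1,2) by auto
    then show False using that(3) by blast
  qed
  have BA: "B \<inter> A = {}" using AB(5) by blast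
  show False
    by (rule splitting_word[OF AB(1,2,5,6,3,4)]) (erule no, assumption, rule AB(5), erule no, assumption, rule BA)
qed

text \<open>
  If \<open>K b\<close> had empty interior, its frontier \<open>F\<close> would be all of \<open>K b\<close> and would contain the orbits of
  postcritical points. A point that a power of the other generator maps to a postcritical point would
  lie in two consecutive preimages of \<open>F\<close>; so these preimages would lie in one part of the Julia set.
  They accumulate at the frontier of the other filled
  set, so no word could separate the two frontiers.
\<close>

lemma filled_interior_nonempty:
  assumes "\<not> connected J"
  shows "interior (K b) \<noteq> {}"
proof
  assume emp: "interior (K b) = {}"
  have fr: "frontier (K b) = K b" using emp closed_filled by (simp add: frontier_def)
  obtain A B where AB: "compact A" "compact B" "A \<noteq> {}" "B \<noteq> {}" "A \<inter> B = {}" "J = A \<union> B"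
    using connected_closed_disconnect[OF compact_J assms] by metis
  obtain a0 where a0: "a0 \<in> Pc" using Pc_nonempty by blast
  have contra: False if CD: "compact C" "compact D" "C \<inter> D = {}" "J = C \<union> D"
    and w: "g w -` frontier (K b) \<subseteq> C" "g w -` frontier (K (\<not> b)) \<subseteq> D" for C D w
  proof -
    have chain: "g (w @ replicate k (\<not> b)) -` frontier (K b) \<subseteq> C" for k
    proof (induction k)
      case (Suc k)
      obtain z where z: "g (w @ replicate k (\<not> b)) z = a0" using poly_surj[OF degree_wp_pos] by blast
      have "w @ replicate (Suc k) (\<not> b) = (w @ replicate k (\<not> b)) @ [\<not> b]" by (simp add: replicate_append_same)
      then have "g (w @ replicate (Suc k) (\<not> b)) z = g [\<not> b] a0" using z g_append by metis
      then have "z \<in> g (w @ replicate (Suc k) (\<not> b)) -` frontier (K b)"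
        using Pc_in_filled[OF Pc_forward[OF a0, of "[\<not> b]"], of b] by (simp only: vimage_eq fr)
      moreover have "z \<in> C" using Suc z fr Pc_in_filled[OF a0] by auto
      ultimately show ?case
        using frontier_preimage_part[OF CD, of "w @ replicate (Suc k) (\<not> b)" b] CD(3) by blast
    qed (use w in simp)
    obtain x where x: "g w x \<in> frontier (K (\<not> b))" using frontier_preimage_nonempty[of w "\<not> b"] by blast
    then have "open (- C)" "x \<in> - C" using w CD by (auto simp: compact_imp_closed)
    then have "open (g w ` (- C))" "g w x \<in> g w ` (- C)" using open_poly_image[OF degree_wp_pos] by auto
    then obtain r where r: "r > 0" "ball (g w x) r \<subseteq> g w ` (- C)" by (meson openE)
    obtain a c where ac: "a \<in> K b" "c \<in> K b" "a \<noteq> c" using filled_two_points[OF deg] by metis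
    obtain k v where v: "v \<in> ball (g w x) r" "g (replicate k (\<not> b)) v = a \<or> g (replicate k (\<not> b)) v = c"
      using backward_orbit_dense[OF x r(1) ac(3)] by metis
    obtain z where z: "z \<notin> C" "v = g w z" using v(1) r(2) by auto
    have "g (w @ replicate k (\<not> b)) z \<in> frontier (K b)" using v(2) z ac fr by (auto simp: g_append)
    then show False using chain[of k] z by blast
  qed
  show False
    by (rule splitting_word[OF AB(1,2,5,6,3,4)]; cases b)
       (use contra[of A B] contra[of B A] AB in \<open>auto simp: Int_commute Un_commute\<close>)
qed

end

section \<open>Disconnected Julia sets come from ordered pairs\<close>

lemma pcompose_X [simp]: "[:0, 1:] \<circ>\<^sub>p f = (f :: complex poly)"
  by (simp add: pcompose_pCons)

context poly_pair_bounded
begin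

lemma preimage_le_R: "g w z \<in> K b \<Longrightarrow> cmod z \<le> R"
  using g_escape_strict[of z "w @ [b]"] filled_vimage[of "q b" "g w z"] filled_le_R[of "g (w @ [b]) z" b]
  by (force simp: g_append poly_pcompose)

lemma not_filled_subset_interior: "\<not> K b \<subseteq> interior (K b)"
proof
  assume "K b \<subseteq> interior (K b)"
  then have "frontier (K b) = {}" using closed_filled by (auto simp: frontier_def)
  then show False using frontier_filled_nonempty by blast
qed

text \<open>
  If \<open>h\<^sub>1\<close> mapped the frontier of \<open>K\<^sub>2\<close> into \<open>K\<^sub>2\<close>, it would map \<open>K\<^sub>2\<close> into itself; then \<open>K\<^sub>2\<close>
  would be contained in \<open>K\<^sub>1\<close>.
\<close>

lemma outer_frontier_escapes_inner_preimage:
  assumes "K True \<subseteq> interior (K False)"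
  obtains x where "x \<in> frontier (K False)" "poly (q True) x \<notin> K False"
proof -
  have "\<not> frontier (K False) \<subseteq> g [True] -` K False"
  proof
    assume "frontier (K False) \<subseteq> g [True] -` K False"
    then have sub: "K False \<subseteq> g [True] -` K False"
      by (rule subset_of_frontier_subset[OF compact_filled compact_preimage connected_Compl_preimage])
    have stay: "g (replicate n True) z \<in> K False" if "z \<in> K False" for n z
      using that
    proof (induction n arbitrary: z)
      case (Suc n)
      then have "poly (q True) z \<in> K False" using sub by (auto simp: poly_pcompose)
      then show ?case using Suc by (simp add: poly_pcompose)
    qed simp
    have "K False \<subseteq> K True"
    proof
      fix z assume "z \<in> K False"
      from filled_le_R[OF stay[OF this]] show "z \<in> K True" unfolding filled_iff[of z True] by blast
    qed
    then show False using assms not_filled_subset_interior[of False] by blast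
  qed
  then obtain x where "x \<in> frontier (K False)" "x \<notin> g [True] -` K False" by blast
  then show ?thesis using that[of x] by simp
qed

text \<open>
  Fix a separation and a word whose two frontiers lie in different parts, and let \<open>Z\<close> be the component
  that contains the outer frontier of the complement of the part that contains the inner one. Frontiers of preimages lie
  inside \<open>Z\<close> or outside it, and call a word split (\<open>Sp\<close>) if its inner frontier lies outside and its
  outer frontier inside. If the claim fails, one of the two one-letter extensions of a split word is
  split again. So there are arbitrarily long split words, and they contradict the dilation estimate.
\<close>

lemma disconnected_nested_imp_inner_preimage:
  assumes disc: "\<not> connected J" and nest: "K True \<subseteq> interior (K False)"
  shows "g [True] -` K False \<subseteq> g [False] -` K True"
proof (rule ccontr)
  assume neg: "\<not> g [True] -` K False \<subseteq> g [False] -` K True"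
  let ?F = "\<lambda>w b. g w -` frontier (K b)"
  let ?E1 = "g [True] -` K False" and ?E2 = "g [False] -` K True"
  have fE1: "frontier ?E1 = ?F [True] False" and fE2: "frontier ?E2 = ?F [False] True"
    by (rule frontier_preimage)+
  obtain A0 B0 where AB0: "compact A0" "compact B0" "A0 \<noteq> {}" "B0 \<noteq> {}" "A0 \<inter> B0 = {}" "J = A0 \<union> B0"
    using connected_closed_disconnect[OF compact_J disc] by metis
  obtain A B w0 where AB: "compact A" "compact B" "A \<inter> B = {}" "J = A \<union> B"
    and w0: "?F w0 True \<subseteq> A" "?F w0 False \<subseteq> B"
    using splitting_word[OF AB0(1,2,5,6,3,4)] AB0 by (metis Int_commute Un_commute)
  \<comment> \<open>Either the frontiers of the two preimages meet or they are nested the wrong way.\<close>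
  have dich: "?F [True] False \<inter> ?F [False] True \<noteq> {} \<or> ?E2 \<subseteq> ?E1"
  proof (rule ccontr)
    assume n: "\<not> (?F [True] False \<inter> ?F [False] True \<noteq> {} \<or> ?E2 \<subseteq> ?E1)"
    obtain a0 where a0: "a0 \<in> Pc" using Pc_nonempty by blast
    have "a0 \<in> ?E1 \<inter> ?E2" using Pc_in_filled[OF Pc_forward[OF a0]] by (simp del: word_poly.simps)
    then have "?E1 \<inter> ?E2 \<noteq> {}" by blast
    moreover have "connected (frontier ?E1)" unfolding fE1 by (rule connected_frontier_preimage)
    moreover have "frontier ?E1 \<inter> frontier ?E2 = {}" unfolding fE1 fE2 using n by blast
    ultimately have "?E1 \<subseteq> interior ?E2 \<or> ?E2 \<subseteq> interior ?E1"
      by (intro nested_continua compact_preimage connected_preimage connected_Compl_preimage)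
    then show False using n neg interior_subset by blast
  qed
  obtain x0 where x0: "x0 \<in> ?F w0 False" using frontier_preimage_nonempty by blast
  define Z where "Z = connected_component_set (- A) x0"
  have Zcon: "connected Z" by (simp add: Z_def)
  have ZA: "Z \<subseteq> - A" unfolding Z_def by (rule connected_component_subset)
  have max: "X \<subseteq> Z" if "connected X" "X \<subseteq> - A" "X \<inter> Z \<noteq> {}" for X
  proof -
    obtain y where y: "y \<in> X" "y \<in> Z" using \<open>X \<inter> Z \<noteq> {}\<close> by blast
    then have "X \<subseteq> connected_component_set (- A) y" using that by (intro connected_component_maximal) auto
    also have "connected_component_set (- A) y = Z" using y(2) connected_component_eq unfolding Z_def by metis
    finally show ?thesis .
  qed
  have dicho: "?F w b \<subseteq> Z \<or> ?F w b \<inter> Z = {}" for w b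
    using frontier_preimage_part[OF AB, of w b] max[OF connected_frontier_preimage, of w b] ZA AB(3) by blast
  define Sp where "Sp w \<longleftrightarrow> ?F w True \<inter> Z = {} \<and> ?F w False \<subseteq> Z" for w
  have Sp0: "Sp w0"
  proof -
    have "x0 \<in> Z" using x0 w0(2) AB(3) by (auto simp: Z_def)
    then have "?F w0 False \<subseteq> Z" using dicho[of w0 False] x0 by blast
    then show ?thesis using w0(1) ZA by (auto simp: Sp_def)
  qed
  have step: "Sp (w @ [True]) \<or> Sp (w @ [False])" if Sp: "Sp w" for w
  proof (cases "?F (w @ [True]) False \<subseteq> Z")
    case True
    then show ?thesis using Sp frontier_preimage_snoc[of w True] by (simp add: Sp_def)
  next
    case False
    then have low1: "?F (w @ [True]) False \<inter> Z = {}" using dicho by blast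
    have "?F (w @ [False]) True \<inter> Z = {}"
    proof (cases "?F [True] False \<inter> ?F [False] True = {}")
      case False
      then obtain x where x: "x \<in> ?F [True] False" "x \<in> ?F [False] True" by blast
      obtain y where y: "g w y = x" using poly_surj[OF degree_wp_pos] by blast
      have "y \<in> ?F (w @ [True]) False" "y \<in> ?F (w @ [False]) True" using x y by (simp_all only: vimage_eq g_append)
      then show ?thesis using low1 dicho[of "w @ [False]" True] by blast
    next
      case True
      then have E: "?E2 \<subseteq> ?E1" using dich by blast
      let ?Y = "g (w @ [True]) -` K False"
      obtain x where x: "x \<in> frontier (K False)" "poly (q True) x \<notin> K False"
        using outer_frontier_escapes_inner_preimage[OF nest] by metis
      obtain y where y: "g w y = x" using poly_surj[OF degree_wp_pos] by blast
      have "y \<in> ?F w False" using x y by simp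
      then have "y \<in> Z" using Sp by (auto simp: Sp_def)
      moreover have "y \<notin> ?Y" using x y by (simp add: g_append poly_pcompose)
      moreover have "Z \<inter> frontier ?Y = {}" using low1 unfolding frontier_preimage by blast
      ultimately have "Z \<inter> ?Y = {}" using connected_Int_frontier[OF Zcon, of ?Y] by blast
      moreover have "?F (w @ [False]) True \<subseteq> ?Y"
      proof
        fix z assume "z \<in> ?F (w @ [False]) True"
        then have "g w z \<in> ?E2" using closed_filled by (auto simp: g_append frontier_def)
        then show "z \<in> ?Y" using E by (auto simp: g_append)
      qed
      ultimately show ?thesis by blast
    qed
    then show ?thesis using Sp frontier_preimage_snoc[of w False] by (simp add: Sp_def)
  qed
  have long: "\<exists>w. length w \<ge> n \<and> Sp w" for n
  proof (induction n)
    case (Suc n)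
    then obtain w where "length w \<ge> n" "Sp w" by blast
    then show ?case using step[of w] by (metis Suc_le_mono length_append_singleton)
  qed (use Sp0 in blast)
  obtain \<rho> where \<rho>: "\<rho> > 0" "\<And>x y. x \<in> B \<Longrightarrow> y \<in> A \<Longrightarrow> \<rho> \<le> dist x y"
    using separate_compact_closed[of B A] AB by (metis Int_commute compact_imp_closed)
  \<comment> \<open>Points of the Julia set inside and outside the component stay a definite distance apart.\<close>
  have apart: "\<rho> \<le> dist x y" if x: "x \<in> J" "x \<in> Z" and y: "y \<in> J" "y \<notin> Z" for x y
  proof (cases "y \<in> A")
    case True
    then show ?thesis using \<rho>(2) x AB(4) ZA by blast
  next
    case False
    show ?thesis
    proof (rule ccontr)
      assume lt: "\<not> \<rho> \<le> dist x y"
      have xB: "x \<in> B" using x AB(4) ZA by blast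
      have "closed_segment x y \<subseteq> - A"
      proof
        fix t assume "t \<in> closed_segment x y"
        then have "dist x t \<le> dist x y" using dist_in_closed_segment[of t x y] by (simp add: dist_commute)
        then show "t \<in> - A" using \<rho>(2)[OF xB] lt by force
      qed
      then have "closed_segment x y \<subseteq> Z" using x by (intro max) auto
      then show False using y by auto
    qed
  qed
  obtain a \<delta> where a: "a \<in> K True" "\<delta> > 0" "ball a \<delta> \<subseteq> K True"
  proof -
    obtain a where "a \<in> interior (K True)" using filled_interior_nonempty[OF disc] by blast
    then show ?thesis using that mem_interior interior_subset by (metis subsetD)
  qed
  \<comment> \<open>Dilation by \<open>lam\<close> moves points of modulus at most \<open>R\<close> by less than \<open>\<rho>\<close>.\<close>
  define lam where "lam = 1 + \<rho> / (2 * R)"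
  have lam: "lam > 1" using \<rho> R1 by (simp add: lam_def)
  have bound: "lam ^ n \<le> 2 * R / \<delta>" for n
  proof -
    obtain w where w: "length w \<ge> n" "Sp w" using long by blast
    let ?X = "g w -` K True" and ?Y = "g w -` K False"
    have XY: "?X \<subseteq> interior ?Y"
      using nest interior_poly_vimage[OF degree_wp_pos, of w "K False"] by auto
    have near: "z' \<in> interior ?Y" if z: "z \<in> ?X" and d: "dist z z' < \<rho>" for z z'
    proof (rule ccontr)
      assume z': "z' \<notin> interior ?Y"
      have "closed_segment z z' \<inter> frontier ?Y \<noteq> {}"
      proof (cases "z' \<in> ?Y")
        case True
        then have "z' \<in> frontier ?Y" using z' subsetD[OF closure_subset True] by (simp add: frontier_def)
        then show ?thesis by auto
      next
        case False
        have "z \<in> ?Y" using z XY interior_subset by blast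
        then show ?thesis using False by (intro connected_Int_frontier) auto
      qed
      then obtain y where y: "y \<in> closed_segment z z'" "y \<in> frontier ?Y" by blast
      have yX: "y \<notin> ?X" using y XY by (auto simp: frontier_def)
      have "closed_segment z y \<inter> frontier ?X \<noteq> {}" using z yX by (intro connected_Int_frontier) auto
      then obtain x where x: "x \<in> closed_segment z y" "x \<in> frontier ?X" by blast
      have "dist x y \<le> dist z y" using dist_in_closed_segment[OF x(1)] by simp
      also have "\<dots> \<le> dist z z'" using dist_in_closed_segment[OF y(1)] by (simp add: dist_commute)
      finally have "dist x y < \<rho>" using d by simp
      moreover have "x \<in> J" "x \<notin> Z" "y \<in> J" "y \<in> Z"
        using x(2) y(2) w(2) frontier_preimage_J unfolding frontier_preimage Sp_def by blast+
      ultimately show False using apart[of y x] by (simp add: dist_commute)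
    qed
    have far: "cmod (g w (z / of_real lam) - a) \<ge> \<delta>" if z: "z \<notin> interior ?Y" for z
    proof (rule ccontr)
      let ?z = "z / of_real lam"
      assume "\<not> cmod (g w ?z - a) \<ge> \<delta>"
      then have X: "?z \<in> ?X" using a(3) by (auto simp: dist_norm norm_minus_commute subset_iff)
      have "z - ?z = of_real (lam - 1) * ?z" using lam by (simp add: field_simps)
      then have "dist ?z z = (lam - 1) * cmod ?z"
        using lam by (metis abs_of_pos diff_gt_0_iff_gt dist_commute dist_norm norm_mult norm_of_real)
      also have "\<dots> \<le> (lam - 1) * R" using preimage_le_R[of w ?z True] X lam by (intro mult_left_mono) auto
      also have "\<dots> < \<rho>" using \<rho> R1 by (simp add: lam_def)
      finally show False using near[OF X] z by blast
    qed
    have "lam ^ degree (wp w) \<le> 2 * R / \<delta>"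
    proof (rule max_principle_dilation[OF degree_wp_pos compact_preimage _ _ a(2) _ far])
      show "interior (g w -` K False) \<noteq> {}" using XY poly_surj[OF degree_wp_pos, of w a] a(1) by auto
      fix z assume "z \<in> frontier ?Y"
      then have "g w z \<in> K False" using closed_filled unfolding frontier_preimage by (auto simp: frontier_def)
      then have "cmod (g w z) \<le> R" "cmod a \<le> R" using filled_le_R a(1) by blast+
      then show "cmod (g w z - a) \<le> 2 * R" using norm_triangle_ineq4[of "g w z" a] by linarith
    qed (use lam R1 in auto)
    moreover have "n \<le> degree (wp w)"
      using w(1) degree_wp[of w] by (meson less_exp less_imp_le order_trans)
    then have "lam ^ n \<le> lam ^ degree (wp w)" using lam by (intro power_increasing) auto
    ultimately show ?thesis by linarith
  qed
  obtain n where "2 * R / \<delta> < lam ^ n" using real_arch_pow[OF lam] by blast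
  then show False using bound[of n] by linarith
qed

lemma disconnected_nested_imp_ordered:
  assumes "\<not> connected J" "K True \<subseteq> interior (K False)"
  shows ordered
proof -
  have "K True \<subseteq> K False" using assms(2) interior_subset by blast
  then show ?thesis
    using disconnected_nested_imp_inner_preimage[OF assms] by (auto simp: ordered_def poly_pcompose)
qed

end

text \<open>
  The filled sets have disjoint frontiers and a common postcritical point, so they are nested.
\<close>

theorem (in poly_pair_bounded) disconnected_imp_ordered:
  assumes disc: "\<not> connected J"
  shows "ordered \<or> poly_pair.ordered (\<lambda>b. q (\<not> b))"
proof -
  interpret S: poly_pair "\<lambda>b. q (\<not> b)" R by unfold_locales (use deg R1 esc in auto)
  have SG: "S.G = G" by (simp add: insert_commute)
  have SJ: "S.J = J" unfolding S.J_def J_def SG ..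
  interpret S: poly_pair_bounded "\<lambda>b. q (\<not> b)" R
  proof unfold_locales
    show "bounded S.Pc" using bounded_Pc unfolding S.Pc_def Pc_def SG .
  qed
  obtain a0 where a0: "a0 \<in> Pc" using Pc_nonempty by blast
  have "K True \<inter> K False \<noteq> {}" using Pc_in_filled[OF a0] by blast
  then have "K True \<subseteq> interior (K False) \<or> K False \<subseteq> interior (K True)"
    using connected_frontier_preimage[of "[]" True] connected_preimage[of "[]" False]
      filled_frontiers_disjoint[OF disc]
    by (intro nested_continua compact_filled connected_Compl_filled) (simp_all add: vimage_def)
  then show ?thesis
    using disconnected_nested_imp_ordered[OF disc] S.disconnected_nested_imp_ordered disc SJ by auto
qed

section \<open>Contraction near the postcritical set of a hyperbolic semigroup\<close>

locale poly_pair_hyperbolic = poly_pair_bounded +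
  assumes hyperbolic_G: "postcritical G \<subseteq> Fatou G"
begin

lemma compact_Pc: "compact Pc" using closed_Pc bounded_Pc by (simp add: compact_eq_bounded_closed)

text \<open>
  Orbits of postcritical points are bounded, so spherical equicontinuity gives Euclidean
  equicontinuity.
\<close>

lemma Pc_equicontinuous:
  assumes x: "x \<in> Pc" and e: "e > 0"
  shows "\<exists>d>0. \<forall>w y. cmod (y - x) < d \<longrightarrow> cmod (g w y - g w x) < e"
proof -
  have F: "Fin x \<in> Fatou G" using x hyperbolic_G by (auto simp: Pc_def)
  obtain \<delta> where \<delta>: "\<delta> > 0" "\<And>z v. cmod z \<le> R \<Longrightarrow> dist (Fin z) (Fin v) < \<delta> \<Longrightarrow> cmod (z - v) < e"
    using dist_Fin_small_imp_close[OF e, of R] R1 by auto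
  obtain d where d: "d > 0" "\<And>w y. w \<noteq> [] \<Longrightarrow> cmod (y - x) < d \<Longrightarrow> dist (Fin (g w y)) (Fin (g w x)) < \<delta>"
    using Fatou_equicontinuous[OF F \<delta>(1)] by metis
  have "cmod (g w y - g w x) < e" if y: "cmod (y - x) < min d e" for w y
  proof (cases "w = []")
    case False
    have "cmod (g w x) \<le> R" using Pc_less_R[OF Pc_forward[OF x]] by (rule less_imp_le)
    then have "cmod (g w x - g w y) < e" using d(2)[OF False, of y] \<delta>(2) y by (simp add: dist_commute)
    then show ?thesis by (simp add: norm_minus_commute)
  qed (use y in simp)
  then show ?thesis using d(1) e by (metis min_less_iff_conj)
qed

lemma Pc_uniformly_equicontinuous:
  assumes e: "e > 0"
  obtains d where "d > 0" "\<And>x w y. x \<in> Pc \<Longrightarrow> cmod (y - x) < d \<Longrightarrow> cmod (g w y - g w x) < e"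
proof -
  have "\<forall>x\<in>Pc. \<exists>d>0. \<forall>w y. cmod (y - x) < d \<longrightarrow> cmod (g w y - g w x) < e / 2"
    using Pc_equicontinuous e half_gt_zero by blast
  then obtain D where D: "\<And>x. x \<in> Pc \<Longrightarrow> D x > 0"
    "\<And>x w y. x \<in> Pc \<Longrightarrow> cmod (y - x) < D x \<Longrightarrow> cmod (g w y - g w x) < e / 2" by metis
  have cover: "Pc \<subseteq> (\<Union>x\<in>Pc. ball x (D x / 2))" using D(1) by force
  obtain C where C: "C \<subseteq> Pc" "finite C" "Pc \<subseteq> (\<Union>x\<in>C. ball x (D x / 2))"
    using compactE_image[OF compact_Pc _ cover] by blast
  have Cne: "C \<noteq> {}" using C(3) Pc_nonempty by auto
  define d where "d = Min ((\<lambda>x. D x / 2) ` C)"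
  have d: "\<And>c. c \<in> C \<Longrightarrow> d \<le> D c / 2" unfolding d_def by (rule Min_le) (use C(2) in auto)
  have "d > 0" using C(1,2) Cne D(1) by (auto simp: d_def)
  note d = this d
  show ?thesis
  proof (rule that[OF d(1)])
    fix x w y assume x: "x \<in> Pc" and y: "cmod (y - x) < d"
    obtain c where c: "c \<in> C" "x \<in> ball c (D c / 2)" using C(3) x by blast
    have cP: "c \<in> Pc" using c C by blast
    have xc: "cmod (x - c) < D c / 2" using c(2) by (simp add: dist_norm norm_minus_commute)
    have "cmod (y - c) \<le> cmod (y - x) + cmod (x - c)" using norm_triangle_ineq[of "y - x" "x - c"] by simp
    then have yc: "cmod (y - c) < D c" using y d(2)[OF c(1)] xc by linarith
    have "cmod (x - c) < D c" using xc D(1)[OF cP] by linarith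
    then have "cmod (g w y - g w c) < e / 2" "cmod (g w x - g w c) < e / 2" using D(2)[OF cP] yc by blast+
    then show "cmod (g w y - g w x) < e"
      using norm_triangle_ineq4[of "g w y - g w c" "g w x - g w c"] by simp
  qed
qed

lemma preimage_norm_le:
  assumes "cmod (g w z) \<le> M" "R \<le> M" shows "cmod z \<le> M"
proof (rule ccontr)
  assume z: "\<not> cmod z \<le> M"
  then have "cmod z \<ge> R" using assms by simp
  then have "cmod (g w z) \<ge> 2 ^ length w * cmod z" by (rule g_escape)
  moreover have "2 ^ length w * cmod z \<ge> 1 * cmod z" by (intro mult_right_mono) auto
  ultimately show False using z assms by simp
qed

lemma no_critical_values_off_Pc:
  assumes "ball x r \<inter> Pc = {}" "poly (pderiv (wp w)) c = 0"
  shows "g w c \<notin> ball x r"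
proof -
  have "w \<noteq> []" using assms(2) by (intro notI) (simp add: pderiv_pCons)
  then show ?thesis using critical_value_Pc[OF _ assms(2)] assms(1) by blast
qed

lemma branch_inverts_nearby:
  assumes ball: "ball x r \<inter> Pc = {}"
    and v: "v holomorphic_on ball x r" "\<forall>\<zeta>\<in>ball x r. g w (v \<zeta>) = \<zeta>" "v (g w y) = y"
    and s: "s > 0" "g w ` ball y s \<subseteq> ball x r" and z: "z \<in> ball y s"
  shows "v (g w z) = z"
proof -
  have gy: "g w y \<in> ball x r" by (rule subsetD[OF s(2)], rule imageI) (use s(1) in simp)
  have "poly (pderiv (wp w)) y \<noteq> 0" using no_critical_values_off_Pc[OF ball, of w y] gy by blast
  then obtain t where t: "t > 0" "ball y t \<subseteq> ball y s" "inj_on (g w) (ball y t)"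
    using has_complex_derivative_locally_invertible[of "g w" "ball y s" y] g_holomorphic s(1)
    by (metis centre_in_ball deriv_poly open_ball)
  have comp: "(\<lambda>z. v (g w z)) holomorphic_on ball y s"
    using holomorphic_on_compose_gen[OF g_holomorphic v(1), of w "ball y s"] s(2) by (simp add: o_def image_subset_iff_funcset)
  have "continuous_on (ball y s) (\<lambda>z. v (g w z))" by (rule holomorphic_on_imp_continuous_on[OF comp])
  then have op: "open (ball y t \<inter> (\<lambda>z. v (g w z)) -` ball y t)"
    using t(2) by (intro continuous_open_preimage) (auto intro: continuous_on_subset)
  have yin: "y \<in> ball y t \<inter> (\<lambda>z. v (g w z)) -` ball y t" using t(1) v(3) by simp
  show ?thesis
  proof (rule analytic_continuation_open[OF op open_ball _ connected_ball _ comp _ _ z])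
    show "ball y t \<inter> (\<lambda>z. v (g w z)) -` ball y t \<noteq> {}" using yin by blast
    show "ball y t \<inter> (\<lambda>z. v (g w z)) -` ball y t \<subseteq> ball y s" using t(2) by blast
    fix u assume u: "u \<in> ball y t \<inter> (\<lambda>z. v (g w z)) -` ball y t"
    then have "g w u \<in> ball x r" using t(2) s(2) by blast
    then have "g w (v (g w u)) = g w u" using v(2) by blast
    then show "v (g w u) = u" using t(3) u by (auto dest: inj_onD)
  qed (intro holomorphic_intros)
qed

text \<open>
  On the disc around \<open>x\<close> all words have inverse branches, which are uniformly bounded. Those that
  invert the words near \<open>y\<close> converge to the identity near \<open>y\<close>, hence on the disc by Vitali's theorem;
  then the words themselves do so on a smaller disc.
\<close>

lemma identity_limit_extends_off_Pc:
  assumes r: "r > 0" and ball: "ball x r \<inter> Pc = {}"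
    and y: "y \<in> ball x r" and s: "s > 0" and lim: "uniform_limit (ball y s) (\<lambda>k. g (u k)) (\<lambda>z. z) sequentially"
  shows "uniform_limit (ball x (r/4)) (\<lambda>k. g (u k)) (\<lambda>z. z) sequentially"
proof -
  \<comment> \<open>Four times \<open>s'\<close> fits into both discs, so that three moves of size \<open>s'\<close> stay inside.\<close>
  define s' where "s' = min s (r - dist x y) / 4"
  have s': "s' > 0" "4 * s' \<le> s" "4 * s' \<le> r - dist x y" using s y by (auto simp: s'_def)
  have inx: "z \<in> ball x r" if "dist y z < 4 * s'" for z
    using that s'(3) dist_triangle[of x z y] by simp
  have iny: "z \<in> ball y s" if "dist y z < 4 * s'" for z using that s'(2) by simp
  have ev: "\<exists>N. \<forall>k\<ge>N. \<forall>z\<in>ball y s. cmod (g (u k) z - z) < e" if "e > 0" for e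
    using lim that by (auto simp: uniform_limit_sequentially_iff dist_norm)
  obtain N where N: "\<And>k z. k \<ge> N \<Longrightarrow> z \<in> ball y s \<Longrightarrow> cmod (g (u k) z - z) < s'" using ev[OF s'(1)] by blast
  have im: "g (u k) ` ball y (3 * s') \<subseteq> ball x r" if k: "k \<ge> N" for k
  proof
    fix \<zeta> assume "\<zeta> \<in> g (u k) ` ball y (3 * s')"
    then obtain z where z: "\<zeta> = g (u k) z" "dist y z < 3 * s'" by auto
    have "dist z \<zeta> < s'" using N[OF k iny, of z] z s' by (simp add: dist_norm norm_minus_commute)
    then show "\<zeta> \<in> ball x r" using inx[of \<zeta>] z dist_triangle[of y \<zeta> z] by linarith
  qed
  have "\<exists>v. v holomorphic_on ball x r \<and> (\<forall>\<zeta>\<in>ball x r. g (u k) (v \<zeta>) = \<zeta>) \<and> v (g (u k) y) = y" if k: "k \<ge> N" for k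
  proof -
    have "g (u k) y \<in> ball x r" by (rule subsetD[OF im[OF k]], rule imageI) (use s'(1) in simp)
    then show ?thesis
      using poly_inverse_branch[OF degree_wp_pos no_critical_values_off_Pc[OF ball], of "u k" y] by metis
  qed
  then obtain v where v: "\<And>k. k \<ge> N \<Longrightarrow> v k holomorphic_on ball x r"
    "\<And>k. k \<ge> N \<Longrightarrow> \<forall>\<zeta>\<in>ball x r. g (u k) (v k \<zeta>) = \<zeta>" "\<And>k. k \<ge> N \<Longrightarrow> v k (g (u k) y) = y" by metis
  define M where "M = max R (cmod x + r)"
  have vM: "cmod (v k \<zeta>) \<le> M" if "k \<ge> N" "\<zeta> \<in> ball x r" for k \<zeta>
  proof (rule preimage_norm_le)
    have "cmod \<zeta> \<le> cmod x + r" using that(2) norm_triangle_ineq2[of \<zeta> x] by (simp add: dist_norm norm_minus_commute)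
    then show "cmod (g (u k) (v k \<zeta>)) \<le> M" using v(2)[OF that(1)] that(2) by (simp add: M_def)
  qed (simp add: M_def)
  \<comment> \<open>Near \<open>y\<close> the branches invert maps close to the identity, so they are close to it too.\<close>
  have vnear: "cmod (v k \<zeta> - \<zeta>) \<le> \<eta>"
    if k: "k \<ge> N" and \<eta>: "0 < \<eta>" "\<eta> \<le> s'" "\<And>z. z \<in> ball y s \<Longrightarrow> cmod (g (u k) z - z) < \<eta>" and \<zeta>: "\<zeta> \<in> ball y s'" for k \<eta> \<zeta>
  proof -
    have sub: "cball \<zeta> \<eta> \<subseteq> cball y (2 * s')"
    proof
      fix t assume "t \<in> cball \<zeta> \<eta>"
      then show "t \<in> cball y (2 * s')" using \<zeta> \<eta>(2) dist_triangle[of y t \<zeta>] by simp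
    qed
    obtain t where t: "t \<in> cball \<zeta> \<eta>" "g (u k) t = \<zeta>"
    proof (rule near_identity_covers[OF _ _ sub \<eta>(1), of "g (u k)"])
      show "continuous_on (cball y (2 * s')) (g (u k))" by (intro continuous_intros)
      show "cmod (g (u k) t - t) \<le> \<eta>" if "t \<in> cball y (2 * s')" for t
        using \<eta>(3)[OF iny, of t] that s'(1) by simp
    qed
    have "t \<in> ball y (3 * s')" using t(1) sub s'(1) by auto
    then have "v k (g (u k) t) = t"
      using branch_inverts_nearby[OF ball v(1)[OF k] v(2)[OF k] v(3)[OF k] _ im[OF k]] s'(1) by simp
    then show ?thesis using t by (simp add: dist_norm norm_minus_commute)
  qed
  have vlim: "uniform_limit (cball x (r/2)) (\<lambda>k. v (N + k)) (\<lambda>z. z) sequentially"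
  proof (rule vitali_convergence[of "ball x r" _ M "\<lambda>z. z" "ball y s'"])
    show "v (N + k) holomorphic_on ball x r" for k using v(1) by simp
    show "cmod (v (N + k) z) \<le> M" if "z \<in> ball x r" for k z using vM that by simp
    show "(\<lambda>z. z) holomorphic_on ball x r" by (intro holomorphic_intros)
    show "ball y s' \<subseteq> ball x r"
    proof
      fix z assume "z \<in> ball y s'"
      then show "z \<in> ball x r" using s'(1) by (intro inx) simp
    qed
    show "ball y s' \<noteq> {}" using s' by simp
    show "cball x (r/2) \<subseteq> ball x r" using r by auto
    show "(\<lambda>k. v (N + k) \<zeta>) \<longlonglongrightarrow> \<zeta>" if \<zeta>: "\<zeta> \<in> ball y s'" for \<zeta>
      unfolding lim_sequentially
    proof (intro allI impI)
      fix e :: real assume e: "e > 0"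
      define \<eta> where "\<eta> = min s' (e/2)"
      have \<eta>: "\<eta> > 0" "\<eta> \<le> s'" "\<eta> < e" using s' e by (auto simp: \<eta>_def)
      obtain N' where N': "\<And>k z. k \<ge> N' \<Longrightarrow> z \<in> ball y s \<Longrightarrow> cmod (g (u k) z - z) < \<eta>" using ev[OF \<eta>(1)] by blast
      show "\<exists>no. \<forall>k\<ge>no. dist (v (N + k) \<zeta>) \<zeta> < e"
      proof (intro exI allI impI)
        fix k assume "k \<ge> N'"
        then have "cmod (v (N + k) \<zeta> - \<zeta>) \<le> \<eta>" using N' by (intro vnear[OF _ \<eta>(1,2) _ \<zeta>]) auto
        then show "dist (v (N + k) \<zeta>) \<zeta> < e" using \<eta>(3) by (simp add: dist_norm)
      qed
    qed
  qed auto
  show ?thesis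
    unfolding uniform_limit_sequentially_iff
  proof (intro allI impI)
    fix e :: real assume e: "e > 0"
    define \<eta> where "\<eta> = min (r/4) (e/2)"
    have \<eta>: "\<eta> > 0" "\<eta> \<le> r/4" "\<eta> < e" using r e by (auto simp: \<eta>_def)
    obtain N' where N': "\<And>k z. k \<ge> N' \<Longrightarrow> z \<in> cball x (r/2) \<Longrightarrow> cmod (v (N + k) z - z) < \<eta>"
      using vlim \<eta>(1) unfolding uniform_limit_sequentially_iff dist_norm by blast
    show "\<exists>N. \<forall>k\<ge>N. \<forall>\<zeta>\<in>ball x (r/4). dist (g (u k) \<zeta>) \<zeta> < e"
    proof (intro exI allI impI ballI)
      fix k \<zeta> assume k: "k \<ge> N + N'" and \<zeta>: "\<zeta> \<in> ball x (r/4)"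
      have kN: "k \<ge> N" "N + (k - N) = k" "k - N \<ge> N'" using k by auto
      have sub: "cball \<zeta> \<eta> \<subseteq> cball x (r/2)"
      proof
        fix t assume "t \<in> cball \<zeta> \<eta>"
        then show "t \<in> cball x (r/2)" using \<zeta> \<eta>(2) dist_triangle[of x t \<zeta>] by simp
      qed
      have cb: "cball x (r/2) \<subseteq> ball x r" using r by auto
      obtain t where t: "t \<in> cball \<zeta> \<eta>" "v k t = \<zeta>"
      proof (rule near_identity_covers[OF _ _ sub \<eta>(1), of "v k"])
        show "continuous_on (cball x (r/2)) (v k)"
          using continuous_on_subset[OF holomorphic_on_imp_continuous_on[OF v(1)[OF kN(1)]] cb] .
        show "cmod (v k t - t) \<le> \<eta>" if "t \<in> cball x (r/2)" for t
          using N'[OF kN(3) that] kN(2) by simp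
      qed
      have "t \<in> ball x r" using t(1) sub cb by blast
      then have "g (u k) \<zeta> = t" using v(2)[OF kN(1)] t(2) by auto
      then show "dist (g (u k) \<zeta>) \<zeta> < e" using t(1) \<eta>(3) by (simp add: dist_commute)
    qed
  qed
qed

lemma identity_limit_extends_Pc:
  assumes x: "x \<in> Pc"
  obtains d where "d > 0"
    "\<And>y s u. y \<in> ball x d \<Longrightarrow> s > 0 \<Longrightarrow> uniform_limit (ball y s) (\<lambda>k. g (u k)) (\<lambda>z. z) sequentially \<Longrightarrow>
       uniform_limit (ball x (d/2)) (\<lambda>k. g (u k)) (\<lambda>z. z) sequentially"
proof -
  obtain d where d: "d > 0" "\<forall>w y. cmod (y - x) < d \<longrightarrow> cmod (g w y - g w x) < 1"
    using Pc_equicontinuous[OF x zero_less_one] by blast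
  have bd: "cmod (g w y) \<le> R + 1" if "y \<in> ball x d" for w y
  proof -
    have "cmod (g w y - g w x) < 1" using d(2)[rule_format, of y w] that by (simp add: dist_norm norm_minus_commute)
    moreover have "cmod (g w x) < R" using Pc_less_R[OF Pc_forward[OF x]] .
    ultimately show ?thesis using norm_triangle_ineq2[of "g w y" "g w x"] by linarith
  qed
  show ?thesis
  proof (rule that[OF d(1)])
    fix y s and u :: "nat \<Rightarrow> bool list"
    assume y: "y \<in> ball x d" and s: "s > 0" and lim: "uniform_limit (ball y s) (\<lambda>k. g (u k)) (\<lambda>z. z) sequentially"
    have "uniform_limit (cball x (d/2)) (\<lambda>k. g (u k)) (\<lambda>z. z) sequentially"
    proof (rule vitali_convergence[of "ball x d" _ "R + 1" "\<lambda>z. z" "ball y s \<inter> ball x d"])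
      show "ball y s \<inter> ball x d \<noteq> {}" using y s by (metis IntI centre_in_ball empty_iff)
      show "(\<lambda>k. g (u k) z) \<longlonglongrightarrow> z" if "z \<in> ball y s \<inter> ball x d" for z
        using tendsto_uniform_limitI[OF lim, of z] that by blast
      show "cball x (d/2) \<subseteq> ball x d" using d(1) by auto
    qed (use bd in \<open>auto intro: holomorphic_intros\<close>)
    then show "uniform_limit (ball x (d/2)) (\<lambda>k. g (u k)) (\<lambda>z. z) sequentially"
      by (rule uniform_limit_on_subset) auto
  qed
qed

text \<open>
  The set of points near which the words converge to the identity is open and closed, so it is the
  whole plane; but nonempty words at least double the modulus \<open>R\<close>.
\<close>

lemma no_identity_limit:
  assumes u: "\<And>k. u k \<noteq> []" and \<rho>: "\<rho> > 0"
    and lim: "uniform_limit (ball b \<rho>) (\<lambda>k. g (u k)) (\<lambda>z. z) sequentially"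
  shows False
proof -
  define \<Omega> where "\<Omega> = {x. \<exists>r>0. uniform_limit (ball x r) (\<lambda>k. g (u k)) (\<lambda>z. z) sequentially}"
  have bO: "b \<in> \<Omega>" using \<rho> lim by (auto simp: \<Omega>_def)
  have opO: "open \<Omega>"
    unfolding open_dist
  proof
    fix x assume "x \<in> \<Omega>"
    then obtain r where r: "r > 0" "uniform_limit (ball x r) (\<lambda>k. g (u k)) (\<lambda>z. z) sequentially" by (auto simp: \<Omega>_def)
    have "y \<in> \<Omega>" if "dist y x < r/2" for y
    proof -
      have "ball y (r/2) \<subseteq> ball x r"
      proof
        fix z assume "z \<in> ball y (r/2)"
        then show "z \<in> ball x r" using that dist_triangle[of x z y] by (simp add: dist_commute)
      qed
      then have "uniform_limit (ball y (r/2)) (\<lambda>k. g (u k)) (\<lambda>z. z) sequentially"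
        using r(2) uniform_limit_on_subset by blast
      then show ?thesis unfolding \<Omega>_def using r(1) by (intro CollectI exI[of _ "r/2"]) auto
    qed
    then show "\<exists>e>0. \<forall>y. dist y x < e \<longrightarrow> y \<in> \<Omega>" using r(1) by (intro exI[of _ "r/2"]) auto
  qed
  have "x \<in> \<Omega>" if x: "x \<in> closure \<Omega>" for x
  proof -
    have pick: "\<exists>y s. y \<in> ball x r \<and> s > 0 \<and> uniform_limit (ball y s) (\<lambda>k. g (u k)) (\<lambda>z. z) sequentially" if "r > 0" for r
    proof -
      obtain y where y: "y \<in> \<Omega>" "dist y x < r" using x \<open>r > 0\<close> unfolding closure_approachable by blast
      then have "y \<in> ball x r" by (simp add: dist_commute)
      then show ?thesis using y(1) unfolding \<Omega>_def by blast
    qed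
    show ?thesis
    proof (cases "x \<in> Pc")
      case True
      obtain d where d: "d > 0"
        "\<And>y s u. y \<in> ball x d \<Longrightarrow> s > 0 \<Longrightarrow> uniform_limit (ball y s) (\<lambda>k. g (u k)) (\<lambda>z. z) sequentially \<Longrightarrow>
          uniform_limit (ball x (d/2)) (\<lambda>k. g (u k)) (\<lambda>z. z) sequentially"
        using identity_limit_extends_Pc[OF True] by metis
      have "uniform_limit (ball x (d/2)) (\<lambda>k. g (u k)) (\<lambda>z. z) sequentially" using pick[OF d(1)] d(2) by blast
      then show ?thesis unfolding \<Omega>_def using d(1) by (intro CollectI exI[of _ "d/2"]) auto
    next
      case False
      have "open (- Pc)" "x \<in> - Pc" using closed_Pc False by auto
      then obtain r where r: "r > 0" "ball x r \<subseteq> - Pc" by (meson openE)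
      then have "ball x r \<inter> Pc = {}" by blast
      then have "uniform_limit (ball x (r/4)) (\<lambda>k. g (u k)) (\<lambda>z. z) sequentially"
        using pick[OF r(1)] identity_limit_extends_off_Pc[OF r(1)] by blast
      then show ?thesis unfolding \<Omega>_def using r(1) by (intro CollectI exI[of _ "r/4"]) auto
    qed
  qed
  then have "closed \<Omega>" using closure_subset_eq by blast
  then have "\<Omega> = UNIV" using opO bO clopen[of \<Omega>] by blast
  then obtain r where r: "r > 0" "uniform_limit (ball (of_real R) r) (\<lambda>k. g (u k)) (\<lambda>z. z) sequentially"
    by (auto simp: \<Omega>_def)
  then have "(\<lambda>k. g (u k) (of_real R)) \<longlonglongrightarrow> of_real R" by (intro tendsto_uniform_limitI) auto
  then obtain k where "dist (g (u k) (of_real R)) (of_real R) < R"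
    unfolding lim_sequentially using R1 by (meson less_le_trans order_refl zero_less_one)
  then have lt: "cmod (g (u k) (of_real R)) < 2 * R"
    using norm_triangle_ineq2[of "g (u k) (of_real R)" "of_real R"] R1 by (simp add: dist_norm)
  have "(2::real) ^ 1 \<le> 2 ^ length (u k)" using u[of k] by (intro power_increasing) (auto simp: Suc_le_eq)
  then have "2 * R \<le> 2 ^ length (u k) * R" using R1 by (intro mult_right_mono) auto
  moreover have "2 ^ length (u k) * R \<le> cmod (g (u k) (of_real R))"
    using g_escape[of "of_real R" "u k"] R1 by simp
  ultimately show False using lt by linarith
qed

text \<open>
  A subsequence of the prefixes converges to a nonconstant map \<open>\<psi>\<close>. The words between consecutive
  members of the subsequence then converge to the identity near \<open>\<psi> a\<close>.
\<close>

lemma expanding_orbit_impossible: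
  assumes r: "r > 0" and bd: "\<And>m z. z \<in> ball a r \<Longrightarrow> cmod (g (map \<gamma> [0..<m]) z) \<le> M"
    and \<epsilon>: "\<epsilon> > 0" and ex: "\<And>m. cmod (deriv (g (map \<gamma> [0..<m])) a) \<ge> \<epsilon>"
  shows False
proof -
  define f where "f m = g (map \<gamma> [0..<m])" for m
  have fh: "f m holomorphic_on S" for m S unfolding f_def by (rule g_holomorphic)
  let ?H = "{h. h holomorphic_on ball a r \<and> (\<forall>z\<in>ball a r. cmod (h z) \<le> M)}"
  obtain \<psi> s where \<psi>: "\<psi> holomorphic_on ball a r" and s: "strict_mono (s::nat\<Rightarrow>nat)"
      and lim: "\<And>x. x \<in> ball a r \<Longrightarrow> (\<lambda>n. f (s n) x) \<longlonglongrightarrow> \<psi> x"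
        "\<And>K. \<lbrakk>compact K; K \<subseteq> ball a r\<rbrakk> \<Longrightarrow> uniform_limit K (f \<circ> s) \<psi> sequentially"
  proof (rule Montel[of "ball a r" ?H f])
    show "\<exists>B. \<forall>h\<in>?H. \<forall>z\<in>K. cmod (h z) \<le> B" if "compact K" "K \<subseteq> ball a r" for K using that by blast
    show "range f \<subseteq> ?H" using bd fh unfolding f_def by blast
  qed auto
  have "uniform_limit (cball a (r/2)) (f \<circ> s) \<psi> sequentially" using r by (intro lim(2)) auto
  then have close: "\<exists>N. \<forall>k\<ge>N. \<forall>z\<in>cball a (r/2). cmod (f (s k) z - \<psi> z) < e" if "e > 0" for e
    using that by (auto simp: uniform_limit_sequentially_iff dist_norm)
  have "ball a (r/2) \<subseteq> ball a r" using r by auto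
  then have \<psi>h: "\<psi> holomorphic_on ball a (r/2)" using \<psi> holomorphic_on_subset by blast
  have d\<psi>: "deriv \<psi> a \<noteq> 0"
  proof
    assume 0: "deriv \<psi> a = 0"
    obtain N where N: "\<forall>k\<ge>N. \<forall>z\<in>cball a (r/2). cmod (f (s k) z - \<psi> z) < \<epsilon> * r / 8"
      using close[of "\<epsilon> * r / 8"] \<epsilon> r by auto
    have "cmod (deriv (\<lambda>z. f (s N) z - \<psi> z) a) \<le> 2 * (\<epsilon> * r / 8) / (r/2)"
    proof (rule cauchy_deriv_bound)
      show "(\<lambda>z. f (s N) z - \<psi> z) holomorphic_on ball a (r/2)" by (intro holomorphic_intros fh \<psi>h)
      show "cmod (f (s N) z - \<psi> z) \<le> \<epsilon> * r / 8" if "z \<in> ball a (r/2)" for z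
        using N that by (auto intro!: less_imp_le)
    qed (use r in simp)
    moreover have "deriv (\<lambda>z. f (s N) z - \<psi> z) a = deriv (f (s N)) a - deriv \<psi> a"
    proof (rule deriv_diff)
      show "f (s N) field_differentiable at a"
        using fh[of "s N" UNIV] by (simp add: holomorphic_on_def)
      show "\<psi> field_differentiable at a" using \<psi> r by (meson centre_in_ball holomorphic_on_imp_differentiable_at open_ball)
    qed
    ultimately have "cmod (deriv (f (s N)) a) \<le> \<epsilon> / 2" using 0 r by simp
    then show False using ex[of "s N"] \<epsilon> unfolding f_def by linarith
  qed
  obtain t where t: "t > 0" "ball a t \<subseteq> ball a (r/2)" "open (\<psi> ` ball a t)" "inj_on \<psi> (ball a t)"
    using has_complex_derivative_locally_invertible[OF \<psi>h _ open_ball d\<psi>] r by auto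
  obtain \<sigma> where \<sigma>: "\<sigma> holomorphic_on \<psi> ` ball a t" "\<And>z. z \<in> ball a t \<Longrightarrow> \<sigma> (\<psi> z) = z"
    using holomorphic_has_inverse[OF holomorphic_on_subset[OF \<psi>h t(2)] open_ball t(4)] by metis
  define b where "b = \<psi> a"
  have "b \<in> \<psi> ` ball a t" using t(1) by (simp add: b_def)
  then obtain \<rho> where \<rho>: "\<rho> > 0" "cball b \<rho> \<subseteq> \<psi> ` ball a t" using t(3) open_contains_cball by blast
  have \<sigma>in: "\<sigma> \<zeta> \<in> ball a t" "\<psi> (\<sigma> \<zeta>) = \<zeta>" if "\<zeta> \<in> cball b \<rho>" for \<zeta>
    using \<rho>(2) \<sigma>(2) that by force+
  define u where "u k = map \<gamma> [s k..<s (Suc k)]" for k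
  have sk: "s k < s (Suc k)" for k using s by (simp add: strict_mono_def)
  have une: "u k \<noteq> []" for k using sk[of k] by (simp add: u_def)
  have fu: "f (s (Suc k)) z = g (u k) (f (s k) z)" for k z
  proof -
    have "[0..<s (Suc k)] = [0..<s k] @ [s k..<s (Suc k)]"
      using sk[of k] by (metis le_add_diff_inverse less_imp_le upt_add_eq_append zero_le)
    then show ?thesis by (simp add: f_def u_def g_append)
  qed
  have "uniform_limit (ball b (\<rho>/2)) (\<lambda>k. g (u k)) (\<lambda>z. z) sequentially"
    unfolding uniform_limit_sequentially_iff
  proof (intro allI impI)
    fix e :: real assume e: "e > 0"
    define \<eta> where "\<eta> = min (\<rho>/2) (e/2)"
    have \<eta>: "\<eta> > 0" "\<eta> \<le> \<rho>/2" "2 * \<eta> \<le> e" using \<rho>(1) e by (auto simp: \<eta>_def)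
    obtain N where N: "\<forall>k\<ge>N. \<forall>z\<in>cball a (r/2). cmod (f (s k) z - \<psi> z) < \<eta>" using close[OF \<eta>(1)] by blast
    show "\<exists>N. \<forall>k\<ge>N. \<forall>y\<in>ball b (\<rho>/2). dist (g (u k) y) y < e"
    proof (intro exI allI impI ballI)
      fix k y assume k: "k \<ge> N" and y: "y \<in> ball b (\<rho>/2)"
      have near: "cmod (f (s j) z - \<psi> z) < \<eta>" if "j \<ge> N" "z \<in> ball a t" for j z
        using N that t(2) ball_subset_cball by blast
      have sub: "cball y \<eta> \<subseteq> cball b \<rho>"
      proof
        fix z assume "z \<in> cball y \<eta>"
        then show "z \<in> cball b \<rho>" using y \<eta>(2) dist_triangle[of b z y] by simp
      qed
      obtain \<zeta> where \<zeta>: "\<zeta> \<in> cball y \<eta>" "f (s k) (\<sigma> \<zeta>) = y"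
      proof (rule near_identity_covers[OF _ _ sub \<eta>(1), of "\<lambda>z. f (s k) (\<sigma> z)"])
        have "continuous_on (cball b \<rho>) \<sigma>"
          using holomorphic_on_imp_continuous_on[OF \<sigma>(1)] \<rho>(2) by (rule continuous_on_subset)
        then show "continuous_on (cball b \<rho>) (\<lambda>z. f (s k) (\<sigma> z))"
          unfolding f_def by (intro continuous_intros)
        show "cmod (f (s k) (\<sigma> z) - z) \<le> \<eta>" if "z \<in> cball b \<rho>" for z
          using near[OF k \<sigma>in(1)[OF that]] \<sigma>in(2)[OF that] by simp
      qed
      let ?x = "\<sigma> \<zeta>"
      have x: "?x \<in> ball a t" using \<zeta>(1) sub by (intro \<sigma>in(1)) blast
      have "g (u k) y = f (s (Suc k)) ?x" using fu[of k ?x] \<zeta>(2) by simp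
      then have "g (u k) y - y = (f (s (Suc k)) ?x - \<psi> ?x) - (f (s k) ?x - \<psi> ?x)" using \<zeta>(2) by simp
      then have "cmod (g (u k) y - y) \<le> cmod (f (s (Suc k)) ?x - \<psi> ?x) + cmod (f (s k) ?x - \<psi> ?x)"
        using norm_triangle_ineq4 by metis
      also have "\<dots> < \<eta> + \<eta>" using near[OF _ x, of "Suc k"] near[OF k x] k by (intro add_strict_mono) auto
      finally show "dist (g (u k) y) y < e" using \<eta>(3) by (simp add: dist_norm)
    qed
  qed
  then show False using no_identity_limit[of u, OF une, where \<rho> = "\<rho>/2" and b = b] \<rho>(1) by simp
qed

lemma deriv_g_append: "deriv (g (u @ v)) z = deriv (g v) (g u z) * deriv (g u) z"
  by (simp add: wp_append pderiv_pcompose poly_pcompose)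

text \<open>
  As long as the orbit stays away from the postcritical set, inverse branches on discs of fixed radius
  are bounded, so the derivatives along the orbit are bounded below.
\<close>

lemma filled_interior_attracted:
  assumes z: "z \<in> interior (K b)" and \<delta>: "\<delta> > 0"
  obtains m x where "x \<in> Pc" "cmod (g (replicate m b) z - x) < \<delta>"
proof (rule ccontr)
  assume neg: "\<not> thesis"
  have off: "ball (g (replicate m b) z) \<delta> \<inter> Pc = {}" for m
    using neg that by (fastforce simp: dist_norm)
  obtain r where r: "r > 0" "ball z r \<subseteq> K b" using z mem_interior by blast
  show False
  proof (rule expanding_orbit_impossible[OF r(1), where \<gamma> = "\<lambda>_. b" and M = R and \<epsilon> = "\<delta> / (2 * (R + \<delta>))"])
    show "cmod (g (map (\<lambda>_. b) [0..<m]) y) \<le> R" if "y \<in> ball z r" for m y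
      using filled_iff[of y b] r(2) that by (auto simp: map_replicate_const)
    show "\<delta> / (2 * (R + \<delta>)) > 0" using \<delta> R1 by simp
    fix m
    let ?w = "replicate m b"
    have gz: "g ?w z \<in> ball (g ?w z) \<delta>" using \<delta> by simp
    obtain v where v: "v holomorphic_on ball (g ?w z) \<delta>" "\<forall>y\<in>ball (g ?w z) \<delta>. g ?w (v y) = y" "v (g ?w z) = z"
      using poly_inverse_branch[OF degree_wp_pos no_critical_values_off_Pc[OF off] gz] by metis
    have zK: "z \<in> K b" using z interior_subset by blast
    have "cmod (deriv v (g ?w z)) \<le> 2 * (R + \<delta>) / \<delta>"
    proof (rule cauchy_deriv_bound[OF v(1) \<delta>])
      fix y assume y: "y \<in> ball (g ?w z) \<delta>"
      have "cmod (g ?w z) \<le> R" using zK filled_iff by blast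
      then have "cmod y \<le> R + \<delta>" using y norm_triangle_ineq2[of y "g ?w z"] by (simp add: dist_norm norm_minus_commute)
      moreover have "g ?w (v y) = y" using v(2) y by blast
      ultimately have "cmod (g ?w (v y)) \<le> R + \<delta>" by simp
      then show "cmod (v y) \<le> R + \<delta>" by (rule preimage_norm_le) (use \<delta> in simp)
    qed
    moreover have "deriv (g ?w) z * deriv v (g ?w z) = 1"
    proof -
      have dv: "(v has_field_derivative deriv v (g ?w z)) (at (g ?w z))"
        using v(1) \<delta> by (meson centre_in_ball holomorphic_derivI open_ball)
      have "(g ?w has_field_derivative deriv (g ?w) z) (at (v (g ?w z)))"
        unfolding v(3) by (simp add: poly_DERIV)
      from DERIV_chain2[OF this dv]
      have "((\<lambda>y. g ?w (v y)) has_field_derivative deriv (g ?w) z * deriv v (g ?w z)) (at (g ?w z))" .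
      moreover have "((\<lambda>y. g ?w (v y)) has_field_derivative 1) (at (g ?w z))"
        by (rule DERIV_ident[THEN has_field_derivative_transform_within_open[of "\<lambda>x. x" 1 "g ?w z" "ball (g ?w z) \<delta>"]])
           (use v(2) \<delta> in auto)
      ultimately show ?thesis by (rule DERIV_unique)
    qed
    then have "cmod (deriv (g ?w) z) * cmod (deriv v (g ?w z)) = 1" by (metis norm_mult norm_one)
    ultimately have "1 \<le> cmod (deriv (g ?w) z) * (2 * (R + \<delta>) / \<delta>)"
      using mult_left_mono[of "cmod (deriv v (g ?w z))" "2 * (R + \<delta>) / \<delta>" "cmod (deriv (g ?w) z)"] by simp
    then have "\<delta> / (2 * (R + \<delta>)) \<le> cmod (deriv (g ?w) z)"
      using \<delta> R1 by (simp add: field_simps)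
    then show "\<delta> / (2 * (R + \<delta>)) \<le> cmod (deriv (g (map (\<lambda>_. b) [0..<m])) z)"
      by (simp add: map_replicate_const)
  qed
qed

text \<open>
  If long words did not have small derivatives on a compact neighbourhood \<open>Q\<close> of the postcritical set,
  all their prefixes would have derivatives bounded below, since the derivatives of the remaining
  parts are bounded above. By Koenig's lemma and compactness there would be one infinite sequence of
  letters and one point for which all prefixes have this property.
\<close>

lemma contraction_near_Pc:
  obtains N \<delta> where "\<delta> > 0"
    "\<And>w x z. length w \<ge> N \<Longrightarrow> x \<in> Pc \<Longrightarrow> cmod (z - x) < \<delta> \<Longrightarrow> cmod (g w z - g w x) \<le> cmod (z - x) / 2"
proof -
  obtain r where r: "r > 0" "\<And>x w y. x \<in> Pc \<Longrightarrow> cmod (y - x) < r \<Longrightarrow> cmod (g w y - g w x) < 1"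
    using Pc_uniformly_equicontinuous[of 1] by auto
  obtain d0 where d0: "d0 > 0" "\<And>x w y. x \<in> Pc \<Longrightarrow> cmod (y - x) < d0 \<Longrightarrow> cmod (g w y - g w x) < r / 4"
    using Pc_uniformly_equicontinuous[of "r/4"] r by auto
  define d where "d = d0 / 2"
  define Q where "Q = {z. infdist z Pc \<le> d}"
  have near: "\<exists>x\<in>Pc. cmod (z - x) < d0" if "z \<in> Q" for z
  proof -
    have "infdist z Pc < d0" using that d0(1) by (simp add: Q_def d_def)
    then obtain x where "x \<in> Pc" "dist z x < d0"
      using infdist_attains_inf[OF closed_Pc Pc_nonempty, of z] by metis
    then show ?thesis by (auto simp: dist_norm)
  qed
  have orb: "\<exists>x\<in>Pc. cmod (g w z - x) < r / 4" if "z \<in> Q" for w z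
    using near[OF that] d0(2) Pc_forward by blast
  have bd: "cmod (g v y) \<le> R + 1" if "x \<in> Pc" "cmod (y - x) < r" for v x y
  proof -
    have "cmod (g v y - g v x) < 1" using r(2) that by blast
    moreover have "cmod (g v x) < R" using Pc_less_R[OF Pc_forward[OF that(1)]] .
    ultimately show ?thesis using norm_triangle_ineq2[of "g v y" "g v x"] by linarith
  qed
  have ballr: "\<exists>x\<in>Pc. \<forall>y\<in>ball z (r/4). cmod (y - x) < r" if "\<exists>x\<in>Pc. cmod (z - x) < r / 4" for z
  proof -
    obtain x where x: "x \<in> Pc" "cmod (z - x) < r / 4" using \<open>\<exists>x\<in>Pc. cmod (z - x) < r / 4\<close> by blast
    have "cmod (y - x) < r" if "y \<in> ball z (r/4)" for y
    proof -
      have "cmod (y - z) < r / 4" using that by (simp add: dist_norm norm_minus_commute)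
      then show ?thesis using norm_triangle_ineq[of "y - z" "z - x"] x(2) r(1) by simp
    qed
    then show ?thesis using x(1) by blast
  qed
  define C where "C = 2 * (R + 1) / (r/4)"
  have C: "C > 0" using r(1) R1 by (simp add: C_def)
  have derb: "cmod (deriv (g v) (g w z)) \<le> C" if "z \<in> Q" for v w z
    unfolding C_def
  proof (rule cauchy_deriv_bound)
    show "cmod (g v y) \<le> R + 1" if "y \<in> ball (g w z) (r/4)" for y
      using ballr[OF orb[OF \<open>z \<in> Q\<close>, of w]] bd that by blast
  qed (use r g_holomorphic in auto)
  define \<epsilon> where "\<epsilon> = 1 / (2 * C)"
  have \<epsilon>: "\<epsilon> > 0" using C by (simp add: \<epsilon>_def)
  \<comment> \<open>No prefix has a small derivative at \<open>y\<close>.\<close>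
  define Good where "Good w y \<longleftrightarrow> (\<forall>m\<le>length w. cmod (deriv (g (take m w)) y) \<ge> \<epsilon>)" for w y
  have good: "Good w y" if y: "y \<in> Q" and big: "cmod (deriv (g w) y) > 1/2" for w y
    unfolding Good_def
  proof (intro allI impI)
    fix m assume "m \<le> length w"
    have "deriv (g w) y = deriv (g (drop m w)) (g (take m w) y) * deriv (g (take m w)) y"
      using deriv_g_append[of "take m w" "drop m w" y] by simp
    then have "cmod (deriv (g w) y) = cmod (deriv (g (drop m w)) (g (take m w) y)) * cmod (deriv (g (take m w)) y)"
      by (simp only: norm_mult)
    also have "\<dots> \<le> C * cmod (deriv (g (take m w)) y)" using derb[OF y] by (intro mult_right_mono) auto
    finally have "1/2 < C * cmod (deriv (g (take m w)) y)" using big by linarith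
    then show "\<epsilon> \<le> cmod (deriv (g (take m w)) y)" using C by (simp add: \<epsilon>_def field_simps)
  qed
  have "\<exists>N. \<forall>w. length w \<ge> N \<longrightarrow> (\<forall>y\<in>Q. cmod (deriv (g w) y) \<le> 1/2)"
  proof (rule ccontr)
    assume neg: "\<nexists>N. \<forall>w. length w \<ge> N \<longrightarrow> (\<forall>y\<in>Q. cmod (deriv (g w) y) \<le> 1/2)"
    \<comment> \<open>Words with arbitrarily long good extensions form an infinite binary tree.\<close>
    define Inf where "Inf w0 \<longleftrightarrow> (\<forall>n. \<exists>w y. length w \<ge> n \<and> y \<in> Q \<and> Good (w0 @ w) y)" for w0
    have Inf0: "Inf []"
      unfolding Inf_def using neg good by (metis append_Nil not_le)
    have InfS: "\<exists>b. Inf (w0 @ [b])" if "Inf w0" for w0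
    proof (rule ccontr)
      assume "\<nexists>b. Inf (w0 @ [b])"
      then have "\<forall>b. \<exists>n. \<forall>w y. length w \<ge> n \<longrightarrow> y \<in> Q \<longrightarrow> \<not> Good ((w0 @ [b]) @ w) y"
        unfolding Inf_def by blast
      then obtain n where n: "\<And>b w y. length w \<ge> n b \<Longrightarrow> y \<in> Q \<Longrightarrow> \<not> Good ((w0 @ [b]) @ w) y" by metis
      obtain w y where w: "length w \<ge> Suc (max (n True) (n False))" "y \<in> Q" "Good (w0 @ w) y"
        using \<open>Inf w0\<close> unfolding Inf_def by blast
      then obtain b w' where bw: "w = b # w'" "length w' \<ge> max (n True) (n False)" by (cases w) auto
      then have "length w' \<ge> n b" by (cases b) auto
      then show False using n[of b w' y] w bw(1) by simp
    qed
    obtain W where W: "\<And>n. Inf (W n) \<and> length (W n) = n" "\<And>n. \<exists>b. W (Suc n) = W n @ [b]"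
    proof -
      have "\<exists>W. \<forall>n. (Inf (W n) \<and> length (W n) = n) \<and> (\<exists>b. W (Suc n) = W n @ [b])"
      proof (rule dependent_nat_choice)
        show "\<exists>x. Inf x \<and> length x = 0" using Inf0 by auto
        fix x n assume "Inf x \<and> length x = n"
        then show "\<exists>y. (Inf y \<and> length y = Suc n) \<and> (\<exists>b. y = x @ [b])" using InfS[of x] by auto
      qed
      then show ?thesis using that by blast
    qed
    define \<gamma> where "\<gamma> n = last (W (Suc n))" for n
    have Wg: "W n = map \<gamma> [0..<n]" for n
    proof (induction n)
      case 0 then show ?case using W(1)[of 0] by simp
    next
      case (Suc n)
      obtain b where "W (Suc n) = W n @ [b]" using W(2) by blast
      then show ?case using Suc by (simp add: \<gamma>_def)
    qed
    have tk: "take m (W n) = W m" if "m \<le> n" for m n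
      unfolding Wg using that by (simp add: take_map)
    define F where "F n = {y \<in> Q. \<forall>m\<le>n. cmod (deriv (g (W m)) y) \<ge> \<epsilon>}" for n
    have Qc: "compact Q" unfolding Q_def using compact_Pc Pc_nonempty by (intro compact_infdist_le) (auto simp: d_def d0(1))
    have "\<Inter> (range F) \<noteq> {}"
    proof (rule compact_nest)
      show "F n \<subseteq> F m" if "m \<le> n" for m n using that by (auto simp: F_def)
      fix n
      have "F n = Q \<inter> (\<Inter>m\<in>{..n}. {y. \<epsilon> \<le> cmod (deriv (g (W m)) y)})" by (auto simp: F_def)
      moreover have "closed (\<Inter>m\<in>{..n}. {y. \<epsilon> \<le> cmod (deriv (g (W m)) y)})"
        by (intro closed_INT ballI closed_Collect_le) (auto intro!: continuous_intros)
      ultimately show "compact (F n)" using Qc by (simp add: compact_Int_closed)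
      obtain w y where w: "y \<in> Q" "Good (W n @ w) y" using W(1)[of n] unfolding Inf_def by blast
      have "cmod (deriv (g (W m)) y) \<ge> \<epsilon>" if "m \<le> n" for m
      proof -
        have "take m (W n @ w) = W m" using tk[OF that] W(1)[of n] that by simp
        moreover have "m \<le> length (W n @ w)" using W(1)[of n] that by simp
        ultimately show ?thesis using w(2) unfolding Good_def by metis
      qed
      then show "F n \<noteq> {}" using w(1) by (auto simp: F_def)
    qed
    then obtain a where a: "\<And>n. a \<in> F n" by blast
    have aQ: "a \<in> Q" using a[of 0] by (simp add: F_def)
    have "\<exists>x\<in>Pc. cmod (a - x) < r / 4" using orb[OF aQ, of "[]"] by simp
    then obtain x where x: "x \<in> Pc" "\<forall>y\<in>ball a (r/4). cmod (y - x) < r" using ballr by blast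
    show False
    proof (rule expanding_orbit_impossible[where r = "r/4" and a = a and \<gamma> = \<gamma> and M = "R + 1" and \<epsilon> = \<epsilon>])
      show "cmod (g (map \<gamma> [0..<m]) z) \<le> R + 1" if "z \<in> ball a (r/4)" for m z
        using bd[OF x(1)] x(2) that by blast
      show "\<epsilon> \<le> cmod (deriv (g (map \<gamma> [0..<m])) a)" for m
        using a[of m] unfolding F_def Wg[symmetric] by blast
    qed (use r \<epsilon> in auto)
  qed
  then obtain N where N: "\<And>w y. length w \<ge> N \<Longrightarrow> y \<in> Q \<Longrightarrow> cmod (deriv (g w) y) \<le> 1/2" by blast
  show ?thesis
  proof (rule that[of d N])
    show "d > 0" using d0 by (simp add: d_def)
    fix w :: "bool list" and x z assume w: "N \<le> length w" and x: "x \<in> Pc" and z: "cmod (z - x) < d"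
    have sub: "ball x d \<subseteq> Q"
    proof
      fix y assume "y \<in> ball x d"
      then have "dist y x < d" by (simp add: dist_commute)
      then show "y \<in> Q" using infdist_le[OF x, of y] by (simp add: Q_def)
    qed
    have "cmod (g w z - g w x) \<le> 1/2 * cmod (z - x)"
    proof (rule field_differentiable_bound[of "ball x d" "g w" "deriv (g w)"])
      show "(g w has_field_derivative deriv (g w) y) (at y within ball x d)" for y
        by (simp add: poly_DERIV has_field_derivative_at_within)
      show "cmod (deriv (g w) y) \<le> 1/2" if "y \<in> ball x d" for y using N[OF w] sub that by blast
      show "x \<in> ball x d" using d0(1) by (simp add: d_def)
      show "z \<in> ball x d" using z by (simp add: dist_norm norm_minus_commute)
    qed simp
    then show "cmod (g w z - g w x) \<le> cmod (z - x) / 2" by simp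
  qed
qed

end

section \<open>Perturbation of hyperbolic pairs\<close>

lemma dist_le_kappa: "dist (f z) (g z) \<le> kappa f g"
  unfolding kappa_def
  by (rule cSUP_upper[OF UNIV_I bdd_aboveI2[where M = pi]]) (rule dist_riemann_sphere_le_pi)

text \<open>
  The neighbourhood filter of a pair, so that the finitely many smallness conditions on a perturbation
  can be combined without naming bounds.
\<close>

definition near_pairs :: "(bool \<Rightarrow> complex poly) \<Rightarrow> (bool \<Rightarrow> complex poly) filter" where
  "near_pairs q = (INF \<epsilon>\<in>{0<..}. principal {f. \<forall>b. degree (f b) \<ge> 2 \<and> kappa (poly_map (q b)) (poly_map (f b)) < \<epsilon>})"

lemma eventually_near_pairs:
  "eventually P (near_pairs q) \<longleftrightarrow>
    (\<exists>\<epsilon>>0. \<forall>f. (\<forall>b. degree (f b) \<ge> 2 \<and> kappa (poly_map (q b)) (poly_map (f b)) < \<epsilon>) \<longrightarrow> P f)"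
  unfolding near_pairs_def
proof (subst eventually_INF_base)
  fix a b :: real assume "a \<in> {0<..}" "b \<in> {0<..}"
  then show "\<exists>x\<in>{0<..}. principal {f. \<forall>b. degree (f b) \<ge> 2 \<and> kappa (poly_map (q b)) (poly_map (f b)) < x}
      \<le> inf (principal {f. \<forall>b. degree (f b) \<ge> 2 \<and> kappa (poly_map (q b)) (poly_map (f b)) < a})
          (principal {f. \<forall>c. degree (f c) \<ge> 2 \<and> kappa (poly_map (q c)) (poly_map (f c)) < b})"
    by (intro bexI[of _ "min a b"]) auto
qed (auto simp: eventually_principal)

lemma near_pairs_uniform_limit:
  "uniform_limit (cball 0 \<rho>) (\<lambda>f. poly (f b)) (poly (q b)) (near_pairs q)"
  unfolding uniform_limit_iff
proof (intro allI impI)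
  fix e :: real assume e: "e > 0"
  have "bounded (poly (q b) ` cball 0 \<rho>)"
    by (intro compact_imp_bounded compact_continuous_image) (auto intro: continuous_intros)
  then obtain M where M: "\<And>z. z \<in> cball 0 \<rho> \<Longrightarrow> cmod (poly (q b) z) \<le> M" unfolding bounded_iff by blast
  obtain \<delta> where \<delta>: "\<delta> > 0" "\<And>z w. cmod z \<le> \<bar>M\<bar> \<Longrightarrow> dist (Fin z) (Fin w) < \<delta> \<Longrightarrow> cmod (z - w) < e"
    using dist_Fin_small_imp_close[OF e, of "\<bar>M\<bar>"] by auto
  show "\<forall>\<^sub>F f in near_pairs q. \<forall>z\<in>cball 0 \<rho>. dist (poly (f b) z) (poly (q b) z) < e"
    unfolding eventually_near_pairs
  proof (intro exI conjI allI impI ballI)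
    fix f :: "bool \<Rightarrow> complex poly" and z :: complex
    assume f: "\<forall>b. degree (f b) \<ge> 2 \<and> kappa (poly_map (q b)) (poly_map (f b)) < \<delta>" and z: "z \<in> cball 0 \<rho>"
    have "dist (Fin (poly (q b) z)) (Fin (poly (f b) z)) < \<delta>"
      using dist_le_kappa[of "poly_map (q b)" "Fin z" "poly_map (f b)"] f by (simp add: le_less_trans)
    moreover have "cmod (poly (q b) z) \<le> \<bar>M\<bar>" using M[OF z] by simp
    ultimately have "cmod (poly (q b) z - poly (f b) z) < e" by (intro \<delta>(2))
    then show "dist (poly (f b) z) (poly (q b) z) < e" by (simp add: dist_norm norm_minus_commute)
  qed (rule \<delta>(1))
qed

lemma near_pairs_uniform_limit_word:
  "uniform_limit (cball 0 \<rho>) (\<lambda>f. poly (word_poly f w)) (poly (word_poly q w)) (near_pairs q)"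
proof (induction w arbitrary: \<rho>)
  case Nil
  then show ?case by (simp add: uniform_limit_iff)
next
  case (Cons b w)
  let ?g = "poly (word_poly q w)"
  have "bounded (poly (q b) ` cball 0 \<rho>)"
    by (intro compact_imp_bounded compact_continuous_image) (auto intro: continuous_intros)
  then obtain M where M: "\<And>z. z \<in> cball 0 \<rho> \<Longrightarrow> cmod (poly (q b) z) \<le> M" unfolding bounded_iff by blast
  show ?case
    unfolding uniform_limit_iff
  proof (intro allI impI)
    fix e :: real assume e: "e > 0"
    have "uniformly_continuous_on (cball 0 (M + 1)) ?g"
      by (intro compact_uniformly_continuous) (auto intro: continuous_intros)
    then obtain d where d: "d > 0" "\<And>x y. x \<in> cball 0 (M+1) \<Longrightarrow> y \<in> cball 0 (M+1) \<Longrightarrow> dist y x < d \<Longrightarrow> dist (?g y) (?g x) < e/2"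
      unfolding uniformly_continuous_on_def using e half_gt_zero by metis
    have "\<forall>\<^sub>F f in near_pairs q. \<forall>z\<in>cball 0 (M+1). dist (poly (word_poly f w) z) (?g z) < e/2"
      using Cons.IH[of "M+1"] e unfolding uniform_limit_iff by (meson half_gt_zero)
    moreover have "\<forall>\<^sub>F f in near_pairs q. \<forall>z\<in>cball 0 \<rho>. dist (poly (f b) z) (poly (q b) z) < min d 1"
      using near_pairs_uniform_limit[where \<rho> = \<rho> and b = b and q = q] d(1) unfolding uniform_limit_iff by (meson min_less_iff_conj zero_less_one)
    ultimately show "\<forall>\<^sub>F f in near_pairs q. \<forall>z\<in>cball 0 \<rho>. dist (poly (word_poly f (b # w)) z) (poly (word_poly q (b # w)) z) < e"
    proof eventually_elim
      case (elim f)
      show ?case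
      proof
        fix z :: complex assume z: "z \<in> cball 0 \<rho>"
        have c: "dist (poly (f b) z) (poly (q b) z) < d" "dist (poly (f b) z) (poly (q b) z) < 1" using elim(2) z by auto
        have 1: "poly (q b) z \<in> cball 0 (M+1)" using M[OF z] by simp
        have 2: "poly (f b) z \<in> cball 0 (M+1)"
          using M[OF z] c(2) norm_triangle_ineq2[of "poly (f b) z" "poly (q b) z"] by (simp add: dist_norm)
        have "dist (poly (word_poly f w) (poly (f b) z)) (?g (poly (f b) z)) < e/2" using elim(1) 2 by blast
        moreover have "dist (?g (poly (f b) z)) (?g (poly (q b) z)) < e/2" by (rule d(2)[OF 1 2 c(1)])
        ultimately show "dist (poly (word_poly f (b # w)) z) (poly (word_poly q (b # w)) z) < e"
          using dist_triangle[of "poly (word_poly f w) (poly (f b) z)" "?g (poly (q b) z)" "?g (poly (f b) z)"]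
          by (simp add: poly_pcompose)
      qed
    qed
  qed
qed

lemma uniform_limit_eventually_close:
  assumes "uniform_limit S f l F" "e > 0"
  shows "\<forall>\<^sub>F x in F. \<forall>z\<in>S. cmod (f x z - l z) < e"
  using assms unfolding uniform_limit_iff dist_norm by blast

text \<open>
  The logarithmic derivative is the sum of the terms \<open>1 / (z - r)\<close> over the zeros, and
  \<open>z / (z - r)\<close> has positive real part if \<open>|r| < |z|\<close>. In particular there are no critical points
  where \<open>|z| \<ge> R\<close>.
\<close>

lemma zeros_in_disc_log_deriv:
  fixes f :: "complex poly"
  assumes "degree f > 0" "\<And>z. cmod z \<ge> R \<Longrightarrow> poly f z \<noteq> 0" "cmod z \<ge> R"
  shows "Re (z * poly (pderiv f) z / poly f z) > 0"
  using assms
proof (induction "degree f" arbitrary: f)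
  case (Suc n)
  obtain r where r: "poly f r = 0" using poly_surj[of f 0] Suc.prems by auto
  then obtain s where s: "f = [:- r, 1:] * s" by (metis dvdE poly_eq_0_iff_dvd)
  have s0: "s \<noteq> 0" using s Suc.hyps(2) by auto
  have rR: "cmod r < R" using Suc.prems(2)[of r] r by (meson not_less)
  then have rz: "cmod r < cmod z" using Suc.prems(3) by simp
  then have zr: "z - r \<noteq> 0" by auto
  have sz: "poly s z \<noteq> 0" using Suc.prems(2)[OF Suc.prems(3)] by (simp add: s)
  have ds: "degree f = Suc (degree s)" unfolding s using s0 by (subst degree_mult_eq) auto
  have split: "z * poly (pderiv f) z / poly f z = z / (z - r) + z * poly (pderiv s) z / poly s z"
  proof -
    have "poly f z = (z - r) * poly s z" by (simp add: s algebra_simps)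
    moreover have "poly (pderiv f) z = poly s z + (z - r) * poly (pderiv s) z"
      unfolding s pderiv_mult by (simp add: pderiv_pCons algebra_simps)
    moreover have "z * (S + a * D) / (a * S) = z / a + z * D / S" if "a \<noteq> 0" "S \<noteq> 0" for a S D :: complex
      using that by (simp add: field_simps)
    ultimately show ?thesis using zr sz by simp
  qed
  have "Re (z / (z - r)) > 0"
  proof -
    have "Re (z * cnj r) \<le> cmod (z * cnj r)" by (rule complex_Re_le_cmod)
    also have "\<dots> = cmod z * cmod r" by (simp add: norm_mult)
    also have "\<dots> < cmod z * cmod z" using rz by (intro mult_strict_left_mono) (auto intro: le_less_trans[OF norm_ge_zero])
    also have "\<dots> = Re (z * cnj z)" by (simp add: complex_mult_cnj cmod_power2[symmetric] power2_eq_square[symmetric])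
    finally have "Re (z * cnj (z - r)) > 0" by (simp add: algebra_simps)
    moreover have "z / (z - r) = (z * cnj (z - r)) / of_real ((cmod (z - r))\<^sup>2)"
      by (rule complex_div_cnj[THEN trans]) simp
    ultimately show ?thesis using zr by (simp add: Re_divide_of_real)
  qed
  moreover have "Re (z * poly (pderiv s) z / poly s z) \<ge> 0"
  proof (cases "degree s = 0")
    case True
    then have "pderiv s = 0" by (simp add: pderiv_eq_0_iff)
    then show ?thesis by simp
  next
    case False
    have "poly s z \<noteq> 0" if "cmod z \<ge> R" for z using Suc.prems(2)[OF that] by (auto simp: s)
    then have "Re (z * poly (pderiv s) z / poly s z) > 0"
      using Suc.hyps(1)[of s] Suc.hyps(2) ds False Suc.prems(3) by simp
    then show ?thesis by simp
  qed
  ultimately show ?case unfolding split by simp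
qed simp

text \<open>
  The chain rule locates the first letter at which the derivative vanishes.
\<close>

lemma (in poly_pair) critical_letter:
  "poly (pderiv (wp w)) c = 0 \<Longrightarrow> \<exists>u b v. w = u @ b # v \<and> poly (pderiv (q b)) (g u c) = 0"
proof (induction w arbitrary: c)
  case Nil
  then show ?case by (simp add: pderiv_pCons)
next
  case (Cons b w)
  have "poly (pderiv (wp w)) (poly (q b) c) * poly (pderiv (q b)) c = 0"
    using Cons.prems by (simp add: pderiv_pcompose poly_pcompose)
  then consider "poly (pderiv (wp w)) (poly (q b) c) = 0" | "poly (pderiv (q b)) c = 0" by auto
  then show ?case
  proof cases
    case 1
    then obtain u b' v where "w = u @ b' # v" "poly (pderiv (q b')) (g u (poly (q b) c)) = 0" using Cons.IH by blast
    then show ?thesis by (intro exI[of _ "b # u"] exI[of _ b'] exI[of _ v]) (simp add: poly_pcompose)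
  next
    case 2
    then show ?thesis by (intro exI[of _ "[]"] exI[of _ b] exI[of _ w]) simp
  qed
qed

lemma (in poly_pair) filled_word_vimage: "g (replicate m b) x \<in> K b \<longleftrightarrow> x \<in> K b"
  by (induction m arbitrary: x) (simp_all add: poly_pcompose filled_vimage)

text \<open>
  The factor 3 leaves room for perturbations that still satisfy the escape condition with factor 2.
\<close>

locale poly_pair_perturbation = poly_pair_hyperbolic +
  assumes esc3: "cmod z \<ge> R \<Longrightarrow> cmod (poly (q b) z) \<ge> 3 * cmod z"
begin

text \<open>
  A zero of modulus at least \<open>R\<close> would be a finite value spherically close to values of large modulus.
\<close>

lemma near_pairs_zero_free: "\<forall>\<^sub>F f in near_pairs q. \<forall>b z. cmod z \<ge> R \<longrightarrow> poly (f b) z \<noteq> 0"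
proof -
  obtain \<delta> where \<delta>: "\<delta> > 0" "\<And>z w. cmod z \<le> 0 \<Longrightarrow> dist (Fin z) (Fin w) < \<delta> \<Longrightarrow> cmod (z - w) < 1"
    using dist_Fin_small_imp_close[of 1 0] by auto
  show ?thesis
    unfolding eventually_near_pairs
  proof (intro exI conjI allI impI notI)
    fix f b z assume f: "\<forall>b. degree (f b) \<ge> 2 \<and> kappa (poly_map (q b)) (poly_map (f b)) < \<delta>"
      and z: "R \<le> cmod z" and 0: "poly (f b) z = 0"
    have "dist (Fin (poly (q b) z)) (Fin 0) < \<delta>"
      using dist_le_kappa[of "poly_map (q b)" "Fin z" "poly_map (f b)"] f 0 by (simp add: le_less_trans)
    then have "cmod (poly (q b) z) < 1" using \<delta>(2)[of 0 "poly (q b) z"] by (simp add: dist_commute)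
    then show False using esc3[OF z, of b] z R1 by linarith
  qed (rule \<delta>(1))
qed

text \<open>
  On the circle \<open>|z| = R\<close> the estimate survives a perturbation; the maximum principle for \<open>z / f z\<close>
  extends it to the outside, even though the leading coefficient is not controlled.
\<close>

lemma near_pairs_poly_pair: "\<forall>\<^sub>F f in near_pairs q. poly_pair f R"
proof -
  have "\<forall>\<^sub>F f in near_pairs q. \<forall>z\<in>cball 0 R. cmod (poly (f b) z - poly (q b) z) < 1" for b
    by (rule uniform_limit_eventually_close[OF near_pairs_uniform_limit]) simp
  then have "\<forall>\<^sub>F f in near_pairs q. \<forall>b. \<forall>z\<in>cball 0 R. cmod (poly (f b) z - poly (q b) z) < 1"
    by (simp add: eventually_all_finite)
  moreover have "\<forall>\<^sub>F f in near_pairs q. \<forall>b. degree (f b) \<ge> 2"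
    unfolding eventually_near_pairs by (intro exI[of _ 1]) auto
  ultimately show ?thesis using near_pairs_zero_free
  proof eventually_elim
    case (elim f)
    show ?case
    proof
      show "2 \<le> degree (f b)" for b using elim(2) by blast
      show "1 \<le> R" by (rule R1)
      have sph: "2 * cmod z \<le> cmod (poly (f b) z)" if "cmod z = R" for b z
      proof -
        have "cmod (poly (f b) z - poly (q b) z) < 1" using elim(1) that by simp
        then have "cmod (poly (f b) z) > cmod (poly (q b) z) - 1"
          using norm_triangle_ineq2[of "poly (q b) z" "poly (f b) z"] by (simp add: norm_minus_commute)
        then show ?thesis using esc3[of z b] that R1 by linarith
      qed
      fix b z assume z: "R \<le> cmod z"
      show "2 * cmod z \<le> cmod (poly (f b) z)"
      proof (cases "cmod z = R")
        case False
        have "cmod (poly [:0, 2:] z) \<le> 1 * cmod (poly (f b) z)"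
        proof (rule max_principle_outside[of "cball 0 R"])
          show "degree [:0, 2::complex:] \<le> degree (f b)" using elim(2)[rule_format, of b] by simp
          show "(0::complex) \<in> interior (cball 0 R)" using R1 by simp
          show "poly (f b) z \<noteq> 0" if "z \<notin> interior (cball 0 R)" for z using elim(3) that by simp
          show "cmod (poly [:0, 2:] z) \<le> 1 * cmod (poly (f b) z)" if "z \<in> frontier (cball 0 R)" for z
            using sph[of z b] that R1 by (simp add: norm_mult)
          show "z \<notin> cball 0 R" using z False by simp
        qed auto
        then show ?thesis by (simp add: norm_mult)
      qed (rule sph)
    qed
  qed
qed

text \<open>
  Critical points of perturbations lie in the disc of radius \<open>R\<close>, where derivatives converge
  uniformly. Away from the points that are mapped near the postcritical set, the unperturbed
  derivative is bounded below.
\<close>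

lemma near_pairs_critical_values:
  assumes \<delta>: "\<delta> > 0"
  shows "\<forall>\<^sub>F f in near_pairs q. \<forall>b c. poly (pderiv (f b)) c = 0 \<longrightarrow> infdist (poly (f b) c) Pc < \<delta>"
proof -
  have "\<forall>\<^sub>F f in near_pairs q. \<forall>c. poly (pderiv (f b)) c = 0 \<longrightarrow> infdist (poly (f b) c) Pc < \<delta>" for b
  proof -
    \<comment> \<open>The part of the disc that is not mapped near the postcritical set.\<close>
    define S where "S = cball 0 R \<inter> {z. \<delta>/2 \<le> infdist (poly (q b) z) Pc}"
    have "closed {z. \<delta>/2 \<le> infdist (poly (q b) z) Pc}"
      by (intro closed_Collect_le continuous_intros)
    then have S: "compact S" unfolding S_def by (intro compact_Int_closed) auto
    have nz: "poly (pderiv (q b)) z \<noteq> 0" if "z \<in> S" for z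
    proof
      assume "poly (pderiv (q b)) z = 0"
      then have "poly (q b) z \<in> Pc" using critical_value_Pc[of "[b]" z] by simp
      then show False using that \<delta> by (simp add: S_def)
    qed
    obtain \<eta> where \<eta>: "\<eta> > 0" "\<And>z. z \<in> S \<Longrightarrow> \<eta> \<le> cmod (poly (pderiv (q b)) z)"
    proof (cases "S = {}")
      case True then show ?thesis using that[of 1] by auto
    next
      case False
      obtain y where "y \<in> S" "\<And>x. x \<in> S \<Longrightarrow> cmod (poly (pderiv (q b)) y) \<le> cmod (poly (pderiv (q b)) x)"
        using poly_attains_min_max[OF S False, of "pderiv (q b)"] by metis
      then show ?thesis using that[of "cmod (poly (pderiv (q b)) y)"] nz by auto
    qed
    define \<kappa> where "\<kappa> = min (\<delta>/2) (\<eta>/3)"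
    have \<kappa>: "\<kappa> > 0" "\<kappa> \<le> \<delta>/2" "2 * \<kappa> < \<eta>" using \<delta> \<eta>(1) by (auto simp: \<kappa>_def)
    have "\<forall>\<^sub>F f in near_pairs q. \<forall>z\<in>cball 0 (R+1). cmod (poly (f b) z - poly (q b) z) < \<kappa>"
      by (rule uniform_limit_eventually_close[OF near_pairs_uniform_limit \<kappa>(1)])
    then show ?thesis using near_pairs_zero_free near_pairs_poly_pair
    proof eventually_elim
      case (elim f)
      interpret f: poly_pair f R by (rule elim(3))
      show ?case
      proof (intro allI impI)
        fix c assume c: "poly (pderiv (f b)) c = 0"
        have cR: "cmod c < R"
        proof (rule ccontr)
          assume "\<not> cmod c < R"
          then have "Re (c * poly (pderiv (f b)) c / poly (f b) c) > 0"
            using f.deg[of b] elim(2) by (intro zeros_in_disc_log_deriv[of "f b" R]) auto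
          then show False using c by simp
        qed
        have sub: "ball c 1 \<subseteq> cball 0 (R+1)"
        proof
          fix z assume "z \<in> ball c 1"
          then show "z \<in> cball 0 (R+1)" using cR norm_triangle_ineq2[of z c] by (simp add: dist_norm norm_minus_commute)
        qed
        have "cmod (deriv (poly (f b - q b)) c) \<le> 2 * \<kappa> / 1"
        proof (rule cauchy_deriv_bound)
          show "poly (f b - q b) holomorphic_on ball c 1" by (intro holomorphic_intros)
          show "cmod (poly (f b - q b) z) \<le> \<kappa>" if "z \<in> ball c 1" for z
          proof -
            have "cmod (poly (f b) z - poly (q b) z) < \<kappa>" using elim(1) sub that by blast
            then show ?thesis by simp
          qed
        qed simp
        then have "cmod (poly (pderiv (q b)) c) \<le> 2 * \<kappa>" using c by (simp add: pderiv_diff)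
        then have "c \<notin> S" using \<eta>(2)[of c] \<kappa>(3) by force
        then have "infdist (poly (q b) c) Pc < \<delta>/2" using cR by (simp add: S_def)
        moreover have "dist (poly (f b) c) (poly (q b) c) < \<delta>/2"
        proof -
          have "c \<in> cball 0 (R+1)" using cR by simp
          then have "cmod (poly (f b) c - poly (q b) c) < \<kappa>" using elim(1) by blast
          then show ?thesis using \<kappa>(2) by (simp add: dist_norm)
        qed
        moreover have "infdist (poly (f b) c) Pc \<le> infdist (poly (q b) c) Pc + dist (poly (f b) c) (poly (q b) c)"
          by (rule infdist_triangle)
        ultimately show "infdist (poly (f b) c) Pc < \<delta>" by linarith
      qed
    qed
  qed
  then show ?thesis by (simp add: eventually_all_finite)
qed

text \<open>
  Words of length between \<open>N\<close> and \<open>2 N\<close> are finitely many, so nearby pairs still map the neighbourhood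
  into itself under these words, and longer words are products of such.
\<close>

lemma near_pairs_trap:
  obtains \<delta> M where "\<delta> > 0"
    "\<forall>\<^sub>F f in near_pairs q. \<forall>w z. infdist z Pc < \<delta> \<longrightarrow> cmod (poly (word_poly f w) z) \<le> M"
proof -
  obtain N0 \<delta> where \<delta>: "\<delta> > 0" and contr:
    "\<And>w x z. length w \<ge> N0 \<Longrightarrow> x \<in> Pc \<Longrightarrow> cmod (z - x) < \<delta> \<Longrightarrow> cmod (g w z - g w x) \<le> cmod (z - x) / 2"
    using contraction_near_Pc by metis
  \<comment> \<open>A positive length, so that removing a prefix of length \<open>N\<close> shortens the word.\<close>
  define N where "N = Suc N0"
  \<comment> \<open>The trap. Long words of the given pair even map it into the half as wide neighbourhood.\<close>
  define V where "V = {z. infdist z Pc < \<delta>}"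
  have near: "\<exists>x\<in>Pc. cmod (z - x) < \<delta>" if "z \<in> V" for z
    using that infdist_attains_inf[OF closed_Pc Pc_nonempty, of z] unfolding V_def by (metis dist_norm mem_Collect_eq)
  have VR: "V \<subseteq> cball 0 (R + \<delta>)"
  proof
    fix z assume "z \<in> V"
    then obtain x where "x \<in> Pc" "cmod (z - x) < \<delta>" using near by blast
    then show "z \<in> cball 0 (R + \<delta>)" using Pc_less_R[of x] norm_triangle_ineq2[of z x] by simp
  qed
  have gV: "infdist (g w z) Pc < \<delta> / 2" if w: "length w \<ge> N" and z: "z \<in> V" for w z
  proof -
    obtain x where x: "x \<in> Pc" "cmod (z - x) < \<delta>" using near[OF z] by blast
    have "infdist (g w z) Pc \<le> dist (g w z) (g w x)" by (rule infdist_le) (rule Pc_forward[OF x(1)])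
    also have "\<dots> \<le> cmod (z - x) / 2" unfolding dist_norm using contr[OF _ x] w by (simp add: N_def)
    finally show ?thesis using x(2) by simp
  qed
  let ?W = "{w :: bool list. length w \<le> 2 * N}"
  have finW: "finite ?W" using finite_lists_length_le[of "UNIV :: bool set" "2 * N"] by simp
  have "\<exists>M. \<forall>z\<in>cball 0 (R + \<delta>). cmod (g w z) \<le> M" for w
  proof -
    have "bounded (g w ` cball 0 (R + \<delta>))"
      by (intro compact_imp_bounded compact_continuous_image) (auto intro: continuous_intros)
    then show ?thesis unfolding bounded_iff by blast
  qed
  then obtain B where B: "\<And>w z. z \<in> cball 0 (R + \<delta>) \<Longrightarrow> cmod (g w z) \<le> B w" by metis
  define M where "M = Max (insert 0 (B ` ?W)) + \<delta> + R"
  have BM: "B w + \<delta> \<le> M" if "w \<in> ?W" for w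
  proof -
    have "B w \<le> Max (insert 0 (B ` ?W))" using finW that by (intro Max_ge) auto
    then show ?thesis using R1 by (simp add: M_def)
  qed
  have "\<forall>w\<in>?W. \<forall>\<^sub>F f in near_pairs q. \<forall>z\<in>cball 0 (R + \<delta>). cmod (poly (word_poly f w) z - g w z) < \<delta> / 2"
    by (intro ballI uniform_limit_eventually_close[OF near_pairs_uniform_limit_word]) (use \<delta> in simp)
  then have ev: "\<forall>\<^sub>F f in near_pairs q. \<forall>w\<in>?W. \<forall>z\<in>cball 0 (R + \<delta>). cmod (poly (word_poly f w) z - g w z) < \<delta> / 2"
    by (rule eventually_ball_finite[OF finW])
  have "\<forall>\<^sub>F f in near_pairs q. \<forall>w z. infdist z Pc < \<delta> \<longrightarrow> cmod (poly (word_poly f w) z) \<le> M"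
    using ev near_pairs_poly_pair
  proof eventually_elim
    case (elim f)
    interpret f: poly_pair f R by (rule elim(2))
    have cl: "cmod (f.g w z - g w z) < \<delta> / 2" if "length w \<le> 2 * N" "z \<in> V" for w z
      using elim(1) that VR by blast
    have trap: "f.g w z \<in> V" if "length w \<ge> N" "z \<in> V" for w z
      using that
    proof (induction "length w" arbitrary: w z rule: less_induct)
      case less
      show ?case
      proof (cases "length w \<le> 2 * N")
        case True
        have "infdist (f.g w z) Pc \<le> infdist (g w z) Pc + dist (f.g w z) (g w z)" by (rule infdist_triangle)
        also have "\<dots> < \<delta>" using gV[OF less.prems] cl[OF True less.prems(2)] by (simp add: dist_norm)
        finally show ?thesis by (simp add: V_def)
      next
        case False
        let ?u = "take N w" and ?v = "drop N w"
        have u: "f.g ?u z \<in> V" by (rule less.hyps) (use False less.prems in auto)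
        have "f.g ?v (f.g ?u z) \<in> V" by (rule less.hyps) (use False u in \<open>auto simp: N_def\<close>)
        then show ?thesis using f.g_append[of ?u ?v z] by simp
      qed
    qed
    show ?case
    proof (intro allI impI)
      fix w z assume "infdist z Pc < \<delta>"
      then have z: "z \<in> V" by (simp add: V_def)
      show "cmod (f.g w z) \<le> M"
      proof (cases "length w \<le> 2 * N")
        case True
        have "cmod (f.g w z) \<le> cmod (g w z) + \<delta>"
          using cl[OF True z] norm_triangle_ineq2[of "f.g w z" "g w z"] \<delta> by linarith
        moreover have "cmod (g w z) \<le> B w" by (rule B) (use VR z in blast)
        moreover have "B w + \<delta> \<le> M" by (rule BM) (use True in simp)
        ultimately show ?thesis by linarith
      next
        case False
        then have "f.g w z \<in> V" using trap[OF _ z, of w] by simp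
        then have "cmod (f.g w z) \<le> R + \<delta>" using VR by auto
        moreover have "Max (insert 0 (B ` ?W)) \<ge> 0" using finW by (intro Max_ge) auto
        ultimately show ?thesis unfolding M_def by linarith
      qed
    qed
  qed
  then show ?thesis by (rule that[OF \<delta>])
qed

lemma near_pairs_bounded: "\<forall>\<^sub>F f in near_pairs q. poly_pair_bounded f R"
proof -
  obtain \<delta> M where \<delta>: "\<delta> > 0" and trap:
    "\<forall>\<^sub>F f in near_pairs q. \<forall>w z. infdist z Pc < \<delta> \<longrightarrow> cmod (poly (word_poly f w) z) \<le> M"
    by (rule near_pairs_trap)
  show ?thesis using trap near_pairs_critical_values[OF \<delta>] near_pairs_poly_pair
  proof eventually_elim
    case (elim f)
    interpret f: poly_pair f R by (rule elim(3))
    have "cmod (f.g w c) \<le> M" if c: "poly (pderiv (f.wp w)) c = 0" for w c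
    proof -
      obtain u b v where w: "w = u @ b # v" "poly (pderiv (f b)) (f.g u c) = 0" using f.critical_letter[OF c] by blast
      have "infdist (poly (f b) (f.g u c)) Pc < \<delta>" using elim(2) w(2) by blast
      then have "cmod (f.g v (poly (f b) (f.g u c))) \<le> M" using elim(1) by blast
      then show ?thesis using w(1) by (simp add: f.g_append poly_pcompose)
    qed
    then have "{f.g w c |w c. w \<noteq> [] \<and> poly (pderiv (f.wp w)) c = 0} \<subseteq> cball 0 M" by auto
    then have "bounded f.Pc" unfolding f.Pc_closure by (intro bounded_closure) (rule bounded_subset[OF bounded_cball])
    then show ?case by unfold_locales
  qed
qed

lemma near_pairs_not_filled:
  assumes x: "x \<notin> K b"
  obtains d where "d > 0" "\<forall>\<^sub>F f in near_pairs q. \<forall>x'\<in>ball x d. x' \<notin> filled (f b)"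
proof -
  obtain n where n: "cmod (g (replicate n b) x) > R" using not_filled_escapes[OF x] by metis
  define s where "s = (cmod (g (replicate n b) x) - R) / 2"
  have s: "s > 0" using n by (simp add: s_def)
  have "isCont (g (replicate n b)) x" by (intro continuous_intros)
  then obtain d where d: "d > 0" "\<And>x'. dist x' x < d \<Longrightarrow> dist (g (replicate n b) x') (g (replicate n b) x) < s"
    using s unfolding continuous_at_eps_delta by (metis dist_norm)
  have "\<forall>\<^sub>F f in near_pairs q. \<forall>z\<in>cball 0 (cmod x + d). cmod (poly (word_poly f (replicate n b)) z - g (replicate n b) z) < s"
    by (rule uniform_limit_eventually_close[OF near_pairs_uniform_limit_word s])
  then have "\<forall>\<^sub>F f in near_pairs q. \<forall>x'\<in>ball x d. x' \<notin> filled (f b)"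
    using near_pairs_poly_pair
  proof eventually_elim
    case (elim f)
    interpret f: poly_pair f R by (rule elim(2))
    show ?case
    proof
      fix x' assume x': "x' \<in> ball x d"
      have "cmod x' \<le> cmod x + d" using x' norm_triangle_ineq2[of x' x] by (simp add: dist_norm norm_minus_commute)
      then have 1: "cmod (f.g (replicate n b) x' - g (replicate n b) x') < s" using elim(1) by simp
      have 2: "cmod (g (replicate n b) x' - g (replicate n b) x) < s" using d(2)[of x'] x' by (simp add: dist_norm norm_minus_commute)
      have "cmod (g (replicate n b) x) \<le> cmod (f.g (replicate n b) x') + cmod (f.g (replicate n b) x' - g (replicate n b) x')
          + cmod (g (replicate n b) x' - g (replicate n b) x)"
        using norm_triangle_ineq2[of "g (replicate n b) x" "g (replicate n b) x'"]
          norm_triangle_ineq2[of "g (replicate n b) x'" "f.g (replicate n b) x'"] by (simp add: norm_minus_commute)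
      then have "cmod (f.g (replicate n b) x') > R" using 1 2 by (simp add: s_def)
      then show "x' \<notin> filled (f b)" using f.filled_iff[of x' b] not_le by blast
    qed
  qed
  then show ?thesis by (rule that[OF d(1)])
qed

text \<open>
  The orbit of \<open>x\<close> reaches the trap after finitely many steps; this persists under perturbation.
\<close>

lemma near_pairs_filled:
  assumes x: "x \<in> interior (K b)"
  obtains d where "d > 0" "\<forall>\<^sub>F f in near_pairs q. \<forall>x'\<in>ball x d. x' \<in> filled (f b)"
proof -
  obtain \<delta> M where \<delta>: "\<delta> > 0" and trap:
    "\<forall>\<^sub>F f in near_pairs q. \<forall>w z. infdist z Pc < \<delta> \<longrightarrow> cmod (poly (word_poly f w) z) \<le> M"
    by (rule near_pairs_trap)
  have \<delta>3: "\<delta> / 3 > 0" using \<delta> by simp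
  obtain m p where p: "p \<in> Pc" "cmod (g (replicate m b) x - p) < \<delta> / 3"
    using filled_interior_attracted[OF x \<delta>3] by metis
  have "isCont (g (replicate m b)) x" by (intro continuous_intros)
  then obtain d where d: "d > 0" "\<And>x'. dist x' x < d \<Longrightarrow> dist (g (replicate m b) x') (g (replicate m b) x) < \<delta> / 3"
    using \<delta>3 unfolding continuous_at_eps_delta by (metis dist_norm)
  have "\<forall>\<^sub>F f in near_pairs q. \<forall>z\<in>cball 0 (cmod x + d). cmod (poly (word_poly f (replicate m b)) z - g (replicate m b) z) < \<delta> / 3"
    by (rule uniform_limit_eventually_close[OF near_pairs_uniform_limit_word \<delta>3])
  then have "\<forall>\<^sub>F f in near_pairs q. \<forall>x'\<in>ball x d. x' \<in> filled (f b)"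
    using near_pairs_poly_pair trap
  proof eventually_elim
    case (elim f)
    interpret f: poly_pair f R by (rule elim(2))
    show ?case
    proof
      fix x' assume x': "x' \<in> ball x d"
      let ?y = "f.g (replicate m b) x'"
      have "cmod x' \<le> cmod x + d" using x' norm_triangle_ineq2[of x' x] by (simp add: dist_norm norm_minus_commute)
      then have 1: "dist ?y (g (replicate m b) x') < \<delta> / 3" using elim(1) by (simp add: dist_norm)
      have 2: "dist (g (replicate m b) x') (g (replicate m b) x) < \<delta> / 3" using d(2)[of x'] x' by (simp add: dist_commute)
      have "infdist ?y Pc \<le> dist ?y p" by (rule infdist_le[OF p(1)])
      also have "\<dots> < \<delta>"
        using 1 2 p(2) dist_triangle[of ?y p "g (replicate m b) x'"]
          dist_triangle[of "g (replicate m b) x'" p "g (replicate m b) x"] by (simp add: dist_norm)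
      finally have "cmod (f.g (replicate n b) ?y) \<le> M" for n using elim(3) by blast
      then have "?y \<in> filled (f b)" by (auto simp: filled_def bounded_iff f.g_replicate)
      then show "x' \<in> filled (f b)" by (simp add: f.filled_word_vimage)
    qed
  qed
  then show ?thesis by (rule that[OF d(1)])
qed

text \<open>
  The postcritical points are interior points, and backward orbits of a disc accumulate at every
  frontier point.
\<close>

lemma closure_interior_filled: "closure (interior (K b)) = K b"
proof
  show "closure (interior (K b)) \<subseteq> K b" using closed_filled by (simp add: closure_minimal interior_subset)
  obtain a where a: "a \<in> Pc" using Pc_nonempty by blast
  have "Fin a \<in> Fatou G" using a hyperbolic_G by (auto simp: Pc_def)
  then have "a \<notin> frontier (K b)" using frontier_not_Fatou[of "[]" a b] by auto
  then have ai: "a \<in> interior (K b)" using Pc_in_filled[OF a, of b] closed_filled by (simp add: frontier_def)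
  then obtain s where s: "s > 0" "ball a s \<subseteq> interior (K b)" by (meson openE open_interior)
  define c where "c = a + of_real (s/2)"
  have c: "c \<in> interior (K b)" "a \<noteq> c" using s by (auto simp: c_def dist_norm subset_iff)
  have pull: "v \<in> interior (K b)" if "g (replicate k b) v \<in> interior (K b)" for k v
    using that
  proof (induction k arbitrary: v)
    case (Suc k)
    then have "poly (q b) v \<in> interior (K b)" by (simp add: poly_pcompose)
    then show ?case by (simp add: interior_filled_vimage)
  qed simp
  show "K b \<subseteq> closure (interior (K b))"
  proof
    fix x assume x: "x \<in> K b"
    show "x \<in> closure (interior (K b))"
    proof (cases "x \<in> interior (K b)")
      case True then show ?thesis using closure_subset by blast
    next
      case False
      then have fr: "x \<in> frontier (K b)" using x closed_filled by (simp add: frontier_def)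
      show ?thesis
        unfolding closure_approachable
      proof (intro allI impI)
        fix e :: real assume e: "e > 0"
        obtain k v where v: "v \<in> ball x e" "g (replicate k b) v = a \<or> g (replicate k b) v = c"
          using backward_orbit_dense[OF fr e c(2)] by metis
        then have "v \<in> interior (K b)" using pull ai c(1) by metis
        then show "\<exists>y\<in>interior (K b). dist y x < e" using v(1) by (auto simp: dist_commute)
      qed
    qed
  qed
qed

text \<open>
  For interior points of \<open>K False\<close> the second condition passes to the limit, as membership persists
  under perturbation and so does nonmembership; the other points of \<open>K False\<close> are limits of
  interior points.
\<close>

lemma ordered_limit:
  assumes freq: "\<exists>\<^sub>F f in near_pairs q. poly_pair.ordered f"
  shows ordered
proof -
  have freq': "\<exists>\<^sub>F f in near_pairs q. poly_pair.ordered f \<and> poly_pair f R"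
    using eventually_frequently_simps(1)[THEN iffD1] frequently_eventually_frequently[OF freq near_pairs_poly_pair] by simp
  have contr: False if ev: "\<forall>\<^sub>F f in near_pairs q. P f"
    and no: "\<And>f. P f \<Longrightarrow> poly_pair f R \<Longrightarrow> poly_pair.ordered f \<Longrightarrow> False" for P
  proof -
    obtain f where "poly_pair.ordered f \<and> poly_pair f R" "P f"
      using frequently_ex[OF frequently_eventually_frequently[OF freq' ev]] by blast
    then show False using no by blast
  qed
  have "interior (K True) \<subseteq> K False"
  proof (rule ccontr)
    assume "\<not> interior (K True) \<subseteq> K False"
    then obtain z where z: "z \<in> interior (K True)" "z \<notin> K False" by blast
    obtain d1 where d1: "d1 > 0" "\<forall>\<^sub>F f in near_pairs q. \<forall>x'\<in>ball z d1. x' \<in> filled (f True)"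
      by (rule near_pairs_filled[OF z(1)])
    obtain d2 where d2: "d2 > 0" "\<forall>\<^sub>F f in near_pairs q. \<forall>x'\<in>ball z d2. x' \<notin> filled (f False)"
      by (rule near_pairs_not_filled[OF z(2)])
    have "\<forall>\<^sub>F f in near_pairs q. z \<in> filled (f True) \<and> z \<notin> filled (f False)"
      using d1(2) d2(2) by eventually_elim (use d1(1) d2(1) in auto)
    then show False by (rule contr) (auto simp: poly_pair.ordered_def)
  qed
  then have 1: "K True \<subseteq> K False"
    using closure_minimal[OF _ closed_filled] closure_interior_filled[of True] by metis
  have "poly (q True) -` interior (K False) \<subseteq> poly (q False) -` K True"
  proof (rule ccontr)
    assume "\<not> poly (q True) -` interior (K False) \<subseteq> poly (q False) -` K True"
    then obtain z where z: "poly (q True) z \<in> interior (K False)" "poly (q False) z \<notin> K True" by blast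
    obtain d1 where d1: "d1 > 0" "\<forall>\<^sub>F f in near_pairs q. \<forall>x'\<in>ball (poly (q True) z) d1. x' \<in> filled (f False)"
      by (rule near_pairs_filled[OF z(1)])
    obtain d2 where d2: "d2 > 0" "\<forall>\<^sub>F f in near_pairs q. \<forall>x'\<in>ball (poly (q False) z) d2. x' \<notin> filled (f True)"
      by (rule near_pairs_not_filled[OF z(2)])
    have c: "\<forall>\<^sub>F f in near_pairs q. \<forall>y\<in>cball 0 (cmod z). cmod (poly (f b) y - poly (q b) y) < e" if "e > 0" for b e
      by (rule uniform_limit_eventually_close[OF near_pairs_uniform_limit that])
    have "\<forall>\<^sub>F f in near_pairs q. poly (f True) z \<in> filled (f False) \<and> poly (f False) z \<notin> filled (f True)"
      using c[OF d1(1), of True] c[OF d2(1), of False] d1(2) d2(2)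
    proof eventually_elim
      case (elim f)
      have "poly (f True) z \<in> ball (poly (q True) z) d1" "poly (f False) z \<in> ball (poly (q False) z) d2"
        using elim(1,2) by (auto simp: dist_norm norm_minus_commute)
      then show ?case using elim(3,4) by blast
    qed
    then show False by (rule contr) (auto simp: poly_pair.ordered_def)
  qed
  moreover have "closed (poly (q False) -` K True)"
    using closed_filled by (intro closed_vimage) (auto intro: continuous_intros)
  ultimately have "closure (poly (q True) -` interior (K False)) \<subseteq> poly (q False) -` K True"
    by (rule closure_minimal)
  then have "poly (q True) -` K False \<subseteq> poly (q False) -` K True"
    using closure_poly_vimage[of "q True" "interior (K False)"] deg[of True] closure_interior_filled[of False] by simp
  then show ?thesis using 1 by (auto simp: ordered_def)
qed

text \<open>
  One of the two orders occurs for pairs arbitrarily close to the given one.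
\<close>

theorem disconnected_limit_imp_ordered:
  assumes freq: "\<exists>\<^sub>F f in near_pairs q. \<not> connected (Julia (generated_semigroup {poly_map (f True), poly_map (f False)}))"
  shows "ordered \<or> poly_pair.ordered (\<lambda>b. q (\<not> b))"
proof -
  have "\<exists>\<^sub>F f in near_pairs q. poly_pair.ordered f \<or> poly_pair.ordered (\<lambda>b. f (\<not> b))"
    using frequently_eventually_frequently[OF freq near_pairs_bounded]
  proof (rule frequently_elim1)
    fix f assume f: "\<not> connected (Julia (generated_semigroup {poly_map (f True), poly_map (f False)})) \<and> poly_pair_bounded f R"
    interpret f: poly_pair_bounded f R using f by blast
    show "poly_pair.ordered f \<or> poly_pair.ordered (\<lambda>b. f (\<not> b))"
      using f.disconnected_imp_ordered f f.connected_Julia_iff by blast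
  qed
  then consider "\<exists>\<^sub>F f in near_pairs q. poly_pair.ordered f" | "\<exists>\<^sub>F f in near_pairs q. poly_pair.ordered (\<lambda>b. f (\<not> b))"
    by (auto simp: frequently_disj_iff)
  then show ?thesis
  proof cases
    case 1
    then show ?thesis using ordered_limit by blast
  next
    case 2
    interpret S: poly_pair "\<lambda>b. q (\<not> b)" R by unfold_locales (use deg R1 esc in auto)
    have SG: "S.G = G" by (simp add: insert_commute)
    interpret S: poly_pair_perturbation "\<lambda>b. q (\<not> b)" R
    proof unfold_locales
      show "bounded S.Pc" using bounded_Pc unfolding S.Pc_def Pc_def SG .
      show "postcritical S.G \<subseteq> Fatou S.G" unfolding SG by (rule hyperbolic_G)
      show "3 * cmod z \<le> cmod (poly (q (\<not> b)) z)" if "R \<le> cmod z" for z b using esc3[OF that] .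
    qed
    have "\<exists>\<^sub>F f in near_pairs (\<lambda>b. q (\<not> b)). poly_pair.ordered f"
    proof (rule ccontr)
      assume "\<not> (\<exists>\<^sub>F f in near_pairs (\<lambda>b. q (\<not> b)). poly_pair.ordered f)"
      then have "\<forall>\<^sub>F f in near_pairs (\<lambda>b. q (\<not> b)). \<not> poly_pair.ordered f" by (simp add: frequently_def)
      then obtain \<epsilon> where \<epsilon>: "\<epsilon> > 0"
        "\<And>f. \<forall>b. degree (f b) \<ge> 2 \<and> kappa (poly_map (q (\<not> b))) (poly_map (f b)) < \<epsilon> \<Longrightarrow> \<not> poly_pair.ordered f"
        unfolding eventually_near_pairs by blast
      have "\<forall>\<^sub>F f in near_pairs q. \<not> poly_pair.ordered (\<lambda>b. f (\<not> b))"
        unfolding eventually_near_pairs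
      proof (intro exI conjI allI impI)
        fix f assume "\<forall>b. degree (f b) \<ge> 2 \<and> kappa (poly_map (q b)) (poly_map (f b)) < \<epsilon>"
        then show "\<not> poly_pair.ordered (\<lambda>b. f (\<not> b))" by (intro \<epsilon>(2)) simp
      qed (rule \<epsilon>(1))
      then show False using 2 by (simp add: frequently_def)
    qed
    then show ?thesis using S.ordered_limit by blast
  qed
qed

end

section \<open>Boundary points of the connectedness locus\<close>

lemma tend_prob_swap: "tend_prob h2 h1 (1 - p) = tend_prob h1 h2 p"
proof -
  have "tau h2 h1 (1 - p) = tau h1 h2 p"
    unfolding tau_def by (simp add: insert_commute add.commute)
  then show ?thesis unfolding tend_prob_def fun_eq_iff by simp
qed

lemma frontier_setC_disconnected_nearby:
  assumes fr: "(poly_map (q True), poly_map (q False)) \<in> poly_maps2_topology frontier_of setC"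
  shows "\<exists>\<^sub>F f in near_pairs q. \<not> connected (Julia (generated_semigroup {poly_map (f True), poly_map (f False)}))"
proof (rule ccontr)
  assume "\<not> ?thesis"
  then have "\<forall>\<^sub>F f in near_pairs q. connected (Julia (generated_semigroup {poly_map (f True), poly_map (f False)}))"
    by (simp add: frequently_def)
  then obtain \<epsilon> where \<epsilon>: "\<epsilon> > 0"
    "\<And>f. \<forall>b. degree (f b) \<ge> 2 \<and> kappa (poly_map (q b)) (poly_map (f b)) < \<epsilon> \<Longrightarrow>
      connected (Julia (generated_semigroup {poly_map (f True), poly_map (f False)}))"
    unfolding eventually_near_pairs by blast
  interpret Metric_space poly_maps kappa by (rule Metric_space_poly_maps)
  let ?U = "mball (poly_map (q True)) \<epsilon> \<times> mball (poly_map (q False)) \<epsilon>"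
  have "(poly_map (q True), poly_map (q False)) \<in> topspace poly_maps2_topology"
    by (rule subsetD[OF frontier_of_subset_topspace fr])
  then have mem: "poly_map (q True) \<in> poly_maps" "poly_map (q False) \<in> poly_maps"
    by (auto simp: topspace_poly_maps2_topology)
  have op: "openin poly_maps2_topology ?U"
    unfolding poly_maps2_topology_def by (simp add: openin_prod_Times_iff)
  have "?U \<subseteq> setC"
  proof
    fix x assume x: "x \<in> ?U"
    have "fst x \<in> poly_maps" "snd x \<in> poly_maps" using x by auto
    then obtain f1 f2 where f: "fst x = poly_map f1" "degree f1 \<ge> 2" "snd x = poly_map f2" "degree f2 \<ge> 2"
      unfolding poly_maps_def by blast
    define f where "f b = (if b then f1 else f2)" for b
    have "\<forall>b. degree (f b) \<ge> 2 \<and> kappa (poly_map (q b)) (poly_map (f b)) < \<epsilon>"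
      using x f by (auto simp: f_def in_mball)
    then have "connected (Julia (generated_semigroup {poly_map (f True), poly_map (f False)}))" by (rule \<epsilon>(2))
    moreover have "poly_map f1 \<in> poly_maps" "poly_map f2 \<in> poly_maps" using f by (auto simp: poly_maps_def)
    ultimately show "x \<in> setC" using f by (cases x) (simp add: setC_def f_def)
  qed
  then have "?U \<subseteq> poly_maps2_topology interior_of setC" using op by (rule interior_of_maximal)
  moreover have "(poly_map (q True), poly_map (q False)) \<in> ?U" using mem \<epsilon>(1) by simp
  ultimately show False using fr unfolding frontier_of_def by blast
qed

lemma poly_pair_of_setB:
  assumes "(h1, h2) \<in> setB"
  obtains q R where "h1 = poly_map (q True)" "h2 = poly_map (q False)" "poly_pair_bounded q R"
    "\<And>b z. cmod z \<ge> R \<Longrightarrow> cmod (poly (q b) z) \<ge> 3 * cmod z"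
proof -
  obtain f1 f2 where f: "h1 = poly_map f1" "degree f1 \<ge> 2" "h2 = poly_map f2" "degree f2 \<ge> 2"
    and bd: "bounded {z. Fin z \<in> postcritical_fin (generated_semigroup {h1, h2})}"
    using assms by (auto simp: setB_def poly_maps_def)
  obtain R1 where R1: "R1 \<ge> 1" "\<And>z. cmod z \<ge> R1 \<Longrightarrow> cmod (poly f1 z) \<ge> 3 * cmod z"
    using escape_radius_exists[OF f(2)] by metis
  obtain R2 where R2: "R2 \<ge> 1" "\<And>z. cmod z \<ge> R2 \<Longrightarrow> cmod (poly f2 z) \<ge> 3 * cmod z"
    using escape_radius_exists[OF f(4)] by metis
  define q where "q b = (if b then f1 else f2)" for b
  define R where "R = max R1 R2"
  have e3: "cmod (poly (q b) z) \<ge> 3 * cmod z" if "cmod z \<ge> R" for b z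
    using that R1 R2 by (auto simp: q_def R_def)
  interpret poly_pair q R
  proof
    show "2 \<le> degree (q b)" for b using f by (simp add: q_def)
    show "1 \<le> R" using R1 by (simp add: R_def)
    show "2 * cmod z \<le> cmod (poly (q b) z)" if "R \<le> cmod z" for b z
      using e3[OF that, of b] norm_ge_zero[of z] by linarith
  qed
  have "bounded Pc" using bd f by (simp add: Pc_def postcritical_fin_def q_def)
  then have "poly_pair_bounded q R" by unfold_locales
  then show ?thesis using that[of q R] f e3 by (simp add: q_def)
qed

lemma ordered_of_theorem_hypotheses:
  assumes "(h1, h2) \<in> setD \<inter> setB \<union> (poly_maps2_topology frontier_of setC) \<inter> setB \<inter> setH"
  obtains q R where "h1 = poly_map (q True)" "h2 = poly_map (q False)" "poly_pair q R"
    "poly_pair.ordered q \<or> poly_pair.ordered (\<lambda>b. q (\<not> b))"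
proof -
  have "(h1, h2) \<in> setB" using assms by blast
  then obtain q R where h: "h1 = poly_map (q True)" "h2 = poly_map (q False)" and B: "poly_pair_bounded q R"
    and e3: "\<And>b z. cmod z \<ge> R \<Longrightarrow> cmod (poly (q b) z) \<ge> 3 * cmod z"
    using poly_pair_of_setB by metis
  interpret poly_pair_bounded q R by (rule B)
  have "ordered \<or> poly_pair.ordered (\<lambda>b. q (\<not> b))"
  proof (cases "(h1, h2) \<in> setD")
    case True
    then show ?thesis using disconnected_imp_ordered connected_Julia_iff by (auto simp: setD_def h)
  next
    case False
    then have fr: "(h1, h2) \<in> poly_maps2_topology frontier_of setC" and H: "(h1, h2) \<in> setH" using assms by auto
    interpret poly_pair_perturbation q R
      by unfold_locales (use H e3 in \<open>auto simp: setH_def hyperbolic_def h\<close>)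
    show ?thesis
      using disconnected_limit_imp_ordered frontier_setC_disconnected_nearby fr unfolding h by blast
  qed
  then show ?thesis using that h poly_pair_axioms by blast
qed

theorem theorem1p8:
  shows
    "(\<forall>h1 h2 p. (h1, h2) \<in> (setD \<inter> setB) \<union> ((poly_maps2_topology frontier_of setC) \<inter> setB \<inter> setH)
        \<and> 0 < p \<and> p < 1 \<longrightarrow>
        Julia (generated_semigroup {h1, h2}) =
          {z0. \<forall>U. open U \<and> z0 \<in> U \<longrightarrow> \<not> (tend_prob h1 h2 p) constant_on U})
     \<and>
     (\<forall>h1 h2 p. (h1, h2) \<in> (poly_maps2_topology frontier_of setC) \<inter> setB \<inter> setH
        \<and> 0 < p \<and> p < 1 \<longrightarrow>
        (continuous_on UNIV (tend_prob h1 h2 p) \<longleftrightarrow>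
          Julia (generated_semigroup {h1}) \<inter> Julia (generated_semigroup {h2}) = {}))"
proof -
  have main: "Julia (generated_semigroup {h1, h2}) =
          {z0. \<forall>U. open U \<and> z0 \<in> U \<longrightarrow> \<not> (tend_prob h1 h2 p) constant_on U} \<and>
      (continuous_on UNIV (tend_prob h1 h2 p) \<longleftrightarrow>
          Julia (generated_semigroup {h1}) \<inter> Julia (generated_semigroup {h2}) = {})"
    if hyp: "(h1, h2) \<in> setD \<inter> setB \<union> (poly_maps2_topology frontier_of setC) \<inter> setB \<inter> setH"
      and p: "0 < p" "p < 1" for h1 h2 p
  proof -
    obtain q R where h: "h1 = poly_map (q True)" "h2 = poly_map (q False)" and P: "poly_pair q R"
      and o: "poly_pair.ordered q \<or> poly_pair.ordered (\<lambda>b. q (\<not> b))"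
      using ordered_of_theorem_hypotheses[OF hyp] by metis
    interpret poly_pair q R by (rule P)
    interpret S: poly_pair "\<lambda>b. q (\<not> b)" R by unfold_locales (use deg R1 esc in auto)
    have J: "Julia (generated_semigroup {h1}) \<inter> Julia (generated_semigroup {h2}) = {} \<longleftrightarrow>
        frontier (K True) \<inter> frontier (K False) = {}"
      unfolding h Julia_single[OF deg] by auto
    from o show ?thesis
    proof
      assume ordered
      then show ?thesis using ordered_Julia_eq[OF p] ordered_continuous_iff[OF p] J by (simp add: h)
    next
      assume o': "poly_pair.ordered (\<lambda>b. q (\<not> b))"
      have p': "0 < 1 - p" "1 - p < 1" using p by auto
      have T: "tend_prob h1 h2 p = S.T (1 - p)" using tend_prob_swap[of h2 h1 p] by (simp add: h)
      have G: "generated_semigroup {h1, h2} = S.G" by (simp add: h insert_commute)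
      have "Julia (generated_semigroup {h1, h2}) =
          {z0. \<forall>U. open U \<and> z0 \<in> U \<longrightarrow> \<not> (tend_prob h1 h2 p) constant_on U}"
        unfolding T G by (rule S.ordered_Julia_eq[OF p' o'])
      moreover have "continuous_on UNIV (tend_prob h1 h2 p) \<longleftrightarrow>
          Julia (generated_semigroup {h1}) \<inter> Julia (generated_semigroup {h2}) = {}"
        unfolding T J using S.ordered_continuous_iff[OF p' o'] by (simp add: Int_commute)
      ultimately show ?thesis by (rule conjI)
    qed
  qed
  show ?thesis using main by blast
qed

end
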